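(* The subgroup $K=q_{\#}(\pi_1(\widehat{\mathbb{H}},\mathbf 1))$ of $\pi_1(\mathbb{H},\mathbf 0)$ does not contain any nontrivial normal subgroup of $\pi_1(\mathbb{H},\mathbf 0)$.
   Context: **Hawaiian Earring.** $\mathbb{H}=\bigcup_{i\in\mathbb N}C_i\subseteq\mathbb R^2$ with $C_i=\{(x,y)\in\mathbb{R}^2: x^2+(y-1/i)^2=1/i^2\}$, $i=1,2,3,\dots$, with the subspace topology and base point $\mathbf 0=(0,0)$. Let $l_i:[0,1]\to C_i$, $l_i(t)=((\sin 2\pi t)/i,(1-\cos 2\pi t)/i)$. **Words and Cayley tree.** Let $\mathcal W_n$ be the set of finite words over $\{a_1^{\pm1},\dots,a_n^{\pm1}\}$ and $\mathcal W=\bigcup_n\mathcal W_n$. For $w\in\mathcal W$, $w'$ is its complete free reduction and $|w|$ its length; $\mathbf 1$ denotes the empty word. Let $\Gamma$ be the directed Cayley graph of the free group on $\{a_1,a_2,\dots\}$: the vertex set $V$ is the set of reduced words, and there is a directed edge labeled $a_i$ from $u$ to $(ua_i)'$ for every $u\in V$, $i\in\mathbb N$. The underlying undirected graph is a tree. Fix a complete list $w_1,w_2,w_3,\dots$ of all non-empty words in $\mathcal W$. For each $j$ let $\widehat w_j=a_1a_2a_1a_2\cdots\in V$ be the word with letters alternating between $a_1$ and $a_2$ (starting with $a_1$) of length $|\widehat w_j|=2(|w_1|+\cdots+|w_{j-1}|)+3j+|w_j|$. **The graph $\widehat{\mathbb H}$.** Step 1: If $w_j=x_1x_2\cdots x_m$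 with letters $x_i$, let $Z_j=\{(\widehat w_jx_1\cdots x_i)': 0\le i\le m\}$. Let $Z$ be the set of vertices of the infinite ray in $\Gamma$ starting at $\mathbf 1$ and following the edges $a_1,a_2,a_1,a_2,\dots$. Step 2: Let $n=n(j)\ge2$ be minimal with $w_j\in\mathcal W_n$. For $u\in Z_j$ and $1\le s\le n$ let $L_{u,s}=\{(ua_s^r)': r\in\mathbb Z\}$. Let $Y_j=Z_j\cup\bigcup_{u\in Z_j,\,1\le s\le n}L_{u,s}$ and $Y=Z\cup\bigcup_jY_j$. (The sets $Y_j$ are pairwise disjoint.) Step 3: Let $\Gamma_0=\Gamma$. Inductively, $\Gamma_j$ is obtained from $\Gamma_{j-1}$ by removing all vertices $v$ at edge-distance $1$ from $Y_j$, unless $v$ is connected to $Y_j$ by an edge labeled $a_1$ or $a_2$ (in either direction), along with all edges incident to $v$ and all vertices and edges of $\Gamma_{j-1}$ separated from $Y_j$ in $\Gamma_{j-1}$ by $v$. Each $\Gamma_j$ is a subtree containing $Y$. Step 4: $\Gamma^*$ is obtained from $\bigcap_j\Gamma_j$ by removing all vertices $v$ (and incident edges) of the reduced form $v=ua_k^{\pm1}w$, where $u$ is a vertex of $\bigcap_j\Gamma_j$ of infinite valence, $k\notin\{1,2\}$ and $w\in\mathcal W$. For every vertex $v$ of the tree $\Gamma^*$ there is a finite set $E_v\subseteq\mathbb N$ such that the directed edges of $\Gamma^*$ terminating at $v$ are labeled exactly by $\{a_i:i\in E_v\}$ (one each), and likewise for the directed edges emanating from $v$. Step 5: For every vertex $v$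 of $\Gamma^*$ and every $i\in\mathbb N\setminus E_v$ add a directed loop from $v$ to $v$ labeled $a_i$. The geometric realization of the resulting graph is $\widehat{\mathbb H}$, with base point the vertex $\mathbf 1$. **The map $q$ and the topology of $\widehat{\mathbb H}$.** In $\mathbb H$ put $V_i^-=l_i([0,3/8))$, $V_i^+=l_i((5/8,1])$, $U_i=l_i((1/4,3/4))$ and $U_{n+1}^\infty=\bigcup_{i=1}^n(V_i^-\cup V_i^+)\cup\bigcup_{i\ge n+1}C_i$. For a directed edge (or loop) $e$ of $\widehat{\mathbb H}$ labeled $a_i$ with parametrization $\psi_e:[0,1]\to e$, put $V_e^-=\psi_e([0,3/8))$, $V_e^+=\psi_e((5/8,1])$, $U_e=\psi_e((1/4,3/4))$. The map $q:\widehat{\mathbb H}\to\mathbb H$ is given by $q(\psi_e(t))=l_i(t)$ for every edge or loop $e$ labeled $a_i$ (so vertices map to $\mathbf 0$). For a vertex $v$, with $n\ge2$ minimal such that $E_v\subseteq\{1,\dots,n\}$, let $U_v$ be the union of all $V_e^-$ with $e$ an edge or loop emanating from $v$, all $V_e^+$ with $e$ an edge or loop terminating at $v$, and all entire loops at $v$ labeled $a_i$ with $i>n$; $q$ restricts to bijections $U_e\to U_i$ and $U_v\to U_{n+1}^\infty$. $\widehat{\mathbb H}$ carries the unique topology making all $U_e$ and $U_v$ open and all the restrictions $q|_{U_e}:U_e\to U_i$ and $q|_{U_v}:U_v\to U_{n+1}^\infty$ homeomorphisms. **The subgroup $K$.** Every loop $\alpha$ in $\mathbb H$ at $\mathbf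 0$ has a unique continuous lift $\widehat\alpha$ to $\widehat{\mathbb H}$ with $\widehat\alpha(0)=\mathbf 1$, homotopies likewise lift, and $K=\{[\alpha]\in\pi_1(\mathbb H,\mathbf 0):\widehat\alpha(1)=\mathbf 1\}=q_\#(\pi_1(\widehat{\mathbb H},\mathbf 1))$. *)

theory Defs
  imports "HOL-Analysis.Analysis" "HOL-Algebra.Coset"
begin

section \<open>The fundamental group of a pointed abstract topological space\<close>

definition loops_at :: "'a topology \<Rightarrow> 'a \<Rightarrow> (real \<Rightarrow> 'a) set" where
  "loops_at X x = {f. pathin X f \<and> f 0 = x \<and> f 1 = x}"

text \<open>Homotopy relative to the end points. The library's \<open>homotopic_paths\<close> and \<open>joinpaths\<close>
  need a type of class \<open>topological_space\<close>, which the points of the graph below do not form.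
  Functions are paths through their values on \<open>[0,1]\<close> only; values elsewhere do not affect
  the relation.\<close>

definition loop_homotopic :: "'a topology \<Rightarrow> 'a \<Rightarrow> (real \<Rightarrow> 'a) \<Rightarrow> (real \<Rightarrow> 'a) \<Rightarrow> bool" where
  "loop_homotopic X x = homotopic_with (\<lambda>h. h 0 = x \<and> h 1 = x) (top_of_set {0..1}) X"

definition loop_class :: "'a topology \<Rightarrow> 'a \<Rightarrow> (real \<Rightarrow> 'a) \<Rightarrow> (real \<Rightarrow> 'a) set" where
  "loop_class X x f = {g \<in> loops_at X x. loop_homotopic X x f g}"

definition loop_join :: "(real \<Rightarrow> 'a) \<Rightarrow> (real \<Rightarrow> 'a) \<Rightarrow> real \<Rightarrow> 'a" where
  "loop_join f g = (\<lambda>t. if t \<le> 1/2 then f (2 * t) else g (2 * t - 1))"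

definition fundamental_group :: "'a topology \<Rightarrow> 'a \<Rightarrow> (real \<Rightarrow> 'a) set monoid" where
  "fundamental_group X x =
     \<lparr>carrier = loop_class X x ` loops_at X x,
      mult = (\<lambda>A B. \<Union>f\<in>A. \<Union>g\<in>B. loop_class X x (loop_join f g)),
      one = loop_class X x (\<lambda>_. x)\<rparr>"

lemma loop_homotopic_refl: "f \<in> loops_at X x \<Longrightarrow> loop_homotopic X x f f"
  by (simp add: loop_homotopic_def loops_at_def pathin_def)

lemma loop_homotopic_sym: "loop_homotopic X x f g \<Longrightarrow> loop_homotopic X x g f"
  unfolding loop_homotopic_def by (rule homotopic_with_symD)

lemma loop_homotopic_trans:
  "loop_homotopic X x f g \<Longrightarrow> loop_homotopic X x g h \<Longrightarrow> loop_homotopic X x f h"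
  unfolding loop_homotopic_def by (rule homotopic_with_trans)

lemma loop_homotopic_imp_loops:
  assumes "loop_homotopic X x f g"
  shows "f \<in> loops_at X x" "g \<in> loops_at X x"
  using homotopic_with_imp_continuous_maps[OF assms[unfolded loop_homotopic_def]]
    homotopic_with_imp_property[OF assms[unfolded loop_homotopic_def]]
  by (auto simp: loops_at_def pathin_def)

lemma loop_class_eq_iff:
  assumes "f \<in> loops_at X x" "g \<in> loops_at X x"
  shows "loop_class X x f = loop_class X x g \<longleftrightarrow> loop_homotopic X x f g"
proof
  assume "loop_class X x f = loop_class X x g"
  then have "g \<in> loop_class X x f"
    using assms loop_homotopic_refl by (auto simp: loop_class_def)
  then show "loop_homotopic X x f g" by (simp add: loop_class_def)
next
  assume "loop_homotopic X x f g"
  then have "loop_homotopic X x f h \<longleftrightarrow> loop_homotopic X x g h" for h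
    by (metis loop_homotopic_sym loop_homotopic_trans)
  then show "loop_class X x f = loop_class X x g"
    by (simp add: loop_class_def)
qed

lemma loop_homotopic_reparam:
  assumes f: "f \<in> loops_at X x"
    and p: "continuous_on {0..1} p" "p ` {0..1} \<subseteq> {0..1}"
    and q: "continuous_on {0..1} q" "q ` {0..1} \<subseteq> {0..1}"
    and pq: "p 0 = q 0" "p 1 = q 1" "f (p 0) = x" "f (p 1) = x"
  shows "loop_homotopic X x (f \<circ> p) (f \<circ> q)"
proof -
  let ?k = "\<lambda>z::real \<times> real. (1 - fst z) * p (snd z) + fst z * q (snd z)"
  have eq: "prod_topology (top_of_set {0..1::real}) (top_of_set {0..1::real})
      = top_of_set ({0..1} \<times> {0..1})"
    by (simp add: prod_topology_subtopology_eu)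
  have "continuous_on ({0..1} \<times> {0..1}) ?k"
    by (intro continuous_intros continuous_on_compose2[OF p(1)] continuous_on_compose2[OF q(1)]) auto
  moreover have "?k z \<in> {0..1}" if "z \<in> {0..1} \<times> {0..1}" for z
  proof -
    have "p (snd z) \<in> {0..1}" "q (snd z) \<in> {0..1}"
      using that p(2) q(2) by (auto simp: image_subset_iff mem_Times_iff)
    moreover have "fst z \<in> {0..1}" using that by auto
    ultimately show ?thesis
      using convex_bound_le[of "p (snd z)" 1 "q (snd z)" "1 - fst z" "fst z"] by auto
  qed
  ultimately have "continuous_map (top_of_set ({0..1} \<times> {0..1})) (top_of_set {0..1}) ?k"
    by (auto simp: continuous_map_in_subtopology)
  then have c: "continuous_map (prod_topology (top_of_set {0..1}) (top_of_set {0..1})) X (f \<circ> ?k)"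
    unfolding eq using f continuous_map_compose by (simp add: loops_at_def pathin_def, blast)
  have alg: "(1 - s) * a + s * a = a" for s a :: real by (simp add: algebra_simps)
  show ?thesis
    unfolding loop_homotopic_def homotopic_with_def
    by (rule exI[of _ "f \<circ> ?k"]) (use c pq in \<open>simp add: alg\<close>)
qed

lemma loop_homotopic_join:
  assumes "loop_homotopic X x f f'" "loop_homotopic X x g g'"
  shows "loop_homotopic X x (loop_join f g) (loop_join f' g')"
proof -
  let ?X01 = "prod_topology (top_of_set {0..1::real}) (top_of_set {0..1::real})"
  have eq: "?X01 = top_of_set ({0..1} \<times> {0..1})"
    by (simp add: prod_topology_subtopology_eu)
  obtain h k where h: "continuous_map ?X01 X h" "\<forall>t. h (0, t) = f t" "\<forall>t. h (1, t) = f' t"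
      "\<forall>s\<in>{0..1}. h (s, 0) = x \<and> h (s, 1) = x"
    and k: "continuous_map ?X01 X k" "\<forall>t. k (0, t) = g t" "\<forall>t. k (1, t) = g' t"
      "\<forall>s\<in>{0..1}. k (s, 0) = x \<and> k (s, 1) = x"
    using assms unfolding loop_homotopic_def homotopic_with_def by auto
  let ?m = "\<lambda>z. if snd z \<le> 1/2 then (h \<circ> (\<lambda>z. (fst z, 2 * snd z))) z
                 else (k \<circ> (\<lambda>z. (fst z, 2 * snd z - 1))) z"
  have "continuous_map ?X01 X ?m"
  proof (rule continuous_map_cases_le)
    show "continuous_map ?X01 euclideanreal snd"
      unfolding eq by (auto intro: continuous_intros)
    show "continuous_map ?X01 euclideanreal (\<lambda>x. 1/2)" by simp
    show "continuous_map (subtopology ?X01 {z \<in> topspace ?X01. snd z \<le> 1/2}) X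
            (h \<circ> (\<lambda>z. (fst z, 2 * snd z)))"
      by (rule continuous_map_compose[OF _ h(1)])
        (auto simp: eq subtopology_subtopology continuous_map_in_subtopology intro!: continuous_intros)
    show "continuous_map (subtopology ?X01 {z \<in> topspace ?X01. 1/2 \<le> snd z}) X
            (k \<circ> (\<lambda>z. (fst z, 2 * snd z - 1)))"
      by (rule continuous_map_compose[OF _ k(1)])
        (auto simp: eq subtopology_subtopology continuous_map_in_subtopology intro!: continuous_intros)
    show "(h \<circ> (\<lambda>z. (fst z, 2 * snd z))) z = (k \<circ> (\<lambda>z. (fst z, 2 * snd z - 1))) z"
      if "z \<in> topspace ?X01" "snd z = 1/2" for z
    proof -
      have "fst z \<in> {0..1}" using that(1) by (auto simp: eq)
      moreover have "2 * snd z = 1" "2 * snd z - 1 = 0" using that(2) by simp_all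
      ultimately show ?thesis using h(4) k(4) by (simp only: o_def)
    qed
  qed
  then show ?thesis
    unfolding loop_homotopic_def homotopic_with_def
    by (intro exI[of _ ?m]) (use h k in \<open>auto simp: loop_join_def\<close>)
qed

lemma const_loop: "x \<in> topspace X \<Longrightarrow> (\<lambda>_. x) \<in> loops_at X x"
  by (simp add: loops_at_def)

lemma loop_join_loops:
  "f \<in> loops_at X x \<Longrightarrow> g \<in> loops_at X x \<Longrightarrow> loop_join f g \<in> loops_at X x"
  by (rule loop_homotopic_imp_loops(2)[OF loop_homotopic_join[OF loop_homotopic_refl loop_homotopic_refl]])

lemma loop_reverse:
  assumes "f \<in> loops_at X x"
  shows "f \<circ> (\<lambda>t. 1 - t) \<in> loops_at X x"
proof (rule loop_homotopic_imp_loops)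
  show "loop_homotopic X x (f \<circ> (\<lambda>t. 1 - t)) (f \<circ> (\<lambda>t. 1 - t))"
    by (rule loop_homotopic_reparam[OF assms]) (use assms in \<open>auto simp: loops_at_def intro!: continuous_intros\<close>)
qed

lemma fundamental_group_mult:
  assumes f: "f \<in> loops_at X x" and g: "g \<in> loops_at X x"
  shows "loop_class X x f \<otimes>\<^bsub>fundamental_group X x\<^esub> loop_class X x g = loop_class X x (loop_join f g)"
proof -
  have "loop_class X x (loop_join f' g') = loop_class X x (loop_join f g)"
    if "f' \<in> loop_class X x f" "g' \<in> loop_class X x g" for f' g'
  proof -
    have "f' \<in> loops_at X x" "g' \<in> loops_at X x" "loop_homotopic X x (loop_join f' g') (loop_join f g)"
      using that by (auto simp: loop_class_def intro: loop_homotopic_join loop_homotopic_sym)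
    then show ?thesis using f g by (simp add: loop_class_eq_iff loop_join_loops)
  qed
  moreover have "f \<in> loop_class X x f" "g \<in> loop_class X x g"
    using f g loop_homotopic_refl by (auto simp: loop_class_def)
  ultimately have "(\<Union>f'\<in>loop_class X x f. \<Union>g'\<in>loop_class X x g. loop_class X x (loop_join f' g'))
      = loop_class X x (loop_join f g)"
    by blast
  then show ?thesis by (simp add: fundamental_group_def)
qed

lemma group_fundamental_group:
  assumes x: "x \<in> topspace X"
  shows "group (fundamental_group X x)"
proof (rule groupI)
  let ?G = "fundamental_group X x" and ?c = "loop_class X x" and ?L = "loops_at X x"
  have carr: "carrier ?G = ?c ` ?L" and one: "\<one>\<^bsub>?G\<^esub> = ?c (\<lambda>_. x)"
    by (simp_all add: fundamental_group_def)
  have ends: "f 0 = x" "f 1 = x" if "f \<in> ?L" for f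
    using that by (auto simp: loops_at_def)
  show "a \<otimes>\<^bsub>?G\<^esub> b \<in> carrier ?G" if "a \<in> carrier ?G" "b \<in> carrier ?G" for a b
    using that by (auto simp: carr fundamental_group_mult loop_join_loops)
  show "\<one>\<^bsub>?G\<^esub> \<in> carrier ?G"
    using x by (simp add: carr one const_loop)
  show "(a \<otimes>\<^bsub>?G\<^esub> b) \<otimes>\<^bsub>?G\<^esub> c = a \<otimes>\<^bsub>?G\<^esub> (b \<otimes>\<^bsub>?G\<^esub> c)"
    if abc: "a \<in> carrier ?G" "b \<in> carrier ?G" "c \<in> carrier ?G" for a b c
  proof -
    obtain f g h where fgh: "f \<in> ?L" "g \<in> ?L" "h \<in> ?L" "a = ?c f" "b = ?c g" "c = ?c h"
      using abc by (auto simp: carr)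
    let ?p = "\<lambda>t::real. min (2 * t) (min (t + 1/4) (t / 2 + 1/2))"
    let ?k = "loop_join f (loop_join g h)"
    have k: "?k \<in> ?L" using fgh by (simp add: loop_join_loops)
    have "loop_homotopic X x (?k \<circ> ?p) (?k \<circ> (\<lambda>t. t))"
      by (rule loop_homotopic_reparam[OF k])
        (use ends[OF k] in \<open>auto intro!: continuous_intros\<close>)
    moreover have "?k \<circ> ?p = loop_join (loop_join f g) h"
      by (rule ext) (auto simp: loop_join_def min_def field_simps intro!: arg_cong[where f=g])
    ultimately show ?thesis
      using fgh by (simp add: fundamental_group_mult loop_join_loops loop_class_eq_iff o_def)
  qed
  show "\<one>\<^bsub>?G\<^esub> \<otimes>\<^bsub>?G\<^esub> a = a" if "a \<in> carrier ?G" for a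
  proof -
    obtain f where f: "f \<in> ?L" "a = ?c f" using \<open>a \<in> carrier ?G\<close> by (auto simp: carr)
    have "loop_homotopic X x (f \<circ> (\<lambda>t. max 0 (2 * t - 1))) (f \<circ> (\<lambda>t. t))"
      by (rule loop_homotopic_reparam[OF f(1)])
        (use ends[OF f(1)] in \<open>auto intro!: continuous_intros\<close>)
    moreover have "f \<circ> (\<lambda>t. max 0 (2 * t - 1)) = loop_join (\<lambda>_. x) f"
      using ends[OF f(1)] by (auto simp: loop_join_def max_def fun_eq_iff intro!: arg_cong[where f=f])
    ultimately show ?thesis
      using f x by (simp add: one fundamental_group_mult loop_join_loops loop_class_eq_iff o_def const_loop)
  qed
  show "\<exists>b\<in>carrier ?G. b \<otimes>\<^bsub>?G\<^esub> a = \<one>\<^bsub>?G\<^esub>" if "a \<in> carrier ?G" for a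
  proof -
    obtain f where f: "f \<in> ?L" "a = ?c f" using \<open>a \<in> carrier ?G\<close> by (auto simp: carr)
    let ?r = "f \<circ> (\<lambda>t. 1 - t)"
    have r: "?r \<in> ?L" by (rule loop_reverse[OF f(1)])
    have "loop_homotopic X x (f \<circ> (\<lambda>t. \<bar>1 - 2 * t\<bar>)) (f \<circ> (\<lambda>t. 1))"
      by (rule loop_homotopic_reparam[OF f(1)])
        (use ends[OF f(1)] in \<open>auto intro!: continuous_intros\<close>)
    moreover have "f \<circ> (\<lambda>t. \<bar>1 - 2 * t\<bar>) = loop_join ?r f"
      by (auto simp: loop_join_def fun_eq_iff intro!: arg_cong[where f=f])
    moreover have "f \<circ> (\<lambda>t::real. 1) = (\<lambda>_. x)" using ends[OF f(1)] by (simp add: o_def)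
    ultimately have "loop_homotopic X x (loop_join ?r f) (\<lambda>_. x)" by (simp only:)
    then have "?c ?r \<otimes>\<^bsub>?G\<^esub> a = \<one>\<^bsub>?G\<^esub>"
      using f r x by (simp add: one fundamental_group_mult loop_join_loops loop_class_eq_iff const_loop)
    then show ?thesis using r by (auto simp: carr)
  qed
qed

definition induced_map ::
  "'b topology \<Rightarrow> 'b \<Rightarrow> ('a \<Rightarrow> 'b) \<Rightarrow> (real \<Rightarrow> 'a) set \<Rightarrow> (real \<Rightarrow> 'b) set" where
  "induced_map Y y h A = (\<Union>f\<in>A. loop_class Y y (h \<circ> f))"


section \<open>The Hawaiian earring\<close>

definition circ :: "nat \<Rightarrow> (real \<times> real) set" where
  "circ i = {(x, y). x\<^sup>2 + (y - 1 / real i)\<^sup>2 = 1 / (real i)\<^sup>2}"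

definition hawaiian :: "(real \<times> real) set" where
  "hawaiian = (\<Union>i\<in>{1..}. circ i)"

definition circ_loop :: "nat \<Rightarrow> real \<Rightarrow> real \<times> real" where
  "circ_loop i t = (sin (2 * pi * t) / real i, (1 - cos (2 * pi * t)) / real i)"

definition H_arc :: "nat \<Rightarrow> (real \<times> real) set" where
  "H_arc i = circ_loop i ` {1/4<..<3/4}"

text \<open>\<open>H_nbhd m\<close> is the set written \<open>U\<^sub>m\<^sup>\<infinity>\<close> in the construction.\<close>

definition H_nbhd :: "nat \<Rightarrow> (real \<times> real) set" where
  "H_nbhd m = (\<Union>i\<in>{1..<m}. circ_loop i ` {0..<3/8} \<union> circ_loop i ` {5/8<..1}) \<union> (\<Union>i\<in>{m..}. circ i)"


section \<open>Words and the Cayley tree\<close>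

text \<open>The letter \<open>a\<^sub>i\<close> is \<open>(i, True)\<close> and its inverse is \<open>(i, False)\<close>; only indices \<open>i \<ge> 1\<close> are
  used.\<close>

type_synonym letter = "nat \<times> bool"
type_synonym word = "letter list"

definition words_upto :: "nat \<Rightarrow> word set" where
  "words_upto n = {x. \<forall>(i, b)\<in>set x. 1 \<le> i \<and> i \<le> n}"

definition words :: "word set" where
  "words = (\<Union>n. words_upto n)"

definition inv_letter :: "letter \<Rightarrow> letter" where
  "inv_letter l = (fst l, \<not> snd l)"

fun push :: "letter \<Rightarrow> word \<Rightarrow> word" where
  "push l [] = [l]"
| "push l (k # ks) = (if k = inv_letter l then ks else l # k # ks)"

definition reduce :: "word \<Rightarrow> word" where
  "reduce x = foldr push x []"

definition is_reduced :: "word \<Rightarrow> bool" where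
  "is_reduced x \<longleftrightarrow> \<not> (\<exists>u l v. x = u @ [l, inv_letter l] @ v)"

text \<open>The value of \<open>reduce\<close> is reduced and unchanged by free cancellation of its argument.\<close>

lemma inv_letter_inv_letter [simp]: "inv_letter (inv_letter l) = l"
  by (simp add: inv_letter_def)

lemma reduced_ConsD: "is_reduced (l # x) \<Longrightarrow> is_reduced x"
  unfolding is_reduced_def by (metis append_Cons)

lemma reduced_push: "is_reduced x \<Longrightarrow> is_reduced (push l x)"
proof (cases x)
  case Nil
  then show ?thesis by (auto simp: is_reduced_def Cons_eq_append_conv)
next
  case (Cons k ks)
  assume r: "is_reduced x"
  show ?thesis
  proof (cases "k = inv_letter l")
    case True
    with Cons r show ?thesis using reduced_ConsD by simp
  next
    case False
    have "is_reduced (l # k # ks)"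
      unfolding is_reduced_def
    proof safe
      fix u m v assume *: "l # k # ks = u @ [m, inv_letter m] @ v"
      show False
      proof (cases u)
        case Nil
        with * False show False by simp
      next
        case (Cons b u')
        with * have "x = u' @ [m, inv_letter m] @ v" using \<open>x = k # ks\<close> by simp
        with r show False unfolding is_reduced_def by blast
      qed
    qed
    with Cons False show ?thesis by simp
  qed
qed

lemma reduced_reduce: "is_reduced (reduce x)"
  unfolding reduce_def by (induction x) (auto intro: reduced_push, simp add: is_reduced_def)

lemma push_push_inv: "is_reduced x \<Longrightarrow> push l (push (inv_letter l) x) = x"
proof (cases x)
  case (Cons k ks)
  assume r: "is_reduced x"
  show ?thesis
  proof (cases "k = l")
    case True
    have "\<exists>b bs. ks = b # bs \<and> b = inv_letter l" if "push l ks \<noteq> l # ks"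
      using that by (cases ks) (auto split: if_splits)
    moreover have "\<not> (\<exists>bs. ks = inv_letter l # bs)"
      using r Cons True unfolding is_reduced_def by (metis append_Cons append_Nil)
    ultimately show ?thesis using Cons True by auto
  next
    case False
    with Cons show ?thesis by auto
  qed
qed simp

lemma reduce_cancel: "reduce (u @ [l, inv_letter l] @ v) = reduce (u @ v)"
  using push_push_inv[OF reduced_reduce, of l v] by (simp add: reduce_def)

definition tree_verts :: "word set" where
  "tree_verts = {x \<in> words. is_reduced x}"

text \<open>A directed edge is a triple (source, label, target). Every subgraph of the Cayley graph that
  occurs below arises by deleting vertices together with all incident edges, so it is the full
  subgraph on its vertex set \<open>S\<close>, and it is represented by \<open>S\<close>.\<close>

type_synonym edge = "word \<times> nat \<times> word"

definition tree_edges :: "word set \<Rightarrow> edge set" where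
  "tree_edges S = {(u, i, v). u \<in> S \<and> v \<in> S \<and> 1 \<le> i \<and> v = reduce (u @ [(i, True)])}"

definition adj :: "word set \<Rightarrow> nat \<Rightarrow> word \<Rightarrow> word \<Rightarrow> bool" where
  "adj S i u v \<longleftrightarrow> (u, i, v) \<in> tree_edges S \<or> (v, i, u) \<in> tree_edges S"

definition tree_walk :: "word set \<Rightarrow> word list \<Rightarrow> bool" where
  "tree_walk S p \<longleftrightarrow> p \<noteq> [] \<and> set p \<subseteq> S \<and> successively (\<lambda>u v. \<exists>i. adj S i u v) p"

text \<open>\<open>u\<close> is separated from \<open>Y\<close> by \<open>v\<close> in the graph on \<open>S\<close>; this includes \<open>u = v\<close>.\<close>

definition separated :: "word set \<Rightarrow> word set \<Rightarrow> word \<Rightarrow> word \<Rightarrow> bool" where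
  "separated S Y v u \<longleftrightarrow> (\<forall>p. tree_walk S p \<and> hd p = u \<and> last p \<in> Y \<longrightarrow> v \<in> set p)"


section \<open>Pruning the Cayley tree\<close>

text \<open>The parameter \<open>w\<close> is the chosen list \<open>w 1, w 2, \<dots>\<close> of all nonempty words; \<open>w 0\<close> is
  never used.\<close>

definition alternating :: "nat \<Rightarrow> word" where
  "alternating m = map (\<lambda>k. if even k then (1, True) else (2, True)) [0..<m]"

definition hat_word :: "(nat \<Rightarrow> word) \<Rightarrow> nat \<Rightarrow> word" where
  "hat_word w j = alternating (2 * (\<Sum>k\<in>{1..<j}. length (w k)) + 3 * j + length (w j))"

definition Zset :: "(nat \<Rightarrow> word) \<Rightarrow> nat \<Rightarrow> word set" where
  "Zset w j = {reduce (hat_word w j @ take i (w j)) | i. i \<le> length (w j)}"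

definition nmin :: "(nat \<Rightarrow> word) \<Rightarrow> nat \<Rightarrow> nat" where
  "nmin w j = (LEAST n. 2 \<le> n \<and> w j \<in> words_upto n)"

definition gen_power :: "nat \<Rightarrow> int \<Rightarrow> word" where
  "gen_power s r = replicate (nat \<bar>r\<bar>) (s, 0 \<le> r)"

definition gen_line :: "word \<Rightarrow> nat \<Rightarrow> word set" where
  "gen_line u s = {reduce (u @ gen_power s r) | r. True}"

definition Yset :: "(nat \<Rightarrow> word) \<Rightarrow> nat \<Rightarrow> word set" where
  "Yset w j = Zset w j \<union> (\<Union>u\<in>Zset w j. \<Union>s\<in>{1..nmin w j}. gen_line u s)"

definition cut_verts :: "word set \<Rightarrow> word set \<Rightarrow> word set" where
  "cut_verts S Y = {v \<in> S - Y. (\<exists>y\<in>Y. \<exists>i. adj S i v y) \<and> \<not> (\<exists>y\<in>Y. \<exists>i\<in>{1, 2}. adj S i v y)}"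

definition prune :: "word set \<Rightarrow> word set \<Rightarrow> word set" where
  "prune S Y = {u \<in> S. \<not> (\<exists>v\<in>cut_verts S Y. separated S Y v u)}"

primrec Gam :: "(nat \<Rightarrow> word) \<Rightarrow> nat \<Rightarrow> word set" where
  "Gam w 0 = tree_verts"
| "Gam w (Suc j) = prune (Gam w j) (Yset w (Suc j))"

definition Gam_inf :: "(nat \<Rightarrow> word) \<Rightarrow> word set" where
  "Gam_inf w = (\<Inter>j. Gam w j)"

definition infinite_valence :: "word set \<Rightarrow> word \<Rightarrow> bool" where
  "infinite_valence S u \<longleftrightarrow> infinite {(x, i, y) \<in> tree_edges S. x = u \<or> y = u}"

text \<open>Below, \<open>u @ (k, b) # x\<close> is reduced as it stands, being a vertex of the tree.\<close>

definition Gam_star :: "(nat \<Rightarrow> word) \<Rightarrow> word set" where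
  "Gam_star w = Gam_inf w -
     {v. \<exists>u k b x. v = u @ (k, b) # x \<and> u \<in> Gam_inf w \<and> infinite_valence (Gam_inf w) u \<and> k \<notin> {1, 2}}"


section \<open>The covering graph\<close>

text \<open>\<open>E_set w v\<close> is read off from the edges terminating at \<open>v\<close>; that the edges emanating
  from \<open>v\<close> carry the same labels, and that the set is finite, are properties of the construction.\<close>

definition E_set :: "(nat \<Rightarrow> word) \<Rightarrow> word \<Rightarrow> nat set" where
  "E_set w v = {i. \<exists>u. (u, i, v) \<in> tree_edges (Gam_star w)}"

definition hat_loops :: "(nat \<Rightarrow> word) \<Rightarrow> edge set" where
  "hat_loops w = {(v, i, v) | v i. v \<in> Gam_star w \<and> 1 \<le> i \<and> i \<notin> E_set w v}"

definition hat_edges :: "(nat \<Rightarrow> word) \<Rightarrow> edge set" where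
  "hat_edges w = tree_edges (Gam_star w) \<union> hat_loops w"

definition src :: "edge \<Rightarrow> word" where "src e = fst e"
definition lab :: "edge \<Rightarrow> nat" where "lab e = fst (snd e)"
definition tgt :: "edge \<Rightarrow> word" where "tgt e = snd (snd e)"

text \<open>Geometric realization: \<open>Inner e t\<close> with \<open>0 < t < 1\<close> is the point of the open edge \<open>e\<close>
  with parameter \<open>t\<close>.\<close>

datatype hat_point = Vertex word | Inner edge real

definition hat_points :: "(nat \<Rightarrow> word) \<Rightarrow> hat_point set" where
  "hat_points w = Vertex ` Gam_star w \<union> {Inner e t | e t. e \<in> hat_edges w \<and> 0 < t \<and> t < 1}"

definition edge_param :: "edge \<Rightarrow> real \<Rightarrow> hat_point" where
  "edge_param e t = (if t = 0 then Vertex (src e) else if t = 1 then Vertex (tgt e) else Inner e t)"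

fun q_map :: "hat_point \<Rightarrow> real \<times> real" where
  "q_map (Vertex v) = (0, 0)"
| "q_map (Inner e t) = circ_loop (lab e) t"

lemma q_map_edge_param: "q_map (edge_param e t) = circ_loop (lab e) t"
  by (auto simp: edge_param_def circ_loop_def zero_prod_def)

definition edge_nbhd :: "edge \<Rightarrow> hat_point set" where
  "edge_nbhd e = edge_param e ` {1/4<..<3/4}"

definition nvert :: "(nat \<Rightarrow> word) \<Rightarrow> word \<Rightarrow> nat" where
  "nvert w v = (LEAST n. 2 \<le> n \<and> E_set w v \<subseteq> {1..n})"

definition vertex_nbhd :: "(nat \<Rightarrow> word) \<Rightarrow> word \<Rightarrow> hat_point set" where
  "vertex_nbhd w v =
     (\<Union>e\<in>{e \<in> hat_edges w. src e = v}. edge_param e ` {0..<3/8}) \<union>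
     (\<Union>e\<in>{e \<in> hat_edges w. tgt e = v}. edge_param e ` {5/8<..1}) \<union>
     (\<Union>e\<in>{e \<in> hat_loops w. src e = v \<and> nvert w v < lab e}. edge_param e ` {0..1})"

definition hat_space :: "(nat \<Rightarrow> word) \<Rightarrow> hat_point topology" where
  "hat_space w = (THE T. topspace T = hat_points w \<and>
     (\<forall>e\<in>hat_edges w. openin T (edge_nbhd e) \<and>
        homeomorphic_map (subtopology T (edge_nbhd e)) (top_of_set (H_arc (lab e))) q_map) \<and>
     (\<forall>v\<in>Gam_star w. openin T (vertex_nbhd w v) \<and>
        homeomorphic_map (subtopology T (vertex_nbhd w v))
          (top_of_set (H_nbhd (Suc (nvert w v)))) q_map))"


section \<open>The subgroup\<close>

definition K_subgroup :: "(nat \<Rightarrow> word) \<Rightarrow> (real \<Rightarrow> real \<times> real) set set" where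
  "K_subgroup w = induced_map (top_of_set hawaiian) (0, 0) q_map `
     carrier (fundamental_group (hat_space w) (Vertex []))"

end

theory Submission
  imports Defs "HOL-Library.Sublist" "HOL-Analysis.Finite_Function_Topology"
    "HOL-Complex_Analysis.Great_Picard"
begin

text \<open>
The trees \<open>T\<^sub>m\<close>, the Cayley trees of the free groups on \<open>a\<^sub>1, \<dots>, a\<^sub>m\<close>, with loops added at every vertex
for the labels above \<open>m\<close>, are covering spaces of the Hawaiian earring. A loop \<open>\<alpha>\<close> all of whose
lifts to these are closed is null-homotopic: weight the edges with label \<open>i\<close> by a number that is small
against the number of times \<open>\<alpha>\<close> can traverse the \<open>i\<close>-th circle. Then the distances from the root along the
lifts are equicontinuous, a subsequence converges uniformly to a function \<open>f\<close>, and \<open>\<alpha>\<close> factors through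
the real tree coded by \<open>f\<close>, which is contractible.

If \<open>\<alpha>\<close> is not null-homotopic, some lift to \<open>T\<^sub>n\<close> is not closed. It visits finitely many vertices.
Choose \<open>j\<close> such that the prefixes of \<open>w\<^sub>j\<close> reduce to all these vertices and \<open>w\<^sub>j\<close> to the end point of the
lift. At the vertices of \<open>Z\<^sub>j\<close> exactly the labels up to \<open>n\<close> belong to edges of the tree, so the
lift of \<open>\<alpha>\<close> that starts at the vertex \<open>h\<close> given by the word of \<open>Z\<close> where \<open>Z\<^sub>j\<close> begins stays at \<open>Z\<^sub>j\<close>
and ends at \<open>(h w\<^sub>j)' \<noteq> h\<close>. Conjugating \<open>\<alpha>\<close> by the loop that leads from \<open>\<one>\<close> to \<open>h\<close> gives a loop outside
of \<open>K\<close>.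
\<close>

section \<open>The Cayley tree\<close>

text \<open>The topology of the graph lives on a datatype, whereas the trees T_m are realized as
  subsets of a normed space, to which the theory of covering spaces applies. So existence and
  homotopy invariance of lifts are used for T_m alone, and of paths in the graph only the vertices
  that they pass are recorded. An element of \<open>K\<close> is the class of a projected loop
  \<open>q_map \<circ> f\<close>. The path \<open>f\<close> visits finitely many vertices, and
  beyond some m every label is a loop at each of them; hence the end of its lift to T_m, acting as a
  word on the vertices of the graph, fixes the root. For the conjugate of \<alpha> this fails for
  all large m. Since m depends on \<open>f\<close>, which is known only after the conjugating loop
  has been fixed, the statements about \<alpha> and the conjugating loop are made for all large m at
  once.\<close>

lemma is_reduced_appendD: "is_reduced (u @ v) \<Longrightarrow> is_reduced u"
  unfolding is_reduced_def by (metis append.assoc)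

lemma is_reduced_prefix: "is_reduced v \<Longrightarrow> prefix u v \<Longrightarrow> is_reduced u"
  by (auto simp: prefix_def intro: is_reduced_appendD)

lemma is_reduced_snoc:
  "is_reduced (u @ [l]) \<longleftrightarrow> is_reduced u \<and> (u = [] \<or> last u \<noteq> inv_letter l)"
proof
  assume r: "is_reduced (u @ [l])"
  have "last u \<noteq> inv_letter l" if "u \<noteq> []"
  proof
    assume "last u = inv_letter l"
    then have "u @ [l] = butlast u @ [inv_letter l, inv_letter (inv_letter l)] @ []"
      using that by (metis append.assoc append_Cons append_Nil append_butlast_last_id
          inv_letter_inv_letter append_Nil2)
    then show False using r unfolding is_reduced_def by blast
  qed
  then show "is_reduced u \<and> (u = [] \<or> last u \<noteq> inv_letter l)"
    using r is_reduced_appendD by blast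
next
  assume a: "is_reduced u \<and> (u = [] \<or> last u \<noteq> inv_letter l)"
  show "is_reduced (u @ [l])"
    unfolding is_reduced_def
  proof safe
    fix x m y assume e: "u @ [l] = x @ [m, inv_letter m] @ y"
    show False
    proof (cases y rule: rev_cases)
      case Nil
      then have "u = x @ [m]" "l = inv_letter m" using e by simp_all
      then show False using a by auto
    next
      case (snoc y' k)
      then have "u = x @ [m, inv_letter m] @ y'" using e by simp
      then show False using a unfolding is_reduced_def by blast
    qed
  qed
qed

lemma is_reduced_Nil [simp]: "is_reduced []"
  by (simp add: is_reduced_def)

lemma reduce_reduced: "is_reduced u \<Longrightarrow> reduce u = u"
proof (induction u)
  case Nil
  then show ?case by (simp add: reduce_def)
next
  case (Cons l u)
  then have "reduce u = u" using reduced_ConsD by blast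
  moreover have "push l u = l # u"
  proof (cases u)
    case (Cons k ks)
    then have "k \<noteq> inv_letter l"
      using Cons.prems unfolding is_reduced_def by (metis append_Cons append_Nil)
    then show ?thesis using Cons by simp
  qed simp
  ultimately show ?case by (simp add: reduce_def)
qed

text \<open>If \<open>l\<close> cancels the first letter of \<open>u\<close>, the two sides differ
  by pushing a letter and its inverse, which changes nothing on a reduced word; this is where
  reducedness of \<open>y\<close> enters.\<close>

lemma foldr_push_push:
  assumes "is_reduced y"
  shows "foldr push (push l u) y = push l (foldr push u y)"
proof (cases u)
  case (Cons k ks)
  have "is_reduced (foldr push ks y)"
    using assms by (induction ks) (auto intro: reduced_push)
  then show ?thesis using Cons push_push_inv by simp
qed simp

lemma reduce_append_left: "reduce (reduce u @ v) = reduce (u @ v)"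
proof (induction u)
  case Nil
  then show ?case by (simp add: reduce_def)
next
  case (Cons l u)
  have "reduce (reduce (l # u) @ v) = foldr push (push l (reduce u)) (reduce v)"
    by (simp add: reduce_def)
  also have "\<dots> = push l (reduce (reduce u @ v))"
    by (simp add: foldr_push_push reduced_reduce) (simp add: reduce_def)
  also have "\<dots> = reduce ((l # u) @ v)"
    unfolding Cons by (simp add: reduce_def)
  finally show ?case .
qed

lemma reduce_append_right: "reduce (u @ reduce v) = reduce (u @ v)"
  by (simp add: reduce_def[of "u @ _"] reduce_reduced[OF reduced_reduce, unfolded reduce_def]
      reduce_def[of v])

text \<open>Right multiplication by a letter in the free group. On reduced words it agrees with
  \<open>reduce (u @ [l])\<close>, and its two branches tell whether the edge with label
  \<open>l\<close> leads towards the root or away from it.\<close>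

definition rmul :: "word \<Rightarrow> letter \<Rightarrow> word" where
  "rmul u l = (if u \<noteq> [] \<and> last u = inv_letter l then butlast u else u @ [l])"

lemma reduce_snoc:
  assumes "is_reduced u"
  shows "reduce (u @ [l]) = rmul u l"
proof (cases "u \<noteq> [] \<and> last u = inv_letter l")
  case True
  then have "u @ [l] = butlast u @ [inv_letter l, inv_letter (inv_letter l)] @ []"
    by (metis append.assoc append_Cons append_Nil append_butlast_last_id inv_letter_inv_letter append_Nil2)
  then have "reduce (u @ [l]) = reduce (butlast u @ [])"
    using reduce_cancel[of "butlast u" "inv_letter l" "[]"] by presburger
  then have "reduce (u @ [l]) = reduce (butlast u)" by simp
  also have "\<dots> = butlast u"
    using assms True is_reduced_appendD[of "butlast u" "[last u]"]
    by (metis append_butlast_last_id reduce_reduced)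
  finally show ?thesis using True by (simp add: rmul_def)
next
  case False
  then show ?thesis using assms by (auto simp: rmul_def reduce_reduced is_reduced_snoc)
qed

lemma reduce_append_snoc: "reduce (u @ v @ [l]) = rmul (reduce (u @ v)) l"
  using reduce_append_left[of "u @ v" "[l]"] reduce_snoc[OF reduced_reduce, of "u @ v" l] by simp

lemma rmul_rmul_inv [simp]:
  assumes "is_reduced u"
  shows "rmul (rmul u l) (inv_letter l) = u"
proof (cases "u \<noteq> [] \<and> last u = inv_letter l")
  case True
  then have u: "u = butlast u @ [inv_letter l]" by (metis append_butlast_last_id)
  then have "butlast u = [] \<or> last (butlast u) \<noteq> l"
    using assms is_reduced_snoc[of "butlast u" "inv_letter l"] by auto
  then show ?thesis using True u by (auto simp: rmul_def)
next
  case False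
  then show ?thesis by (auto simp: rmul_def)
qed

lemma inv_letter_pair [simp]: "inv_letter (i, b) = (i, \<not> b)"
  by (simp add: inv_letter_def)

lemma rmul_cases:
  obtains "rmul u l = u @ [l]" "u = [] \<or> last u \<noteq> inv_letter l" | "u = rmul u l @ [inv_letter l]"
proof (cases "u \<noteq> [] \<and> last u = inv_letter l")
  case True
  then have "u = rmul u l @ [inv_letter l]"
    using append_butlast_last_id[of u] by (simp add: rmul_def)
  then show ?thesis by (rule that(2))
next
  case False
  then show ?thesis using that(1) by (auto simp: rmul_def)
qed

section \<open>Vertices and adjacency in the Cayley tree\<close>

lemma words_iff: "x \<in> words \<longleftrightarrow> (\<forall>l\<in>set x. 1 \<le> fst l)"
proof
  assume a: "\<forall>l\<in>set x. 1 \<le> fst l"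
  have "x \<in> words_upto (Max (insert 0 (fst ` set x)))"
    using a by (force simp: words_upto_def intro!: Max_ge)
  then show "x \<in> words" by (auto simp: words_def)
qed (auto simp: words_def words_upto_def)

lemma set_push: "set (push l x) \<subseteq> insert l (set x)"
  by (cases x) auto

lemma set_reduce: "set (reduce x) \<subseteq> set x"
proof (induction x)
  case (Cons l x)
  have "set (reduce (l # x)) \<subseteq> insert l (set (reduce x))"
    using set_push by (simp add: reduce_def)
  then show ?case using Cons by auto
qed (simp add: reduce_def)

lemma reduce_tree_verts: "x \<in> words \<Longrightarrow> reduce x \<in> tree_verts"
  using set_reduce[of x] by (auto simp: tree_verts_def reduced_reduce words_iff)

lemma tree_verts_prefix: "v \<in> tree_verts \<Longrightarrow> prefix u v \<Longrightarrow> u \<in> tree_verts"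
  by (auto simp: tree_verts_def words_iff is_reduced_prefix dest: set_mono_prefix)

lemma tree_verts_rmul: "v \<in> tree_verts \<Longrightarrow> 1 \<le> i \<Longrightarrow> rmul v (i, b) \<in> tree_verts"
  using reduce_tree_verts[of "v @ [(i, b)]"] by (auto simp: tree_verts_def reduce_snoc words_iff)

lemma tree_edges_iff:
  assumes "S \<subseteq> tree_verts"
  shows "(u, i, v) \<in> tree_edges S \<longleftrightarrow> u \<in> S \<and> v \<in> S \<and> 1 \<le> i \<and> v = rmul u (i, True)"
  using assms by (auto simp: tree_edges_def tree_verts_def reduce_snoc)

lemma adj_iff:
  assumes "S \<subseteq> tree_verts"
  shows "adj S i u v \<longleftrightarrow> u \<in> S \<and> v \<in> S \<and> (\<exists>b. v = u @ [(i, b)] \<or> u = v @ [(i, b)])"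
proof
  have *: "\<exists>b. rmul x (i, True) = x @ [(i, b)] \<or> x = rmul x (i, True) @ [(i, b)]" for x
    by (rule rmul_cases[of x "(i, True)"]) auto
  assume "adj S i u v"
  then show "u \<in> S \<and> v \<in> S \<and> (\<exists>b. v = u @ [(i, b)] \<or> u = v @ [(i, b)])"
    using *[of u] *[of v] by (auto simp: adj_def tree_edges_iff[OF assms])
next
  assume a: "u \<in> S \<and> v \<in> S \<and> (\<exists>b. v = u @ [(i, b)] \<or> u = v @ [(i, b)])"
  then obtain b where b: "v = u @ [(i, b)] \<or> u = v @ [(i, b)]" by blast
  have r: "is_reduced u" "is_reduced v" and i: "1 \<le> i"
    using a b assms by (auto simp: tree_verts_def words_iff)
  have *: "y = rmul x (i, True) \<or> x = rmul y (i, True)"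
    if "is_reduced y" "y = x @ [(i, b)]" for x y
    using that by (cases b) (auto simp: rmul_def is_reduced_snoc)
  have "v = rmul u (i, True) \<or> u = rmul v (i, True)"
    using b *[OF r(1), of v] *[OF r(2), of u] by blast
  then show "adj S i u v" using a i by (auto simp: adj_def tree_edges_iff[OF assms])
qed

text \<open>A nonempty connected set of vertices of the tree, in terms of prefixes: \<open>g\<close>
  is its vertex nearest to the root, and the geodesic from \<open>g\<close> to each member stays in
  \<open>Y\<close>.\<close>

definition rooted_subtree :: "word \<Rightarrow> word set \<Rightarrow> bool" where
  "rooted_subtree g Y \<longleftrightarrow> g \<in> Y \<and> (\<forall>y\<in>Y. prefix g y \<and> (\<forall>p. prefix g p \<and> prefix p y \<longrightarrow> p \<in> Y))"

lemma rooted_subtree_root: "rooted_subtree g Y \<Longrightarrow> g \<in> Y"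
  and rooted_subtree_prefix: "rooted_subtree g Y \<Longrightarrow> y \<in> Y \<Longrightarrow> prefix g y"
  and rooted_subtree_between:
    "rooted_subtree g Y \<Longrightarrow> y \<in> Y \<Longrightarrow> prefix g p \<Longrightarrow> prefix p y \<Longrightarrow> p \<in> Y"
  unfolding rooted_subtree_def by blast+

text \<open>Both roots are prefixes of the common vertex \<open>d\<close>, so they are comparable. A
  path that starts at the shorter root enters the other subtree at its root, and up to there it is
  part of the geodesic to \<open>d\<close>.\<close>

lemma rooted_subtree_Un:
  assumes A: "rooted_subtree a A" and B: "rooted_subtree b B" and d: "d \<in> A" "d \<in> B"
  shows "rooted_subtree (if prefix a b then a else b) (A \<union> B)"
proof -
  have *: "rooted_subtree a (A \<union> B)"
    if A: "rooted_subtree a A" and B: "rooted_subtree b B" and d: "d \<in> A" "d \<in> B" and ab: "prefix a b"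
    for a b A B
    unfolding rooted_subtree_def
  proof (intro conjI ballI allI impI)
    show "a \<in> A \<union> B" using rooted_subtree_root[OF A] by simp
    fix y assume y: "y \<in> A \<union> B"
    show "prefix a y"
    proof (cases "y \<in> A")
      case True
      then show ?thesis by (rule rooted_subtree_prefix[OF A])
    next
      case False
      then have "prefix b y" using y rooted_subtree_prefix[OF B] by blast
      then show ?thesis using ab by (rule prefix_order.trans[rotated])
    qed
    fix p assume p: "prefix a p \<and> prefix p y"
    have "p \<in> A" if "y \<in> A" using rooted_subtree_between[OF A that] p by blast
    moreover have "p \<in> B" if "y \<in> B" "prefix b p" using rooted_subtree_between[OF B that] p by blast
    moreover have "p \<in> A" if "y \<in> B" "\<not> prefix b p"
    proof -
      have "prefix p b" using p that prefix_same_cases rooted_subtree_prefix[OF B that(1)] by blast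
      then have "prefix p d" using rooted_subtree_prefix[OF B d(2)] by (rule prefix_order.trans)
      then show ?thesis using rooted_subtree_between[OF A d(1)] p by blast
    qed
    ultimately show "p \<in> A \<union> B" using y by blast
  qed
  have "prefix a d" "prefix b d" using A B d rooted_subtree_prefix by blast+
  then have "prefix a b \<or> prefix b a" using prefix_same_cases by blast
  then show ?thesis
    using *[OF A B d] *[OF B A d(2,1)] by (simp add: Un_commute) blast
qed

text \<open>The tree has no cycles: an edge that joins a vertex of \<open>A\<close> to one of
  \<open>B\<close> without lying in either would close a cycle together with the paths from its ends
  to \<open>d\<close>.\<close>

lemma rooted_subtree_Un_edge:
  assumes A: "rooted_subtree a A" and B: "rooted_subtree b B" and d: "d \<in> A" "d \<in> B"
    and p: "p \<in> A \<union> B" "p @ [l] \<in> A \<union> B"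
  shows "{p, p @ [l]} \<subseteq> A \<or> {p, p @ [l]} \<subseteq> B"
proof -
  have *: "{p, p @ [l]} \<subseteq> A \<or> {p, p @ [l]} \<subseteq> B"
    if A: "rooted_subtree a A" and B: "rooted_subtree b B" and d: "d \<in> A" "d \<in> B"
      and p: "p \<in> A" "p @ [l] \<in> B" for a b A B
  proof (cases "b = p @ [l]")
    case True
    have "prefix a p" "prefix b d" using rooted_subtree_prefix A B d p by blast+
    then have "p @ [l] \<in> A"
      using True rooted_subtree_between[OF A d(1), of "p @ [l]"] by (simp add: prefix_prefix)
    then show ?thesis using p by simp
  next
    case False
    have "prefix b (p @ [l])" by (rule rooted_subtree_prefix[OF B p(2)])
    then have "prefix b p" using False by simp
    then have "p \<in> B" using rooted_subtree_between[OF B p(2)] by simp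
    then show ?thesis using p by simp
  qed
  show ?thesis using *[OF A B d] *[OF B A d(2,1)] p by auto
qed

text \<open>In the application \<open>A\<close> is \<open>Zset w j\<close> and the
  \<open>B i\<close> are the lines attached to it. They are added one at a time; each meets the
  union because it meets \<open>A\<close>.\<close>

lemma rooted_subtree_UN:
  assumes "finite I" and A: "rooted_subtree a A"
    and B: "\<And>i. i \<in> I \<Longrightarrow> \<exists>b. rooted_subtree b (B i)" "\<And>i. i \<in> I \<Longrightarrow> A \<inter> B i \<noteq> {}"
  shows "(\<exists>g. rooted_subtree g (A \<union> (\<Union>i\<in>I. B i))) \<and>
     (\<forall>p l. {p, p @ [l]} \<subseteq> A \<union> (\<Union>i\<in>I. B i) \<longrightarrow>
        {p, p @ [l]} \<subseteq> A \<or> (\<exists>i\<in>I. {p, p @ [l]} \<subseteq> B i))"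
  using assms(1) B
proof (induction I)
  case empty
  then show ?case using A by auto
next
  case (insert j I)
  let ?U = "A \<union> (\<Union>i\<in>I. B i)"
  obtain g where g: "rooted_subtree g ?U"
    and e: "\<And>p l. {p, p @ [l]} \<subseteq> ?U \<Longrightarrow> {p, p @ [l]} \<subseteq> A \<or> (\<exists>i\<in>I. {p, p @ [l]} \<subseteq> B i)"
    using insert.IH insert.prems by (metis insertI2)
  obtain b where b: "rooted_subtree b (B j)" using insert.prems by blast
  obtain d where d: "d \<in> ?U" "d \<in> B j" using insert.prems by blast
  have eq: "A \<union> (\<Union>i\<in>insert j I. B i) = ?U \<union> B j" by blast
  show ?case
    unfolding eq
  proof (intro conjI allI impI)
    show "\<exists>g. rooted_subtree g (?U \<union> B j)" using rooted_subtree_Un[OF g b d] by blast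
    fix p l assume "{p, p @ [l]} \<subseteq> ?U \<union> B j"
    then have "{p, p @ [l]} \<subseteq> ?U \<or> {p, p @ [l]} \<subseteq> B j"
      using rooted_subtree_Un_edge[OF g b d, of p l] by blast
    then show "{p, p @ [l]} \<subseteq> A \<or> (\<exists>i\<in>insert j I. {p, p @ [l]} \<subseteq> B i)"
      using e[of p l] by blast
  qed
qed

text \<open>What pruning at \<open>Y\<close> leaves, read along the geodesic from the root to
  \<open>u\<close>: wherever this geodesic steps out of \<open>Y\<close>, the step has label 1 or
  2.\<close>

definition exits_ok :: "word set \<Rightarrow> word \<Rightarrow> bool" where
  "exits_ok Y u \<longleftrightarrow> (\<forall>p l x. u = p @ l # x \<and> p \<in> Y \<and> p @ [l] \<notin> Y \<longrightarrow> fst l \<in> {1, 2})"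

lemma exits_ok_prefix: "exits_ok Y u \<Longrightarrow> prefix v u \<Longrightarrow> exits_ok Y v"
  unfolding exits_ok_def prefix_def by (metis append.assoc append_Cons)

text \<open>The words with prefix \<open>v\<close> form the branch above \<open>v\<close>, and the
  only edge that joins this branch to the rest of the tree ends at \<open>v\<close>.\<close>

lemma walk_leaves_branch:
  assumes S: "S \<subseteq> tree_verts" and p: "tree_walk S p" "prefix v (hd p)" "\<not> prefix v (last p)"
  shows "v \<in> set p"
  using p
proof (induction p)
  case Nil
  then show ?case by (simp add: tree_walk_def)
next
  case (Cons u p)
  show ?case
  proof (cases p)
    case Nil
    then show ?thesis using Cons.prems by simp
  next
    case (Cons u' p')
    have w: "tree_walk S p" and a: "\<exists>i. adj S i u u'"
      using Cons.prems \<open>p = u' # p'\<close> by (auto simp: tree_walk_def)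
    show ?thesis
    proof (cases "prefix v u'")
      case True
      then show ?thesis using Cons.IH[OF w] Cons.prems \<open>p = u' # p'\<close> by simp
    next
      case False
      obtain l where "u' = u @ [l] \<or> u = u' @ [l]" using a adj_iff[OF S] by blast
      then have "u = v" using False Cons.prems by auto
      then show ?thesis by simp
    qed
  qed
qed

lemma prefix_walk:
  assumes S: "S \<subseteq> tree_verts" and u: "\<And>v. prefix v u \<Longrightarrow> v \<in> S"
  shows "successively (\<lambda>u v. \<exists>i. adj S i u v) (prefixes u)"
  using u
proof (induction u rule: rev_induct)
  case (snoc l u)
  have "successively (\<lambda>u v. \<exists>i. adj S i u v) (prefixes u)"
    using snoc by simp
  moreover have "\<exists>i. adj S i u (u @ [l])"
    using snoc.prems[of u] snoc.prems[of "u @ [l]"] by (cases l) (auto simp: adj_iff[OF S])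
  ultimately show ?case by (auto simp: successively_append_iff)
qed simp

lemma adj_sym: "adj S i u v \<longleftrightarrow> adj S i v u"
  by (auto simp: adj_def)

text \<open>The vertices to be cut are the ends of edges that leave \<open>Y\<close> away from the
  root. The only other neighbor of \<open>Y\<close> is the parent of \<open>g\<close>, and the edge
  to it has the label of \<open>last g\<close>; that this label is 1 or 2 spares the parent. Being
  separated by a cut vertex then means lying in the branch above it.\<close>

lemma prune_eq:
  assumes S: "S \<subseteq> tree_verts" and pc: "\<And>u v. u \<in> S \<Longrightarrow> prefix v u \<Longrightarrow> v \<in> S"
    and Y: "Y \<subseteq> S" "rooted_subtree g Y" and g: "g \<noteq> []" "fst (last g) \<in> {1, 2}"
  shows "prune S Y = {u \<in> S. exits_ok Y u}"
proof -
  have gp: "prefix g y" if "y \<in> Y" for y by (rule rooted_subtree_prefix[OF Y(2) that])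
  have cut: "v \<in> cut_verts S Y \<longleftrightarrow> (\<exists>p l. v = p @ [l] \<and> v \<in> S \<and> p \<in> Y \<and> v \<notin> Y \<and> fst l \<notin> {1, 2})" for v
  proof
    assume "v \<in> cut_verts S Y"
    then obtain y i where v: "v \<in> S" "v \<notin> Y" "y \<in> Y" "adj S i v y" "i \<notin> {1, 2}"
      by (auto simp: cut_verts_def)
    then obtain b where b: "y = v @ [(i, b)] \<or> v = y @ [(i, b)]" by (auto simp: adj_iff[OF S])
    have "y \<noteq> v @ [(i, b)]"
    proof
      assume y: "y = v @ [(i, b)]"
      then have "g = y \<or> prefix g v" using gp[OF v(3)] by auto
      then show False
      proof
        assume "g = y" then show False using y g v by auto
      next
        assume "prefix g v"
        then have "v \<in> Y" using rooted_subtree_between[OF Y(2) v(3)] y by simp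
        then show False using v by simp
      qed
    qed
    then show "\<exists>p l. v = p @ [l] \<and> v \<in> S \<and> p \<in> Y \<and> v \<notin> Y \<and> fst l \<notin> {1, 2}"
      using b v by auto
  next
    assume "\<exists>p l. v = p @ [l] \<and> v \<in> S \<and> p \<in> Y \<and> v \<notin> Y \<and> fst l \<notin> {1, 2}"
    then obtain p i b where v: "v = p @ [(i, b)]" "v \<in> S" "p \<in> Y" "v \<notin> Y" "i \<notin> {1, 2}"
      by fastforce
    have "adj S i v p" using v Y by (auto simp: adj_iff[OF S])
    moreover have False if y: "y \<in> Y" "j \<in> {1, 2}" "adj S j v y" for y j
    proof -
      obtain c where "y = v @ [(j, c)] \<or> v = y @ [(j, c)]" using y by (auto simp: adj_iff[OF S])
      then have "y = v @ [(j, c)]" using v y by auto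
      then have "v \<in> Y"
        using rooted_subtree_between[OF Y(2) y(1)] gp[OF v(3)] v(1) by (simp add: prefix_prefix)
      then show False using v by simp
    qed
    ultimately show "v \<in> cut_verts S Y" using v unfolding cut_verts_def by blast
  qed
  have sep: "separated S Y v u \<longleftrightarrow> prefix v u"
    if v: "v \<in> cut_verts S Y" and u: "u \<in> S" for v u
  proof -
    obtain p l where p: "v = p @ [l]" "p \<in> Y" "v \<notin> Y" using v unfolding cut by blast
    have nv: "\<not> prefix v y" if "y \<in> Y" for y
    proof
      assume "prefix v y"
      then have "v \<in> Y"
        using rooted_subtree_between[OF Y(2) that] gp[OF p(2)] p(1) by (simp add: prefix_prefix)
      then show False using p by simp
    qed
    have gY: "g \<in> Y" by (rule rooted_subtree_root[OF Y(2)])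
    show ?thesis
    proof
      assume s: "separated S Y v u"
      \<comment> \<open>The walk descends from \<open>u\<close> to the root and then climbs to
        \<open>g\<close>; \<open>q\<close> leaves out the empty word, where the first half already
        ends.\<close>
      obtain q where q: "prefixes g = [] # q" by (cases g) auto
      have "q \<noteq> []" using q g by (metis last_ConsL last_prefixes)
      then have lq: "last q = g" using q by (metis last_ConsR last_prefixes)
      have sq: "set q \<subseteq> {v. prefix v g}" using q by (metis set_prefixes_eq set_subset_Cons)
      let ?q = "rev (prefixes u) @ q"
      have s1: "successively (\<lambda>u v. \<exists>i. adj S i u v) (rev (prefixes u))"
        using prefix_walk[OF S, of u] pc u by (simp add: adj_sym)
      have s2: "successively (\<lambda>u v. \<exists>i. adj S i u v) ([] # q)"
        using prefix_walk[OF S, of g] pc gY Y(1) unfolding q by blast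
      have l1: "last (rev (prefixes u)) = []" by (simp add: last_rev)
      have "successively (\<lambda>u v. \<exists>i. adj S i u v) ?q"
        using s1 s2 l1 by (auto simp: successively_append_iff successively_Cons)
      moreover have "set ?q \<subseteq> S"
        using pc u gY Y(1) sq by auto
      ultimately have "tree_walk S ?q" by (simp add: tree_walk_def)
      moreover have "hd ?q = u" by (simp add: hd_rev)
      moreover have "last ?q = g" using lq \<open>q \<noteq> []\<close> by simp
      ultimately have "v \<in> set ?q" using s gY unfolding separated_def by blast
      then have "prefix v u \<or> prefix v g" using sq by auto
      then show "prefix v u" using nv[OF gY] by simp
    next
      assume "prefix v u"
      then show "separated S Y v u"
        unfolding separated_def using walk_leaves_branch[OF S] nv by blast
    qed
  qed
  show ?thesis
  proof (intro Set.set_eqI iffI)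
    fix u assume "u \<in> prune S Y"
    then have u: "u \<in> S" "\<And>v. v \<in> cut_verts S Y \<Longrightarrow> \<not> prefix v u"
      using sep by (auto simp: prune_def)
    have "exits_ok Y u"
      unfolding exits_ok_def
    proof (intro allI impI; rule ccontr)
      fix p l x assume a: "u = p @ l # x \<and> p \<in> Y \<and> p @ [l] \<notin> Y" "fst l \<notin> {1, 2}"
      have pr: "prefix (p @ [l]) u" using a by simp
      then have "p @ [l] \<in> cut_verts S Y" unfolding cut using a pc u(1) by blast
      then show False using u(2) pr by blast
    qed
    then show "u \<in> {u \<in> S. exits_ok Y u}" using u by simp
  next
    fix u assume u: "u \<in> {u \<in> S. exits_ok Y u}"
    have "\<not> prefix v u" if v: "v \<in> cut_verts S Y" for v
    proof
      assume pr: "prefix v u"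
      obtain p l where p: "v = p @ [l]" "p \<in> Y" "v \<notin> Y" "fst l \<notin> {1, 2}" using v unfolding cut by blast
      then obtain x where "u = p @ l # x" using pr by (auto simp: prefix_def)
      then show False using u p unfolding exits_ok_def by blast
    qed
    then show "u \<in> prune S Y" using sep u by (auto simp: prune_def)
  qed
qed

lemma rmul_snoc: "rmul (x @ [inv_letter l]) l = x"
  by (simp add: rmul_def)

lemma rooted_subtree_singleton_edge:
  assumes "is_reduced z"
  shows "\<exists>g. rooted_subtree g {z, rmul z l}"
    and "{p, p @ [k]} \<subseteq> {z, rmul z l} \<Longrightarrow> fst k = fst l"
proof -
  have *: "rooted_subtree u {u, u @ [k]}" for u :: word and k
    by (auto simp: rooted_subtree_def prefix_snoc intro: prefix_order.antisym)
  show "\<exists>g. rooted_subtree g {z, rmul z l}"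
  proof (rule rmul_cases[of z l])
    assume "rmul z l = z @ [l]"
    then show ?thesis using *[of z l] by metis
  next
    assume "z = rmul z l @ [inv_letter l]"
    then show ?thesis using *[of "rmul z l" "inv_letter l"] by (metis insert_commute)
  qed
  assume a: "{p, p @ [k]} \<subseteq> {z, rmul z l}"
  then have "p = z \<and> p @ [k] = rmul z l \<or> p = rmul z l \<and> p @ [k] = z"
    by (metis insert_subset insertE singletonD append_self_conv not_Cons_self2)
  moreover have "rmul z l = z @ [l] \<or> z = rmul z l @ [inv_letter l]"
    by (rule rmul_cases[of z l]) simp_all
  moreover have "length (x @ [y]) = Suc (length x)" for x :: word and y by simp
  ultimately show "fst k = fst l"
    by (metis append1_eq_conv fst_conv inv_letter_def n_not_Suc_n Suc_n_not_n n_not_Suc_n not_less_eq lessI less_SucI)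
qed

text \<open>\<open>Zset w j\<close> with base vertex and word made independent, so that the word can
  vary in an induction.\<close>

definition word_path :: "word \<Rightarrow> word \<Rightarrow> word set" where
  "word_path h x = {reduce (h @ take i x) | i. i \<le> length x}"

lemma word_path_snoc:
  "word_path h (x @ [l]) = word_path h x \<union> {reduce (h @ x), rmul (reduce (h @ x)) l}"
proof -
  have "reduce (h @ x @ [l]) = rmul (reduce (h @ x)) l" by (rule reduce_append_snoc)
  moreover have "word_path h (x @ [l]) = word_path h x \<union> {reduce (h @ x @ [l])}"
    by (auto simp: word_path_def le_Suc_eq) force+
  moreover have "reduce (h @ x) \<in> word_path h x" by (auto simp: word_path_def intro!: exI[of _ "length x"])
  ultimately show ?thesis by auto
qed

text \<open>Each letter attaches one edge at a vertex that the walk has already reached. Since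
  unions of subtrees that meet create no edges, every edge among the visited vertices carries a
  label of the word.\<close>

lemma word_path_subtree:
  "(\<exists>g. rooted_subtree g (word_path h x)) \<and>
   (\<forall>p l. {p, p @ [l]} \<subseteq> word_path h x \<longrightarrow> fst l \<in> fst ` set x)"
proof (induction x rule: rev_induct)
  case Nil
  have "word_path h [] = {reduce h}" by (simp add: word_path_def)
  moreover have "rooted_subtree (reduce h) {reduce h}"
    by (auto simp: rooted_subtree_def intro: prefix_order.antisym)
  ultimately show ?case by auto
next
  case (snoc k x)
  let ?z = "reduce (h @ x)"
  obtain g where g: "rooted_subtree g (word_path h x)" using snoc by blast
  obtain b where b: "rooted_subtree b {?z, rmul ?z k}"
    using rooted_subtree_singleton_edge(1)[OF reduced_reduce] by blast
  have z: "?z \<in> word_path h x" "?z \<in> {?z, rmul ?z k}"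
    by (auto simp: word_path_def intro!: exI[of _ "length x"])
  show ?case
    unfolding word_path_snoc
  proof (intro conjI allI impI)
    show "\<exists>g. rooted_subtree g (word_path h x \<union> {?z, rmul ?z k})"
      using rooted_subtree_Un[OF g b z] by blast
    fix p l assume "{p, p @ [l]} \<subseteq> word_path h x \<union> {?z, rmul ?z k}"
    then have "{p, p @ [l]} \<subseteq> word_path h x \<or> {p, p @ [l]} \<subseteq> {?z, rmul ?z k}"
      by (intro rooted_subtree_Un_edge[OF g b z]) auto
    then show "fst l \<in> fst ` set (x @ [k])"
    proof
      assume "{p, p @ [l]} \<subseteq> word_path h x"
      then have "fst l \<in> fst ` set x" using snoc by blast
      then show ?thesis by auto
    next
      assume "{p, p @ [l]} \<subseteq> {?z, rmul ?z k}"
      then show ?thesis using rooted_subtree_singleton_edge(2)[OF reduced_reduce] by simp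
    qed
  qed
qed

section \<open>Lines of powers of one generator\<close>

lemma gen_line_self: "is_reduced u \<Longrightarrow> u \<in> gen_line u s"
  by (auto simp: gen_line_def gen_power_def reduce_reduced intro!: exI[of _ 0])

lemma gen_line_rmul:
  assumes "v \<in> gen_line u s"
  shows "rmul v (s, b) \<in> gen_line u s"
proof -
  obtain r where v: "v = reduce (u @ gen_power s r)" using assms by (auto simp: gen_line_def)
  have rv: "rmul v (s, b) = reduce (u @ gen_power s r @ [(s, b)])"
    unfolding v by (simp add: reduce_append_snoc)
  define r' where "r' = (if b then r + 1 else r - 1)"
  have "reduce (u @ gen_power s r @ [(s, b)]) = reduce (u @ gen_power s r')"
  proof (cases "r = 0 \<or> (0 \<le> r \<longleftrightarrow> b)")
    case True
    have "gen_power s r @ [(s, b)] = gen_power s r'"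
    proof (cases "r = 0")
      case False
      then have "nat \<bar>r'\<bar> = Suc (nat \<bar>r\<bar>)" "0 \<le> r' \<longleftrightarrow> b" "0 \<le> r \<longleftrightarrow> b"
        using True by (auto simp: r'_def)
      then show ?thesis by (simp add: gen_power_def replicate_append_same del: replicate_Suc)
        (simp add: replicate_append_same)
    qed (auto simp: gen_power_def r'_def)
    then show ?thesis by simp
  next
    case False
    then have n: "nat \<bar>r\<bar> = Suc (nat \<bar>r'\<bar>)" and b: "0 \<le> r \<longleftrightarrow> \<not> b" and r': "r' = 0 \<or> (0 \<le> r' \<longleftrightarrow> \<not> b)"
      by (auto simp: r'_def)
    have "gen_power s r = gen_power s r' @ [(s, \<not> b)]"
      using r' b n by (auto simp: gen_power_def replicate_append_same)
    then have "u @ gen_power s r @ [(s, b)] = (u @ gen_power s r') @ [(s, \<not> b), inv_letter (s, \<not> b)] @ []"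
      by simp
    then show ?thesis using reduce_cancel[of "u @ gen_power s r'" "(s, \<not> b)" "[]"] by simp
  qed
  then show ?thesis unfolding rv gen_line_def by blast
qed

lemma gen_line_subset:
  assumes "u \<in> L" "is_reduced u" "\<And>v b. v \<in> L \<Longrightarrow> rmul v (s, b) \<in> L"
  shows "gen_line u s \<subseteq> L"
proof -
  have "reduce (u @ replicate k (s, b)) \<in> L" for k b
  proof (induction k)
    case (Suc k)
    have "reduce (u @ replicate (Suc k) (s, b)) = rmul (reduce (u @ replicate k (s, b))) (s, b)"
      using reduce_append_snoc[of u "replicate k (s, b)" "(s, b)"] by (simp add: replicate_append_same)
    then show ?case using assms(3) Suc by simp
  qed (use assms in \<open>simp add: reduce_reduced\<close>)
  then show ?thesis by (auto simp: gen_line_def gen_power_def)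
qed

text \<open>The vertex of the line nearest to the root is \<open>u\<close> without its final block
  of letters with index \<open>s\<close>; from this \<open>b\<close> the line runs in two rays, one
  for each sign.\<close>

lemma gen_line_form:
  assumes u: "is_reduced u"
  obtains b where "prefix b u" "gen_line u s = {b @ replicate r (s, c) | r c. True}"
proof -
  define b where "b = rev (dropWhile (\<lambda>l. fst l = s) (rev u))"
  define y where "y = rev (takeWhile (\<lambda>l. fst l = s) (rev u))"
  have by': "u = b @ y"
    unfolding b_def y_def by (metis rev_append rev_rev_ident takeWhile_dropWhile_id)
  have ys: "fst l = s" if "l \<in> set y" for l using that set_takeWhileD unfolding y_def by fastforce
  have bs: "b = [] \<or> fst (last b) \<noteq> s"
    unfolding b_def using hd_dropWhile[of "\<lambda>l. fst l = s" "rev u"] by (auto simp: last_rev)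
  let ?L = "{b @ replicate r (s, c) | r c. True}"
  have rb: "is_reduced b" using u by' is_reduced_appendD by blast
  have red: "is_reduced (b @ replicate r (s, c))" for r c
  proof (induction r)
    case (Suc r)
    have "is_reduced ((b @ replicate r (s, c)) @ [(s, c)])"
      unfolding is_reduced_snoc using Suc bs by (cases r) (auto simp: last_append)
    then show ?case by (simp add: replicate_append_same)
  qed (simp add: rb)
  have step: "rmul v (s, d) \<in> ?L" if v: "v \<in> ?L" for v d
  proof -
    obtain r c where v: "v = b @ replicate r (s, c)" using v by blast
    show ?thesis
    proof (cases "r = 0 \<or> c = d")
      case True
      then have v': "v = b @ replicate r (s, d)" using v by auto
      have "is_reduced (v @ [(s, d)])"
        using red[of "Suc r" d] unfolding v' by (simp add: replicate_append_same)
      then have "rmul v (s, d) = v @ [(s, d)]" by (auto simp: rmul_def is_reduced_snoc)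
      also have "\<dots> = b @ replicate (Suc r) (s, d)" unfolding v' by (simp add: replicate_append_same)
      finally show ?thesis by blast
    next
      case False
      then obtain q where q: "r = Suc q" by (cases r) auto
      have "v = (b @ replicate q (s, c)) @ [(s, c)]" unfolding v q by (simp add: replicate_append_same)
      moreover have "(s, c) = inv_letter (s, d)" using False by auto
      ultimately have "rmul v (s, d) = b @ replicate q (s, c)" by (simp only: rmul_snoc)
      then show ?thesis by blast
    qed
  qed
  \<comment> \<open>A reduced word in the powers of a single generator cannot change its
    sign.\<close>
  have yr: "\<exists>c. y = replicate (length y) (s, c)"
  proof -
    have "is_reduced (b @ y') \<Longrightarrow> set y' \<subseteq> set y \<Longrightarrow> \<exists>c. y' = replicate (length y') (s, c)" for y'
    proof (induction y' rule: rev_induct)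
      case (snoc l y')
      have r: "is_reduced ((b @ y') @ [l])" using snoc.prems by simp
      then obtain c where c: "y' = replicate (length y') (s, c)"
        using snoc.IH[OF is_reduced_appendD[OF r]] snoc.prems(2) by auto
      obtain d where l: "l = (s, d)" using ys[of l] snoc.prems(2) by (cases l) auto
      show ?case
      proof (cases "y' = []")
        case True
        then show ?thesis using l by auto
      next
        case False
        then have "last y' = (s, c)" using c last_replicate[of "length y'" "(s, c)"] by simp
        then have "(s, c) \<noteq> inv_letter l" using r False unfolding is_reduced_snoc by auto
        then have "d = c" using l by auto
        then have "y' @ [l] = replicate (Suc (length y')) (s, c)"
          using c l replicate_append_same[of "length y'" "(s, c)"] by simp
        then show ?thesis by auto
      qed
    qed simp
    then show ?thesis using u by' by blast
  qed
  then have uL: "u \<in> ?L" using by' by auto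
  have sub: "gen_line u s \<subseteq> ?L" by (rule gen_line_subset[OF uL u step])
  have bin: "b \<in> gen_line u s"
  proof -
    obtain c where c: "y = replicate (length y) (s, c)" using yr by blast
    have "b @ replicate k (s, c) \<in> gen_line u s \<Longrightarrow> b \<in> gen_line u s" for k
    proof (induction k)
      case (Suc k)
      have "b @ replicate (Suc k) (s, c) = (b @ replicate k (s, c)) @ [inv_letter (s, \<not> c)]"
        by (simp add: replicate_append_same)
      then have "rmul (b @ replicate (Suc k) (s, c)) (s, \<not> c) = b @ replicate k (s, c)"
        by (simp only: rmul_snoc)
      then have "b @ replicate k (s, c) \<in> gen_line u s"
        using gen_line_rmul[OF Suc.prems, of "\<not> c"] by simp
      then show ?case by (rule Suc.IH)
    qed simp
    moreover have "b @ replicate (length y) (s, c) \<in> gen_line u s"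
      using gen_line_self[OF u, of s] by' c by simp
    ultimately show ?thesis by blast
  qed
  have "b @ replicate k (s, c) \<in> gen_line u s" for k c
  proof (induction k)
    case (Suc k)
    have "is_reduced ((b @ replicate k (s, c)) @ [(s, c)])"
      using red[of "Suc k" c] by (simp add: replicate_append_same)
    then have "rmul (b @ replicate k (s, c)) (s, c) = b @ replicate (Suc k) (s, c)"
      unfolding is_reduced_snoc by (auto simp: rmul_def replicate_append_same)
    then show ?case using gen_line_rmul[OF Suc, of c] by simp
  qed (simp add: bin)
  then have "gen_line u s = ?L" using sub by blast
  moreover have "prefix b u" using by' by simp
  ultimately show ?thesis using that by blast
qed

lemma prefix_replicate:
  assumes "prefix x (replicate r l)"
  shows "\<exists>k. x = replicate k l"
proof -
  have "\<forall>y\<in>set x. y = l" using set_mono_prefix[OF assms] by auto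
  then have "replicate (length x) l = x" by (rule replicate_length_same)
  then show ?thesis by metis
qed

lemma gen_line_subtree:
  assumes u: "is_reduced u"
  shows "\<exists>g. rooted_subtree g (gen_line u s)"
    and "{p, p @ [l]} \<subseteq> gen_line u s \<Longrightarrow> fst l = s"
proof -
  obtain b where b: "gen_line u s = {b @ replicate r (s, c) | r c. True}"
    by (rule gen_line_form[OF u])
  have mem: "y \<in> gen_line u s \<longleftrightarrow> (\<exists>r c. y = b @ replicate r (s, c))" for y
    unfolding b by simp
  have "rooted_subtree b (gen_line u s)"
    unfolding rooted_subtree_def
  proof (intro conjI ballI allI impI)
    have "b = b @ replicate 0 (s, True)" by simp
    then show "b \<in> gen_line u s" unfolding mem by blast
    fix y assume "y \<in> gen_line u s"
    then obtain r c where y: "y = b @ replicate r (s, c)" unfolding mem by blast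
    then show "prefix b y" by simp
    fix p assume p: "prefix b p \<and> prefix p y"
    then obtain x where x: "p = b @ x" by (auto elim: prefixE)
    then have "prefix x (replicate r (s, c))" using p y by simp
    then obtain k where "x = replicate k (s, c)" using prefix_replicate by metis
    then show "p \<in> gen_line u s" unfolding mem x by blast
  qed
  then show "\<exists>g. rooted_subtree g (gen_line u s)" by blast
  assume "{p, p @ [l]} \<subseteq> gen_line u s"
  then obtain r c r' c' where "p = b @ replicate r (s, c)" "p @ [l] = b @ replicate r' (s, c')"
    using mem by (metis insert_subset)
  then have "replicate r (s, c) @ [l] = replicate r' (s, c')" by simp
  then have "l \<in> set (replicate r' (s, c'))" by (metis in_set_conv_decomp)
  then show "fst l = s" by simp
qed

section \<open>The ray that alternates between the first two generators\<close>

lemma alternating_Suc: "alternating (Suc m) = alternating m @ [if even m then (1, True) else (2, True)]"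
  by (simp add: alternating_def)

lemma length_alternating [simp]: "length (alternating m) = m"
  by (simp add: alternating_def)

lemma prefix_alternating: "k \<le> m \<Longrightarrow> prefix (alternating k) (alternating m)"
  by (induction m) (auto simp: alternating_Suc le_Suc_eq)

lemma prefix_alternatingD: "prefix p (alternating m) \<Longrightarrow> \<exists>k\<le>m. p = alternating k"
proof -
  assume p: "prefix p (alternating m)"
  then have l: "length p \<le> m" using prefix_length_le by fastforce
  then have "prefix p (alternating (length p))"
    by (intro prefix_length_prefix[OF p prefix_alternating]) simp_all
  moreover have "prefix (alternating (length p)) p"
    by (intro prefix_length_prefix[OF prefix_alternating[OF l] p]) simp
  ultimately show ?thesis using l prefix_order.antisym by blast
qed

lemma set_alternating: "l \<in> set (alternating m) \<Longrightarrow> fst l \<in> {1, 2} \<and> snd l"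
  by (auto simp: alternating_def split: if_splits)

lemma alternating_tree_verts: "alternating m \<in> tree_verts"
proof -
  have "is_reduced (alternating m)"
  proof (induction m)
    case (Suc m)
    have "last (alternating m) \<noteq> inv_letter (if even m then (1, True) else (2, True))" if "alternating m \<noteq> []"
      using set_alternating[OF last_in_set[OF that]] by auto
    then show ?case using Suc by (auto simp: alternating_Suc is_reduced_snoc)
  qed (simp add: alternating_def)
  then show ?thesis
    using set_alternating by (fastforce simp: tree_verts_def words_iff)
qed

text \<open>A step in the tree appends a letter or deletes the last one, so it shortens the common
  prefix with the ray by at most one letter.\<close>

lemma prefix_alternating_rmul:
  assumes "prefix (alternating (Suc k)) u"
  shows "prefix (alternating k) (rmul u l)"
proof (rule rmul_cases[of u l])
  assume "rmul u l = u @ [l]"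
  moreover have "prefix (alternating k) u"
    using prefix_order.trans[OF prefix_alternating[of k "Suc k"] assms] by simp
  ultimately show ?thesis by simp
next
  assume u: "u = rmul u l @ [inv_letter l]"
  have "prefix (alternating k @ [if even k then (1, True) else (2, True)]) (rmul u l @ [inv_letter l])"
    using assms unfolding alternating_Suc by (metis u)
  then have "alternating k @ [if even k then (1, True) else (2, True)] = rmul u l @ [inv_letter l] \<or>
      prefix (alternating k @ [if even k then (1, True) else (2, True)]) (rmul u l)"
    by (rule prefix_snoc[THEN iffD1])
  then show ?thesis
  proof
    assume "alternating k @ [if even k then (1, True) else (2, True)] = rmul u l @ [inv_letter l]"
    then show ?thesis by (simp only: append1_eq_conv prefix_order.order_refl)
  qed (rule append_prefixD)
qed

text \<open>Reading \<open>x\<close> takes \<open>length x\<close> steps, each of which costs at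
  most one letter of the common prefix with the ray; the second claim runs the same steps backwards,
  with the inverse letters.\<close>

lemma prefix_alternating_word_path:
  "u \<in> word_path h x \<Longrightarrow> is_reduced h \<Longrightarrow> prefix (alternating (k + length x)) h \<Longrightarrow> prefix (alternating k) u"
  "u \<in> word_path h x \<Longrightarrow> is_reduced h \<Longrightarrow> prefix (alternating (k + length x)) u \<Longrightarrow> prefix (alternating k) h"
proof -
  have *: "i \<le> length x \<Longrightarrow> prefix (alternating (k + length x)) h \<Longrightarrow>
      prefix (alternating (k + length x - i)) (reduce (h @ take i x))"
    if "is_reduced h" for k i
  proof (induction i)
    case (Suc i)
    have "reduce (h @ take (Suc i) x) = rmul (reduce (h @ take i x)) (x ! i)"
      using Suc.prems reduce_append_snoc by (simp add: take_Suc_conv_app_nth)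
    moreover have "Suc (k + length x - Suc i) = k + length x - i" using Suc.prems by simp
    ultimately show ?case
      using prefix_alternating_rmul[of "k + length x - Suc i"] Suc by simp
  qed (simp add: that reduce_reduced)
  have **: "i \<le> length x \<Longrightarrow> prefix (alternating (k + i)) (reduce (h @ take i x)) \<Longrightarrow> prefix (alternating k) h"
    if "is_reduced h" for i
  proof (induction i)
    case (Suc i)
    have "reduce (h @ take (Suc i) x) = rmul (reduce (h @ take i x)) (x ! i)"
      using Suc.prems reduce_append_snoc by (simp add: take_Suc_conv_app_nth)
    then have "reduce (h @ take i x) = rmul (reduce (h @ take (Suc i) x)) (inv_letter (x ! i))"
      by (simp add: reduced_reduce)
    then show ?case
      using prefix_alternating_rmul[of "k + i"] Suc by simp
  qed (simp add: that reduce_reduced)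
  show "prefix (alternating k) u" if a: "u \<in> word_path h x" "is_reduced h" "prefix (alternating (k + length x)) h"
  proof -
    obtain i where i: "i \<le> length x" "u = reduce (h @ take i x)" using a by (auto simp: word_path_def)
    have "prefix (alternating k) (alternating (k + length x - i))"
      using i by (intro prefix_alternating) simp
    then show ?thesis using *[OF a(2) i(1) a(3)] i by (meson prefix_order.trans)
  qed
  show "prefix (alternating k) h" if a: "u \<in> word_path h x" "is_reduced h" "prefix (alternating (k + length x)) u"
  proof -
    obtain i where i: "i \<le> length x" "u = reduce (h @ take i x)" using a by (auto simp: word_path_def)
    have "prefix (alternating (k + i)) u"
      using i a(3) prefix_alternating[of "k + i" "k + length x"] by (meson prefix_order.trans add_left_mono)
    then show ?thesis using **[OF a(2) i(1)] i by simp
  qed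
qed

text \<open>The labels along the ray alternate, so a line meets it in at most one edge.\<close>

lemma prefix_alternating_gen_line:
  assumes v: "v \<in> gen_line u s" "v' \<in> gen_line u s" and u: "is_reduced u"
    and p: "prefix (alternating (Suc k)) v"
  shows "prefix (alternating k) v'"
proof -
  obtain b where b: "gen_line u s = {b @ replicate r (s, c) | r c. True}"
    by (rule gen_line_form[OF u])
  obtain r c r' c' where v: "v = b @ replicate r (s, c)" "v' = b @ replicate r' (s, c')"
    using v unfolding b by auto
  show ?thesis
  proof (cases "prefix (alternating k) b")
    case True
    then show ?thesis using v by simp
  next
    case False
    have "prefix (alternating k) v"
      using p prefix_alternating[of k "Suc k"] prefix_order.trans[of _ "alternating (Suc k)" v] by simp
    moreover have "prefix b v" using v by simp
    ultimately have pb: "prefix b (alternating k)" using False prefix_same_cases by blast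
    then obtain j where j: "b = alternating j" "j \<le> k" using prefix_alternatingD by blast
    then have "j < k" using False by (cases "j = k") auto
    have "prefix (alternating (Suc (Suc j))) v"
      using prefix_alternating[of "Suc (Suc j)" "Suc k"] \<open>j < k\<close> p prefix_order.trans[of _ "alternating (Suc k)" v] by simp
    then have "prefix [if even j then (1, True) else (2, True), if even j then (2, True) else (1, True)] (replicate r (s, c))"
      unfolding v j(1) alternating_Suc by (simp split: if_splits)
    then have "{if even j then (1, True) else (2, True), if even j then (2, True) else (1, True)} \<subseteq> {(s, c)}"
      by (auto dest!: set_mono_prefix split: if_splits)
    then show ?thesis by (auto split: if_splits)
  qed
qed

section \<open>The sets Y_j and the pruned tree\<close>

locale word_enumeration =
  fixes w :: "nat \<Rightarrow> word"
  assumes enum: "w ` {1..} = words - {[]}"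
begin

lemma w_words: "1 \<le> j \<Longrightarrow> w j \<in> words"
  using enum by auto

lemma nmin_props: "1 \<le> j \<Longrightarrow> 2 \<le> nmin w j \<and> w j \<in> words_upto (nmin w j)"
proof -
  assume "1 \<le> j"
  then obtain n where "w j \<in> words_upto n" using w_words by (auto simp: words_def)
  then have "2 \<le> max 2 n \<and> w j \<in> words_upto (max 2 n)" by (fastforce simp: words_upto_def)
  then show ?thesis unfolding nmin_def by (rule LeastI)
qed

text \<open>The length of \<open>hat_word w j\<close> without the summand for \<open>w j\<close>
  itself. The walk through \<open>Zset w j\<close> can undo at most \<open>length (w j)\<close>
  letters, so a prefix of the ray of this length is common to all of
  \<open>Zset w j\<close>.\<close>

definition pre_len :: "nat \<Rightarrow> nat" where
  "pre_len j = 2 * (\<Sum>k\<in>{1..<j}. length (w k)) + 3 * j"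

lemma hat_word_alternating: "hat_word w j = alternating (pre_len j + length (w j))"
  by (simp add: hat_word_def pre_len_def)

lemma reduced_hat_word: "is_reduced (hat_word w j)"
  using alternating_tree_verts by (simp add: hat_word_alternating tree_verts_def)

lemma Zset_word_path: "Zset w j = word_path (hat_word w j) (w j)"
  by (simp add: Zset_def word_path_def)

lemma hat_word_in_Zset: "hat_word w j \<in> Zset w j"
  unfolding Zset_def using reduce_reduced[OF reduced_hat_word] by (force intro: exI[of _ 0])

lemma Zset_subset_Yset: "Zset w j \<subseteq> Yset w j"
  by (simp add: Yset_def)

lemma reduced_Zset: "u \<in> Zset w j \<Longrightarrow> is_reduced u"
  by (auto simp: Zset_def reduced_reduce)

lemma Yset_cases:
  assumes "1 \<le> j" "y \<in> Yset w j"
  obtains u s where "u \<in> Zset w j" "s \<in> {1..nmin w j}" "y \<in> gen_line u s"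
proof -
  have "\<exists>u s. u \<in> Zset w j \<and> s \<in> {1..nmin w j} \<and> y \<in> gen_line u s"
  proof (cases "y \<in> Zset w j")
    case True
    then have "y \<in> gen_line y 1" by (intro gen_line_self reduced_Zset)
    then show ?thesis using True nmin_props[OF assms(1)] by force
  next
    case False
    then show ?thesis using assms(2) unfolding Yset_def by blast
  qed
  then show ?thesis using that by blast
qed

lemma Yset_tree_verts:
  assumes "1 \<le> j"
  shows "Yset w j \<subseteq> tree_verts"
proof
  fix y assume "y \<in> Yset w j"
  then obtain u s where us: "u \<in> Zset w j" "s \<in> {1..nmin w j}" "y \<in> gen_line u s"
    by (rule Yset_cases[OF assms])
  obtain i where "u = reduce (hat_word w j @ take i (w j))" using us(1) by (auto simp: Zset_def)
  moreover have "hat_word w j @ take i (w j) \<in> words"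
    using alternating_tree_verts w_words[OF assms] unfolding hat_word_alternating
    by (auto simp: tree_verts_def words_iff dest: in_set_takeD)
  ultimately have u: "u \<in> tree_verts" using reduce_tree_verts by simp
  obtain r where "y = reduce (u @ gen_power s r)" using us(3) by (auto simp: gen_line_def)
  moreover have "u @ gen_power s r \<in> words"
    using u us(2) by (auto simp: tree_verts_def words_iff gen_power_def)
  ultimately show "y \<in> tree_verts" using reduce_tree_verts by simp
qed

text \<open>\<open>Zset w j\<close> stays between the positions \<open>pre_len j\<close> and
  \<open>pre_len j + 2 * length (w j)\<close> of the ray, and passing to a line through one of its
  vertices shifts the position by at most one; this gives the offsets in the two bounds.\<close>

lemma Yset_ray_bounds:
  assumes "1 \<le> j" and y: "y \<in> Yset w j"
  shows "prefix (alternating (pre_len j - 1)) y"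
    and "\<not> prefix (alternating (pre_len j + 2 * length (w j) + 2)) y"
proof -
  obtain u s where us: "u \<in> Zset w j" "y \<in> gen_line u s"
    by (rule Yset_cases[OF assms])
  note ru = reduced_Zset[OF us(1)]
  have path: "u \<in> word_path (hat_word w j) (w j)" using us(1) by (simp add: Zset_word_path)
  have "prefix (alternating (pre_len j)) u"
    by (rule prefix_alternating_word_path(1)[OF path reduced_hat_word]) (simp add: hat_word_alternating)
  moreover have "pre_len j = Suc (pre_len j - 1)" using assms(1) by (simp add: pre_len_def)
  ultimately have "prefix (alternating (Suc (pre_len j - 1))) u" by simp
  then show "prefix (alternating (pre_len j - 1)) y"
    by (rule prefix_alternating_gen_line[OF gen_line_self[OF ru] us(2) ru])
  show "\<not> prefix (alternating (pre_len j + 2 * length (w j) + 2)) y"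
  proof
    assume "prefix (alternating (pre_len j + 2 * length (w j) + 2)) y"
    then have "prefix (alternating (Suc (pre_len j + 2 * length (w j) + 1))) y" by simp
    then have "prefix (alternating (pre_len j + 2 * length (w j) + 1)) u"
      by (rule prefix_alternating_gen_line[OF us(2) gen_line_self[OF ru] ru])
    then have "prefix (alternating ((pre_len j + length (w j) + 1) + length (w j))) u"
      by (simp add: mult_2 add.assoc add.commute add.left_commute)
    then have "prefix (alternating (pre_len j + length (w j) + 1)) (hat_word w j)"
      by (rule prefix_alternating_word_path(2)[OF path reduced_hat_word])
    then show False unfolding hat_word_alternating by (auto dest: prefix_length_le)
  qed
qed

text \<open>The summand \<open>3 * j\<close> provides exactly the three letters that the offsets
  \<open>- 1\<close> and \<open>+ 2\<close> of the bounds take up, and the factor 2 before the sum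
  makes room for the walk through \<open>Zset w i\<close>.\<close>

lemma pre_len_mono:
  assumes "1 \<le> i" "i < j"
  shows "pre_len i + 2 * length (w i) + 2 \<le> pre_len j - 1"
proof -
  have "(\<Sum>k\<in>{1..<i}. length (w k)) + length (w i) = (\<Sum>k\<in>{1..<Suc i}. length (w k))"
    using assms by simp
  also have "\<dots> \<le> (\<Sum>k\<in>{1..<j}. length (w k))"
    using assms by (intro sum_mono2) auto
  finally show ?thesis using assms unfolding pre_len_def by linarith
qed

lemma Yset_disjoint:
  assumes "1 \<le> i" "1 \<le> j" "y \<in> Yset w i" "y \<in> Yset w j"
  shows "i = j"
proof -
  have False if "1 \<le> i" "i < j" "1 \<le> j" "y \<in> Yset w i" "y \<in> Yset w j" for i j
    using Yset_ray_bounds(2)[OF that(1,4)] Yset_ray_bounds(1)[OF that(3,5)]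
      prefix_alternating[OF pre_len_mono[OF that(1,2)]] prefix_order.trans by blast
  then show ?thesis using assms by (metis linorder_neqE_nat)
qed

lemma finite_Zset: "finite (Zset w j)"
  by (simp add: Zset_def)

text \<open>An edge inside \<open>Zset w j\<close> has a label of \<open>w j\<close>, which is at
  most \<open>nmin w j\<close>, so it lies on one of the attached lines. Hence all edges of
  \<open>Yset w j\<close> are edges of lines.\<close>

lemma Yset_subtree:
  assumes "1 \<le> j"
  shows "(\<exists>g. rooted_subtree g (Yset w j)) \<and>
    (\<forall>p l. {p, p @ [l]} \<subseteq> Yset w j \<longrightarrow> (\<exists>u\<in>Zset w j. \<exists>s\<in>{1..nmin w j}. {p, p @ [l]} \<subseteq> gen_line u s))"
proof -
  let ?I = "Zset w j \<times> {1..nmin w j}"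
  obtain a where a: "rooted_subtree a (Zset w j)"
    using word_path_subtree unfolding Zset_word_path by blast
  have Y: "Yset w j = Zset w j \<union> (\<Union>i\<in>?I. gen_line (fst i) (snd i))"
    by (auto simp: Yset_def)
  have U: "(\<exists>g. rooted_subtree g (Yset w j)) \<and>
     (\<forall>p l. {p, p @ [l]} \<subseteq> Yset w j \<longrightarrow>
        {p, p @ [l]} \<subseteq> Zset w j \<or> (\<exists>i\<in>?I. {p, p @ [l]} \<subseteq> gen_line (fst i) (snd i)))"
    unfolding Y
  proof (rule rooted_subtree_UN[OF _ a])
    show "finite ?I" using finite_Zset by simp
    show "\<exists>b. rooted_subtree b (gen_line (fst i) (snd i))" if "i \<in> ?I" for i
      using that reduced_Zset by (intro gen_line_subtree(1)) auto
    show "Zset w j \<inter> gen_line (fst i) (snd i) \<noteq> {}" if "i \<in> ?I" for i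
      using that reduced_Zset gen_line_self by fastforce
  qed
  have "\<exists>u\<in>Zset w j. \<exists>s\<in>{1..nmin w j}. {p, p @ [l]} \<subseteq> gen_line u s"
    if p: "{p, p @ [l]} \<subseteq> Zset w j" for p l
  proof -
    have "fst l \<in> fst ` set (w j)"
      using word_path_subtree[of "hat_word w j" "w j"] p unfolding Zset_word_path by blast
    then have "fst l \<in> {1..nmin w j}"
      using nmin_props[OF assms] by (fastforce simp: words_upto_def)
    moreover have r: "is_reduced p" "is_reduced (p @ [l])" using p reduced_Zset by auto
    then have "rmul p l = p @ [l]" by (auto simp: rmul_def is_reduced_snoc)
    then have "p @ [l] \<in> gen_line p (fst l)"
      using gen_line_rmul[OF gen_line_self[OF r(1)], of "fst l" "snd l"] by simp
    ultimately show ?thesis using p gen_line_self[OF r(1), of "fst l"] by blast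
  qed
  then show ?thesis using U by fastforce
qed

text \<open>The vertex of \<open>Yset w j\<close> nearest to the root is a prefix of
  \<open>hat_word w j\<close>, hence on the ray, and the lower bound of
  \<open>Yset_ray_bounds\<close> keeps it away from the empty word. So it is entered by an edge with
  label 1 or 2, as \<open>prune_eq\<close> demands.\<close>

lemma Yset_root:
  assumes "1 \<le> j"
  obtains g k where "rooted_subtree g (Yset w j)" "g = alternating (Suc k)" "fst (last g) \<in> {1, 2}"
proof -
  obtain g where g: "rooted_subtree g (Yset w j)" using Yset_subtree[OF assms] by blast
  have "prefix g (hat_word w j)"
    using rooted_subtree_prefix[OF g] hat_word_in_Zset Zset_subset_Yset by blast
  then obtain m where m: "g = alternating m" using prefix_alternatingD unfolding hat_word_alternating by blast
  have "length (alternating (pre_len j - 1)) \<le> length g"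
    using Yset_ray_bounds(1)[OF assms rooted_subtree_root[OF g]] by (rule prefix_length_le)
  then have "0 < m" using assms by (simp add: m pre_len_def)
  then obtain k where "m = Suc k" by (cases m) auto
  moreover from this have "fst (last g) \<in> {1, 2}" by (simp add: m alternating_Suc)
  ultimately show ?thesis using that g m by simp
qed

text \<open>The geodesic from the root to \<open>y\<close> follows the ray up to the root of
  \<open>Yset w j\<close> and stays inside the set afterwards.\<close>

lemma Yset_prefix_cases:
  assumes "1 \<le> j" "y \<in> Yset w j" "y = p @ l # x"
  shows "p \<in> Yset w j \<or> prefix (p @ [l]) (hat_word w j)"
proof -
  obtain g where g: "rooted_subtree g (Yset w j)" using Yset_subtree[OF assms(1)] by blast
  have gy: "prefix g y" by (rule rooted_subtree_prefix[OF g assms(2)])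
  have py: "prefix (p @ [l]) y" using assms(3) by simp
  show ?thesis
  proof (cases "prefix g p")
    case True
    then have "p \<in> Yset w j" using rooted_subtree_between[OF g assms(2)] assms(3) by simp
    then show ?thesis by simp
  next
    case False
    have "prefix g (p @ [l]) \<or> prefix (p @ [l]) g" using gy py prefix_same_cases by blast
    then have "prefix (p @ [l]) g" using False by (auto simp: prefix_snoc)
    moreover have "prefix g (hat_word w j)"
      using rooted_subtree_prefix[OF g] hat_word_in_Zset Zset_subset_Yset by blast
    ultimately show ?thesis using prefix_order.trans by blast
  qed
qed

lemma prefix_hat_word_label: "prefix (p @ [l]) (hat_word w j) \<Longrightarrow> fst l \<in> {1, 2}"
  unfolding hat_word_alternating
  by (metis in_set_conv_decomp set_alternating set_mono_prefix subsetD)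

text \<open>Pruning at one of the sets must spare the others. On the way to \<open>y\<close> all
  steps before \<open>Yset w j\<close> run along the ray, with labels 1 and 2, and the steps within
  \<open>Yset w j\<close> start at no vertex of another \<open>Yset w i\<close>.\<close>

lemma exits_ok_Yset:
  assumes "1 \<le> i" "1 \<le> j" "y \<in> Yset w j"
  shows "exits_ok (Yset w i) y"
  unfolding exits_ok_def
proof (intro allI impI)
  fix p l x assume a: "y = p @ l # x \<and> p \<in> Yset w i \<and> p @ [l] \<notin> Yset w i"
  obtain g where g: "rooted_subtree g (Yset w j)" using Yset_subtree[OF assms(2)] by blast
  show "fst l \<in> {1, 2}"
  proof (cases "p \<in> Yset w j")
    case True
    then have "i = j" using a Yset_disjoint[OF assms(1,2)] by blast
    moreover have "p @ [l] \<in> Yset w j"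
      using rooted_subtree_between[OF g assms(3), of "p @ [l]"] rooted_subtree_prefix[OF g True] a
      by (simp add: prefix_prefix)
    ultimately show ?thesis using a by simp
  next
    case False
    then show ?thesis using Yset_prefix_cases[OF assms(2,3)] a prefix_hat_word_label by blast
  qed
qed

lemma Gam_eq: "Gam w j = {u \<in> tree_verts. \<forall>i\<in>{1..j}. exits_ok (Yset w i) u}"
proof (induction j)
  case (Suc j)
  let ?S = "Gam w j"
  obtain g k where g: "rooted_subtree g (Yset w (Suc j))" "g = alternating (Suc k)" "fst (last g) \<in> {1, 2}"
    by (rule Yset_root[of "Suc j"]) simp_all
  have "prune ?S (Yset w (Suc j)) = {u \<in> ?S. exits_ok (Yset w (Suc j)) u}"
  proof (rule prune_eq)
    show "?S \<subseteq> tree_verts" using Suc by simp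
    show "v \<in> ?S" if "u \<in> ?S" "prefix v u" for u v
      using that exits_ok_prefix tree_verts_prefix unfolding Suc by blast
    show "Yset w (Suc j) \<subseteq> ?S"
    proof
      fix y assume y: "y \<in> Yset w (Suc j)"
      have "exits_ok (Yset w i) y" if "i \<in> {1..j}" for i
        by (rule exits_ok_Yset[OF _ _ y]) (use that in simp_all)
      moreover have "y \<in> tree_verts" using y Yset_tree_verts[of "Suc j"] by auto
      ultimately show "y \<in> ?S" unfolding Suc by blast
    qed
    show "g \<noteq> []" using g(2) by (simp add: alternating_Suc)
  qed (use g in simp_all)
  then show ?case unfolding Gam.simps Suc by (auto simp: atLeastAtMostSuc_conv)
qed simp

lemma Gam_inf_eq: "Gam_inf w = {u \<in> tree_verts. \<forall>i\<ge>1. exits_ok (Yset w i) u}"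
  unfolding Gam_inf_def Gam_eq by fastforce

lemma Gam_inf_prefix: "u \<in> Gam_inf w \<Longrightarrow> prefix v u \<Longrightarrow> v \<in> Gam_inf w"
  unfolding Gam_inf_eq using exits_ok_prefix tree_verts_prefix by blast

lemma Yset_edge_label:
  assumes "1 \<le> j" "{p, p @ [l]} \<subseteq> Yset w j"
  shows "fst l \<in> {1..nmin w j}"
proof -
  obtain u s where "u \<in> Zset w j" "s \<in> {1..nmin w j}" "{p, p @ [l]} \<subseteq> gen_line u s"
    using Yset_subtree[OF assms(1)] assms(2) by metis
  then show ?thesis using gen_line_subtree(2)[OF reduced_Zset] by metis
qed

text \<open>At a vertex of \<open>Yset w j\<close> the edges away from the root either stay in the
  set, with labels up to \<open>nmin w j\<close>, or are exits with label 1 or 2. Outside all of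
  these sets, pruning does not restrict the next letter.\<close>

lemma infinite_valence_iff:
  assumes u: "u \<in> Gam_inf w"
  shows "infinite_valence (Gam_inf w) u \<longleftrightarrow> (\<forall>j\<ge>1. u \<notin> Yset w j)"
proof -
  have sub: "Gam_inf w \<subseteq> tree_verts" by (auto simp: Gam_inf_eq)
  let ?E = "{(x, i, y) \<in> tree_edges (Gam_inf w). x = u \<or> y = u}"
  have "finite ?E" if j: "1 \<le> j" "u \<in> Yset w j" for j
  proof -
    \<comment> \<open>The entry \<open>fst (last u)\<close> accounts for the edge towards the
      root.\<close>
    let ?N = "max (max 2 (nmin w j)) (fst (last u))"
    have b: "i \<le> ?N" if v: "v \<in> Gam_inf w" "v = u @ [(i, b)] \<or> u = v @ [(i, b)]" for v i b
    proof (cases "v = u @ [(i, b)]")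
      case True
      show ?thesis
      proof (cases "v \<in> Yset w j")
        case in_Y: True
        then have "{u, u @ [(i, b)]} \<subseteq> Yset w j" using j True by simp
        then show ?thesis using Yset_edge_label[OF j(1)] by fastforce
      next
        case False
        have "exits_ok (Yset w j) v" using v(1) j by (simp add: Gam_inf_eq)
        then have "i \<in> {1, 2}" unfolding exits_ok_def using True False j(2) by fastforce
        then show ?thesis by auto
      qed
    next
      case False
      then show ?thesis using v by auto
    qed
    have "?E \<subseteq> (\<lambda>i. (u, i, rmul u (i, True))) ` {..?N} \<union> (\<lambda>i. (rmul u (i, False), i, u)) ` {..?N}"
    proof
      fix e assume "e \<in> ?E"
      then obtain x i y where e: "e = (x, i, y)" "x \<in> Gam_inf w" "y \<in> Gam_inf w"
          "y = rmul x (i, True)" "x = u \<or> y = u"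
        by (auto simp: tree_edges_iff[OF sub])
      have rx: "is_reduced x" using e sub by (auto simp: tree_verts_def)
      have c: "y = x @ [(i, True)] \<or> x = y @ [(i, False)]"
        unfolding e(4) by (rule rmul_cases[of x "(i, True)"]) auto
      show "e \<in> (\<lambda>i. (u, i, rmul u (i, True))) ` {..?N} \<union> (\<lambda>i. (rmul u (i, False), i, u)) ` {..?N}"
        using e(5)
      proof
        assume "x = u"
        moreover from this have "i \<le> ?N" using b[OF e(3)] c by blast
        ultimately show ?thesis using e by auto
      next
        assume "y = u"
        moreover from this have "i \<le> ?N" using b[OF e(2)] c by blast
        moreover have "x = rmul y (i, False)" using rmul_rmul_inv[OF rx, of "(i, True)"] e(4) by simp
        ultimately show ?thesis using e(1) by auto
      qed
    qed
    then show "finite ?E" by (rule finite_subset) simp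
  qed
  moreover have "infinite ?E" if nY: "\<forall>j\<ge>1. u \<notin> Yset w j"
  proof
    assume fin: "finite ?E"
    \<comment> \<open>A letter whose label exceeds that of the last letter of \<open>u\<close>
      cannot cancel with it.\<close>
    let ?I = "{max 1 (Suc (fst (last u)))..}"
    have "(\<lambda>i. (u, i, u @ [(i, True)])) ` ?I \<subseteq> ?E"
    proof (rule image_subsetI)
      fix i assume i: "i \<in> ?I"
      have ut: "u \<in> tree_verts" using u sub by blast
      have red: "is_reduced (u @ [(i, True)])"
        using i ut by (auto simp: is_reduced_snoc tree_verts_def)
      have "exits_ok (Yset w j) (u @ [(i, True)])" if "1 \<le> j" for j
        unfolding exits_ok_def
      proof (intro allI impI)
        fix p l x assume a: "u @ [(i, True)] = p @ l # x \<and> p \<in> Yset w j \<and> p @ [l] \<notin> Yset w j"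
        have "p \<noteq> u" using a nY that by blast
        then obtain x' where "u = p @ l # x'"
          using a by (cases x rule: rev_cases) auto
        moreover have "exits_ok (Yset w j) u" using u that by (simp add: Gam_inf_eq)
        ultimately show "fst l \<in> {1, 2}" using a unfolding exits_ok_def by blast
      qed
      moreover have "u @ [(i, True)] \<in> tree_verts"
        using ut red i by (auto simp: tree_verts_def words_iff)
      ultimately have v: "u @ [(i, True)] \<in> Gam_inf w" by (simp add: Gam_inf_eq)
      have "u @ [(i, True)] = rmul u (i, True)" using red by (auto simp: rmul_def is_reduced_snoc)
      then show "(u, i, u @ [(i, True)]) \<in> ?E"
        using v u i by (simp add: tree_edges_iff[OF sub])
    qed
    then have "finite ((\<lambda>i. (u, i, u @ [(i, True)])) ` ?I)" using fin finite_subset by blast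
    then have "finite ?I" by (rule finite_imageD) (auto simp: inj_on_def)
    then show False using infinite_Ici by blast
  qed
  ultimately show ?thesis unfolding infinite_valence_def by blast
qed

text \<open>Pruning and the removal of branches at vertices of infinite valence amount to one
  condition on each edge of the geodesic from the root. If the label is neither 1 nor 2, the start
  of the edge must have finite valence, hence lie in some \<open>Yset w j\<close>, and leaving this
  set by such an edge is what pruning forbids.\<close>

lemma Gam_star_eq:
  "Gam_star w = {u \<in> tree_verts. \<forall>p l x. u = p @ l # x \<longrightarrow>
     fst l \<in> {1, 2} \<or> (\<exists>j\<ge>1. p \<in> Yset w j \<and> p @ [l] \<in> Yset w j)}" (is "_ = ?G")
proof (intro Set.set_eqI iffI)
  fix v assume v: "v \<in> Gam_star w"
  then have vi: "v \<in> Gam_inf w" by (simp add: Gam_star_def)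
  have "fst l \<in> {1, 2} \<or> (\<exists>j\<ge>1. p \<in> Yset w j \<and> p @ [l] \<in> Yset w j)" if vp: "v = p @ l # x" for p l x
  proof (cases "fst l \<in> {1, 2}")
    case False
    have p: "p \<in> Gam_inf w" using vi Gam_inf_prefix vp by simp
    have "\<not> infinite_valence (Gam_inf w) p"
      using v p vp False unfolding Gam_star_def by (cases l) auto
    then obtain j where j: "1 \<le> j" "p \<in> Yset w j" using infinite_valence_iff[OF p] by blast
    moreover have "exits_ok (Yset w j) v" using vi j by (simp add: Gam_inf_eq)
    ultimately show ?thesis using vp False unfolding exits_ok_def by blast
  qed simp
  then show "v \<in> ?G" using vi unfolding Gam_inf_eq by blast
next
  fix v assume v: "v \<in> ?G"
  have letter: "fst l \<in> {1, 2} \<or> (\<exists>j\<ge>1. p \<in> Yset w j \<and> p @ [l] \<in> Yset w j)" if "v = p @ l # x" for p l x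
    using v that by blast
  have "exits_ok (Yset w i) v" if i: "1 \<le> i" for i
    unfolding exits_ok_def
  proof (intro allI impI)
    fix p l x assume a: "v = p @ l # x \<and> p \<in> Yset w i \<and> p @ [l] \<notin> Yset w i"
    then show "fst l \<in> {1, 2}" using letter Yset_disjoint[OF i] by metis
  qed
  then have vi: "v \<in> Gam_inf w" using v by (simp add: Gam_inf_eq)
  have False if a: "v = u @ (k, b) # x" "u \<in> Gam_inf w" "infinite_valence (Gam_inf w) u" "k \<notin> {1, 2}" for u k b x
    using letter[OF a(1)] a infinite_valence_iff[OF a(2)] by auto
  then show "v \<in> Gam_star w" using vi unfolding Gam_star_def by blast
qed

lemma Gam_star_tree_verts: "Gam_star w \<subseteq> tree_verts"
  unfolding Gam_star_eq by blast

lemma Gam_star_reduced: "v \<in> Gam_star w \<Longrightarrow> is_reduced v"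
  using Gam_star_tree_verts by (auto simp: tree_verts_def)

lemma Gam_star_snoc:
  "u @ [l] \<in> Gam_star w \<longleftrightarrow> u \<in> Gam_star w \<and> u @ [l] \<in> tree_verts \<and>
     (fst l \<in> {1, 2} \<or> (\<exists>j\<ge>1. u \<in> Yset w j \<and> u @ [l] \<in> Yset w j))"
proof
  assume a: "u @ [l] \<in> Gam_star w"
  then have "u \<in> tree_verts" using Gam_star_tree_verts tree_verts_prefix[of "u @ [l]" u] by auto
  moreover have "fst k \<in> {1, 2} \<or> (\<exists>j\<ge>1. p \<in> Yset w j \<and> p @ [k] \<in> Yset w j)" if "u = p @ k # x" for p k x
  proof -
    have "u @ [l] = p @ k # (x @ [l])" using that by simp
    then show ?thesis using a unfolding Gam_star_eq by blast
  qed
  ultimately have "u \<in> Gam_star w" unfolding Gam_star_eq by blast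
  then show "u \<in> Gam_star w \<and> u @ [l] \<in> tree_verts \<and>
     (fst l \<in> {1, 2} \<or> (\<exists>j\<ge>1. u \<in> Yset w j \<and> u @ [l] \<in> Yset w j))"
    using a unfolding Gam_star_eq by blast
next
  assume a: "u \<in> Gam_star w \<and> u @ [l] \<in> tree_verts \<and>
     (fst l \<in> {1, 2} \<or> (\<exists>j\<ge>1. u \<in> Yset w j \<and> u @ [l] \<in> Yset w j))"
  have "fst k \<in> {1, 2} \<or> (\<exists>j\<ge>1. p \<in> Yset w j \<and> p @ [k] \<in> Yset w j)" if e: "u @ [l] = p @ k # x" for p k x
  proof (cases x rule: rev_cases)
    case Nil
    then show ?thesis using a e by auto
  next
    case (snoc x' l')
    then have "u = p @ k # x'" using e by simp
    then show ?thesis using a unfolding Gam_star_eq by blast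
  qed
  then show "u @ [l] \<in> Gam_star w" using a unfolding Gam_star_eq by blast
qed

lemma Gam_star_rmul:
  assumes v: "v \<in> Gam_star w" and i: "1 \<le> i"
  shows "rmul v (i, b) \<in> Gam_star w \<longleftrightarrow>
    i \<in> {1, 2} \<or> (\<exists>j\<ge>1. v \<in> Yset w j \<and> rmul v (i, b) \<in> Yset w j)"
proof (rule rmul_cases[of v "(i, b)"])
  assume e: "rmul v (i, b) = v @ [(i, b)]"
  have "v @ [(i, b)] \<in> tree_verts"
    using tree_verts_rmul[OF _ i, of v b] v Gam_star_tree_verts e by auto
  then show ?thesis using v Gam_star_snoc[of v "(i, b)"] unfolding e by simp
next
  assume e: "v = rmul v (i, b) @ [inv_letter (i, b)]"
  then show ?thesis using v Gam_star_snoc[of "rmul v (i, b)" "inv_letter (i, b)"] by auto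
qed

text \<open>An edge of \<open>Yset w j\<close> lies on a line with its own label, and a line is
  invariant under both signs. So the right side does not depend on \<open>b\<close>, which is why
  incoming and outgoing edges of a vertex have the same labels.\<close>

lemma Yset_rmul:
  assumes v: "is_reduced v" and i: "1 \<le> j"
  shows "v \<in> Yset w j \<and> rmul v (i, b) \<in> Yset w j \<longleftrightarrow>
    i \<in> {1..nmin w j} \<and> (\<exists>u\<in>Zset w j. v \<in> gen_line u i)"
proof
  assume a: "v \<in> Yset w j \<and> rmul v (i, b) \<in> Yset w j"
  have "\<exists>u\<in>Zset w j. \<exists>s\<in>{1..nmin w j}. {v, rmul v (i, b)} \<subseteq> gen_line u s \<and> s = i"
  proof (rule rmul_cases[of v "(i, b)"])
    assume e: "rmul v (i, b) = v @ [(i, b)]"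
    then obtain u s where us: "u \<in> Zset w j" "s \<in> {1..nmin w j}" "{v, v @ [(i, b)]} \<subseteq> gen_line u s"
      using Yset_subtree[OF i] a by (metis empty_subsetI insert_subset)
    then have "s = i" using gen_line_subtree(2)[OF reduced_Zset[OF us(1)] us(3)] by simp
    then show ?thesis using us e by auto
  next
    let ?p = "rmul v (i, b)"
    assume e: "v = ?p @ [inv_letter (i, b)]"
    then have "{?p, ?p @ [inv_letter (i, b)]} \<subseteq> Yset w j" using a by simp
    then obtain u s where us: "u \<in> Zset w j" "s \<in> {1..nmin w j}" "{?p, ?p @ [inv_letter (i, b)]} \<subseteq> gen_line u s"
      using Yset_subtree[OF i] by metis
    then have "s = i" using gen_line_subtree(2)[OF reduced_Zset[OF us(1)] us(3)] by simp
    then show ?thesis using us e by auto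
  qed
  then show "i \<in> {1..nmin w j} \<and> (\<exists>u\<in>Zset w j. v \<in> gen_line u i)" by blast
next
  assume a: "i \<in> {1..nmin w j} \<and> (\<exists>u\<in>Zset w j. v \<in> gen_line u i)"
  then obtain u where u: "u \<in> Zset w j" "v \<in> gen_line u i" by blast
  then have "rmul v (i, b) \<in> gen_line u i" by (intro gen_line_rmul)
  then show "v \<in> Yset w j \<and> rmul v (i, b) \<in> Yset w j" using u a unfolding Yset_def by blast
qed

section \<open>Labels of the tree edges at a vertex\<close>

lemma E_set_rmul_False:
  assumes "v \<in> Gam_star w"
  shows "i \<in> E_set w v \<longleftrightarrow> 1 \<le> i \<and> rmul v (i, False) \<in> Gam_star w"
proof
  assume "i \<in> E_set w v"
  then obtain u where u: "u \<in> Gam_star w" "1 \<le> i" "v = rmul u (i, True)"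
    by (auto simp: E_set_def tree_edges_iff[OF Gam_star_tree_verts])
  then have "rmul v (i, False) = u"
    using rmul_rmul_inv[OF Gam_star_reduced[OF u(1)], of "(i, True)"] by simp
  then show "1 \<le> i \<and> rmul v (i, False) \<in> Gam_star w" using u by simp
next
  assume a: "1 \<le> i \<and> rmul v (i, False) \<in> Gam_star w"
  then have "v = rmul (rmul v (i, False)) (i, True)"
    using rmul_rmul_inv[OF Gam_star_reduced[OF assms], of "(i, False)"] by simp
  then show "i \<in> E_set w v"
    using a assms unfolding E_set_def tree_edges_iff[OF Gam_star_tree_verts] by blast
qed

lemma E_set_iff:
  assumes v: "v \<in> Gam_star w"
  shows "i \<in> E_set w v \<longleftrightarrow> i \<in> {1, 2} \<or> (\<exists>j\<ge>1. i \<in> {1..nmin w j} \<and> (\<exists>u\<in>Zset w j. v \<in> gen_line u i))"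
  unfolding E_set_rmul_False[OF v]
  using Gam_star_rmul[OF v, of i False] Yset_rmul[OF Gam_star_reduced[OF v], of _ i False] by auto

lemma E_set_rmul:
  assumes v: "v \<in> Gam_star w"
  shows "i \<in> E_set w v \<longleftrightarrow> 1 \<le> i \<and> rmul v (i, b) \<in> Gam_star w"
  unfolding E_set_iff[OF v]
  using Gam_star_rmul[OF v, of i b] Yset_rmul[OF Gam_star_reduced[OF v], of _ i b] by auto

lemma E_set_rmul_eq:
  assumes v: "v \<in> Gam_star w" and i: "i \<in> E_set w v"
  shows "i \<in> E_set w (rmul v (i, b))"
proof -
  have "rmul v (i, b) \<in> Gam_star w" "1 \<le> i" using i E_set_rmul[OF v] by auto
  then show ?thesis
    using E_set_rmul[of "rmul v (i, b)" i "\<not> b"] rmul_rmul_inv[OF Gam_star_reduced[OF v], of "(i, b)"] v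
    by simp
qed

lemma E_set_Yset:
  assumes v: "v \<in> Gam_star w" and j: "1 \<le> j" "v \<in> Yset w j"
  shows "E_set w v \<subseteq> {1..nmin w j}"
proof
  fix i assume "i \<in> E_set w v"
  then consider "i \<in> {1, 2}" | k u where "1 \<le> k" "i \<in> {1..nmin w k}" "u \<in> Zset w k" "v \<in> gen_line u i"
    unfolding E_set_iff[OF v] by blast
  then show "i \<in> {1..nmin w j}"
  proof cases
    case 1
    then show ?thesis using nmin_props[OF j(1)] by auto
  next
    case 2
    then have "v \<in> Yset w k" unfolding Yset_def by blast
    then show ?thesis using Yset_disjoint[OF 2(1) j(1)] j(2) 2(2) by blast
  qed
qed

lemma finite_E_set:
  assumes v: "v \<in> Gam_star w"
  shows "finite (E_set w v)" "E_set w v \<subseteq> {1..}"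
proof -
  show "finite (E_set w v)"
  proof (cases "\<exists>j\<ge>1. v \<in> Yset w j")
    case True
    then show ?thesis using E_set_Yset[OF v] finite_subset by blast
  next
    case False
    then have "E_set w v \<subseteq> {1, 2}" unfolding Yset_def using E_set_iff[OF v] by blast
    then show ?thesis using finite_subset by blast
  qed
  show "E_set w v \<subseteq> {1..}" unfolding E_set_rmul_False[OF v] subset_iff using E_set_rmul_False[OF v] by simp
qed

text \<open>Along \<open>Zset w j\<close> the graph looks like the Cayley tree of the free group on
  \<open>nmin w j\<close> generators, with loops for the other labels: the lines through
  \<open>v\<close> itself provide each label up to \<open>nmin w j\<close>, and disjointness of the
  sets \<open>Yset w k\<close> excludes further ones.\<close>

lemma Zset_Gam_star:
  assumes "1 \<le> j" "v \<in> Zset w j"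
  shows "v \<in> Gam_star w" "E_set w v = {1..nmin w j}"
proof -
  have vY: "v \<in> Yset w j" using assms Zset_subset_Yset by blast
  obtain g where g: "rooted_subtree g (Zset w j)"
    using word_path_subtree unfolding Zset_word_path by blast
  have "fst l \<in> {1, 2} \<or> (\<exists>j\<ge>1. p \<in> Yset w j \<and> p @ [l] \<in> Yset w j)" if vp: "v = p @ l # x" for p l x
  proof (cases "prefix g p")
    case True
    then have "p \<in> Zset w j" "p @ [l] \<in> Zset w j"
      using rooted_subtree_between[OF g assms(2), of p] rooted_subtree_between[OF g assms(2), of "p @ [l]"] vp
      by (simp_all add: prefix_prefix)
    then show ?thesis using Zset_subset_Yset assms(1) by blast
  next
    case False
    have "prefix (p @ [l]) v" using vp by simp
    then have "prefix g (p @ [l]) \<or> prefix (p @ [l]) g"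
      using rooted_subtree_prefix[OF g assms(2)] prefix_same_cases by blast
    then have "prefix (p @ [l]) g" using False by (auto simp: prefix_snoc)
    then have "prefix (p @ [l]) (hat_word w j)"
      using rooted_subtree_prefix[OF g hat_word_in_Zset] prefix_order.trans by blast
    then show ?thesis using prefix_hat_word_label by blast
  qed
  then show v: "v \<in> Gam_star w" using vY Yset_tree_verts[OF assms(1)] unfolding Gam_star_eq by blast
  have "i \<in> E_set w v" if "i \<in> {1..nmin w j}" for i
    unfolding E_set_iff[OF v]
    using that assms gen_line_self[OF Gam_star_reduced[OF v], of i] by blast
  then show "E_set w v = {1..nmin w j}" using E_set_Yset[OF v assms(1) vY] by blast
qed

lemma alternating_Gam_star: "alternating m \<in> Gam_star w"
proof -
  have "fst l \<in> {1, 2}" if "alternating m = p @ l # x" for p l x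
  proof -
    have "l \<in> set (alternating m)" unfolding that by simp
    then show ?thesis using set_alternating by blast
  qed
  then show ?thesis using alternating_tree_verts unfolding Gam_star_eq by blast
qed

end

section \<open>The circles of the Hawaiian earring\<close>

lemma circ_loop_inj:
  assumes "1 \<le> i" "0 \<le> s" "s < 1" "0 \<le> t" "t < 1" "circ_loop i s = circ_loop i t"
  shows "s = t"
proof -
  have "sin (2 * pi * s) = sin (2 * pi * t) \<and> cos (2 * pi * s) = cos (2 * pi * t)"
    using assms by (simp add: circ_loop_def)
  then obtain n :: int where "2 * pi * s = 2 * pi * t + 2 * pi * n"
    using sin_cos_eq_iff by metis
  then have "2 * pi * (s - t - n) = 0" by (simp add: algebra_simps)
  then have "s - t = n" by simp
  then have "n = 0" using assms by linarith
  then show ?thesis using \<open>s - t = n\<close> by simp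
qed

lemma circ_loop_0 [simp]: "circ_loop i 0 = (0, 0)" "circ_loop i 1 = (0, 0)"
  by (simp_all add: circ_loop_def)

lemma circ_loop_eq_0:
  assumes "1 \<le> i" "0 < t" "t < 1"
  shows "circ_loop i t \<noteq> (0, 0)"
  using circ_loop_inj[of i t 0] assms by auto

lemma circ_loop_in_circ: "1 \<le> i \<Longrightarrow> circ_loop i t \<in> circ i"
proof -
  assume i: "1 \<le> i"
  let ?x = "2 * pi * t"
  have "(sin ?x / i)\<^sup>2 + ((1 - cos ?x) / i - 1 / i)\<^sup>2 = ((sin ?x)\<^sup>2 + (cos ?x)\<^sup>2) / i\<^sup>2"
    by (simp add: power_divide diff_divide_distrib add_divide_distrib del: sin_cos_squared_add)
  also have "\<dots> = 1 / i\<^sup>2" by simp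
  finally show ?thesis by (simp add: circ_def circ_loop_def)
qed

lemma circ_eq_image:
  assumes i: "1 \<le> i"
  shows "circ i = circ_loop i ` {0..<1}"
proof (intro equalityI subsetI)
  fix p assume p: "p \<in> circ i"
  obtain x y where xy: "p = (x, y)" by fastforce
  have i0: "real i > 0" using i by simp
  have "(i * x)\<^sup>2 + (1 - i * y)\<^sup>2 = i\<^sup>2 * (x\<^sup>2 + (y - 1 / i)\<^sup>2)"
    using i0 by (simp add: power2_eq_square field_simps)
  also have "\<dots> = 1" using p i0 by (simp add: xy circ_def)
  finally have "(1 - i * y)\<^sup>2 + (i * x)\<^sup>2 = 1" by simp
  then obtain a where a: "0 \<le> a" "a < 2 * pi" "1 - i * y = cos a" "i * x = sin a"
    using sincos_total_2pi by metis
  have "p = circ_loop i (a / (2 * pi))"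
    using a i0 by (simp add: circ_loop_def xy field_simps)
  moreover have "a / (2 * pi) \<in> {0..<1}" using a by simp
  ultimately show "p \<in> circ_loop i ` {0..<1}" by blast
qed (use circ_loop_in_circ i in auto)

text \<open>On \<open>circ i\<close> the equation of the circle reads
  \<open>x\<^sup>2 + y\<^sup>2 = 2 * y / i\<close>, so this quotient recovers the index, and it is
  continuous away from the origin.\<close>

definition inv_radius :: "real \<times> real \<Rightarrow> real" where
  "inv_radius p = 2 * snd p / ((fst p)\<^sup>2 + (snd p)\<^sup>2)"

lemma inv_radius_circ:
  assumes "1 \<le> i" "p \<in> circ i" "p \<noteq> (0, 0)"
  shows "inv_radius p = i"
proof -
  obtain x y where xy: "p = (x, y)" by fastforce
  have i0: "real i > 0" using assms by simp
  have "x\<^sup>2 + (y - 1 / i)\<^sup>2 = 1 / i\<^sup>2" using assms by (simp add: xy circ_def)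
  moreover have "(y - 1 / i)\<^sup>2 = y\<^sup>2 - 2 * y / i + 1 / i\<^sup>2" by (simp add: power2_diff power_divide)
  ultimately have "x\<^sup>2 + y\<^sup>2 = 2 * y / i" by simp
  moreover have "x\<^sup>2 + y\<^sup>2 \<noteq> 0" using assms(3) xy by (simp add: sum_power2_eq_zero_iff)
  ultimately show ?thesis using i0 by (simp add: inv_radius_def xy field_simps)
qed

lemma circ_loop_eqD:
  assumes "1 \<le> i" "1 \<le> j" "0 < s" "s < 1" "0 \<le> t" "t \<le> 1" "circ_loop i s = circ_loop j t"
  shows "i = j" "s = t"
proof -
  have n: "circ_loop i s \<noteq> (0, 0)" by (rule circ_loop_eq_0[OF assms(1,3,4)])
  have "real i = real j"
    using inv_radius_circ[OF assms(1) circ_loop_in_circ n] inv_radius_circ[OF assms(2) circ_loop_in_circ]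
      assms n by (metis assms(1,2,7))
  then show ij: "i = j" by simp
  have "t \<noteq> 1" using n assms(7) by auto
  then show "s = t" using circ_loop_inj[of i s t] assms ij by simp
qed

lemma hawaiian_cases:
  assumes "p \<in> hawaiian"
  obtains "p = (0, 0)" | i t where "1 \<le> i" "0 < t" "t < 1" "p = circ_loop i t"
proof -
  obtain i where i: "1 \<le> i" "p \<in> circ i" using assms by (auto simp: hawaiian_def)
  then obtain t where t: "0 \<le> t" "t < 1" "p = circ_loop i t" using circ_eq_image by auto
  show ?thesis
  proof (cases "t = 0")
    case True
    then show ?thesis using that(1) t by simp
  next
    case False
    then have "0 < t" using t by simp
    then show ?thesis using that(2)[OF i(1) _ t(2,3)] by simp
  qed
qed

lemma circ_loop_hawaiian: "1 \<le> i \<Longrightarrow> circ_loop i t \<in> hawaiian"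
  using circ_loop_in_circ by (auto simp: hawaiian_def)

lemma zero_hawaiian: "(0, 0) \<in> hawaiian"
  using circ_loop_hawaiian[of 1 0] by simp

lemma continuous_on_circ_loop: "continuous_on S (circ_loop i)"
  unfolding circ_loop_def divide_inverse by (intro continuous_intros)

text \<open>Off the origin, \<open>inv_radius\<close> separates the circle \<open>i\<close> from all
  the others by an open condition; on the circle itself, the complementary part is the image of a
  compact set and can be taken away.\<close>

lemma openin_circ_loop_image:
  assumes i: "1 \<le> i" and J: "open J" "J \<subseteq> {0<..<1}"
  shows "openin (top_of_set hawaiian) (circ_loop i ` J)"
proof -
  let ?P = "{p. p \<noteq> (0, 0)} :: (real \<times> real) set"
  let ?K = "circ_loop i ` ({0..1} - J)"
  have "compact ?K"
    by (intro compact_continuous_image continuous_on_circ_loop compact_diff J) simp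
  then have cK: "closed ?K" by (rule compact_imp_closed)
  have "fst p \<noteq> 0 \<or> snd p \<noteq> 0" if "p \<in> ?P" for p using that by (cases p) auto
  then have c: "continuous_on ?P inv_radius"
    unfolding inv_radius_def by (intro continuous_intros) (auto simp: sum_power2_eq_zero_iff)
  have oP: "open ?P" by (simp add: Collect_neg_eq[symmetric] open_Collect_neq)
  have "open (?P \<inter> inv_radius -` {real i - 1/2<..<real i + 1/2})"
    by (rule continuous_open_preimage[OF c oP]) simp
  then have o: "open ((?P \<inter> inv_radius -` {real i - 1/2<..<real i + 1/2}) - ?K)" using cK by (rule open_Diff)
  have "circ_loop i ` J = hawaiian \<inter> ((?P \<inter> inv_radius -` {real i - 1/2<..<real i + 1/2}) - ?K)"
  proof (intro equalityI subsetI)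
    fix p assume "p \<in> circ_loop i ` J"
    then obtain t where t: "t \<in> J" "p = circ_loop i t" by blast
    then have t01: "0 < t" "t < 1" using J by auto
    have n: "p \<noteq> (0, 0)" using circ_loop_eq_0[OF i t01] t by simp
    moreover have "inv_radius p = i" using inv_radius_circ[OF i circ_loop_in_circ[OF i]] n t by simp
    moreover have "p \<notin> ?K"
    proof
      assume "p \<in> ?K"
      then obtain s where s: "s \<in> {0..1} - J" "p = circ_loop i s" by blast
      then have "t = s" using circ_loop_eqD(2)[OF i i t01, of s] t by simp
      then show False using s t by simp
    qed
    ultimately show "p \<in> hawaiian \<inter> ((?P \<inter> inv_radius -` {real i - 1/2<..<real i + 1/2}) - ?K)"
      using circ_loop_hawaiian[OF i] t by simp
  next
    fix p assume p: "p \<in> hawaiian \<inter> ((?P \<inter> inv_radius -` {real i - 1/2<..<real i + 1/2}) - ?K)"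
    then obtain k t where k: "1 \<le> k" "0 < t" "t < 1" "p = circ_loop k t"
      using hawaiian_cases[of p] by blast
    have "inv_radius p = k" using inv_radius_circ[OF k(1) circ_loop_in_circ[OF k(1)]] k(4) p by simp
    then have "k = i" using p by auto
    then show "p \<in> circ_loop i ` J" using k p by auto
  qed
  then show ?thesis using o by (auto simp: openin_open)
qed

text \<open>In this form the set is the earring without finitely many compact arcs, from which
  openness is immediate.\<close>

lemma H_nbhd_eq:
  "H_nbhd m = hawaiian - (\<Union>i\<in>{1..<m}. circ_loop i ` {3/8..5/8})"
proof (intro equalityI subsetI)
  fix p assume "p \<in> H_nbhd m"
  then consider i t where "i \<in> {1..<m}" "t \<in> {0..<3/8} \<union> {5/8<..1}" "p = circ_loop i t"
    | i where "m \<le> i" "p \<in> circ i" unfolding H_nbhd_def by blast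
  then show "p \<in> hawaiian - (\<Union>i\<in>{1..<m}. circ_loop i ` {3/8..5/8})"
  proof cases
    case 1
    have "p \<noteq> circ_loop j s" if "j \<in> {1..<m}" "s \<in> {3/8..5/8}" for j s
      using circ_loop_eqD(2)[of j i s t] 1 that by auto
    then have "p \<notin> (\<Union>i\<in>{1..<m}. circ_loop i ` {3/8..5/8})" by blast
    then show ?thesis using 1 circ_loop_hawaiian[of i t] by simp
  next
    case 2
    show ?thesis
    proof (cases "i = 0")
      \<comment> \<open>Since \<open>1 / 0 = 0\<close>, the circle with index 0 degenerates to the
        origin.\<close>
      case True
      then have "p \<in> hawaiian" "m = 0" using 2 zero_hawaiian by (auto simp: circ_def sum_power2_eq_zero_iff)
      then show ?thesis by simp
    next
      case False
      then have i: "1 \<le> i" by simp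
      then obtain t where t: "0 \<le> t" "t < 1" "p = circ_loop i t" using circ_eq_image 2 by auto
      have "p \<noteq> circ_loop j s" if "j \<in> {1..<m}" "s \<in> {3/8..5/8}" for j s
        using circ_loop_eqD(1)[of j i s t] i t that 2 by auto
      then have "p \<notin> (\<Union>i\<in>{1..<m}. circ_loop i ` {3/8..5/8})" by blast
      then show ?thesis using t circ_loop_hawaiian[OF i] by simp
    qed
  qed
next
  fix p assume p: "p \<in> hawaiian - (\<Union>i\<in>{1..<m}. circ_loop i ` {3/8..5/8})"
  then obtain i where i: "1 \<le> i" "p \<in> circ i" by (auto simp: hawaiian_def)
  then obtain t where t: "0 \<le> t" "t < 1" "p = circ_loop i t" using circ_eq_image by auto
  show "p \<in> H_nbhd m"
  proof (cases "m \<le> i")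
    case True
    then show ?thesis using i by (auto simp: H_nbhd_def)
  next
    case False
    then have im: "i \<in> {1..<m}" using i by simp
    then have "t \<notin> {3/8..5/8}" using p t(3) by blast
    then have "t \<in> {0..<3/8} \<union> {5/8<..1}" using t by auto
    then show ?thesis using im t(3) unfolding H_nbhd_def by blast
  qed
qed

lemma openin_H_nbhd: "openin (top_of_set hawaiian) (H_nbhd m)"
proof -
  have "closed (\<Union>i\<in>{1..<m}. circ_loop i ` {3/8..5/8})"
    by (intro closed_UN ballI compact_imp_closed compact_continuous_image continuous_on_circ_loop
        finite_atLeastLessThan compact_Icc)
  then have "openin (top_of_set hawaiian) (hawaiian \<inter> - (\<Union>i\<in>{1..<m}. circ_loop i ` {3/8..5/8}))"
    by (intro openin_open_Int open_Compl)
  then show ?thesis by (simp add: H_nbhd_eq Diff_eq)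
qed

text \<open>Open are the sets whose traces on all charts have open images. As \<open>q\<close> is
  injective on charts, images commute with intersections, and open images of the overlaps make the
  charts open. Any two such topologies agree on each chart, hence everywhere. This gives the
  definite description in \<open>hat_space\<close> its meaning.\<close>

lemma glued_topology_unique:
  fixes q :: "'a \<Rightarrow> 'b"
  assumes inj: "\<And>U. U \<in> \<U> \<Longrightarrow> inj_on q U"
    and op: "\<And>U V. U \<in> \<U> \<Longrightarrow> V \<in> \<U> \<Longrightarrow> openin B (q ` (U \<inter> V))"
  shows "\<exists>!T. topspace T = \<Union>\<U> \<and>
    (\<forall>U\<in>\<U>. openin T U \<and> homeomorphic_map (subtopology T U) (subtopology B (q ` U)) q)"
proof (rule ex_ex1I)
  let ?O = "\<lambda>S. S \<subseteq> \<Union>\<U> \<and> (\<forall>U\<in>\<U>. openin B (q ` (S \<inter> U)))"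
  let ?T = "topology ?O"
  have op1: "openin B (q ` U)" if "U \<in> \<U>" for U using op[OF that that] by simp
  have "istopology ?O"
    unfolding istopology_def
  proof (intro conjI allI impI)
    fix S S' assume "?O S" "?O S'"
    moreover have "q ` (S \<inter> S' \<inter> U) = q ` (S \<inter> U) \<inter> q ` (S' \<inter> U)" if "U \<in> \<U>" for U
      using inj_on_image_Int[OF inj[OF that], of "S \<inter> U" "S' \<inter> U"] by (simp add: Int_ac)
    ultimately show "S \<inter> S' \<subseteq> \<Union>\<U>" "\<forall>U\<in>\<U>. openin B (q ` (S \<inter> S' \<inter> U))" by auto
  next
    fix K assume K: "\<forall>S\<in>K. ?O S"
    have "q ` (\<Union>K \<inter> U) = (\<Union>S\<in>K. q ` (S \<inter> U))" for U by blast
    then show "\<Union>K \<subseteq> \<Union>\<U>" "\<forall>U\<in>\<U>. openin B (q ` (\<Union>K \<inter> U))" using K by auto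
  qed
  then have oT: "openin ?T S \<longleftrightarrow> ?O S" for S by (simp add: topology_inverse')
  have oU: "openin ?T U" if "U \<in> \<U>" for U unfolding oT using that op by blast
  have "topspace ?T = \<Union>\<U>"
  proof
    show "topspace ?T \<subseteq> \<Union>\<U>" unfolding topspace_def using oT by blast
    show "\<Union>\<U> \<subseteq> topspace ?T" using oU openin_subset by blast
  qed
  moreover have "homeomorphic_map (subtopology ?T U) (subtopology B (q ` U)) q" if U: "U \<in> \<U>" for U
  proof (rule bijective_open_imp_homeomorphic_map)
    have tU: "topspace (subtopology ?T U) = U" using openin_subset[OF oU[OF U]] by auto
    have tq: "topspace (subtopology B (q ` U)) = q ` U" using openin_subset[OF op1[OF U]] by auto
    show "q ` topspace (subtopology ?T U) = topspace (subtopology B (q ` U))" by (simp only: tU tq)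
    show "inj_on q (topspace (subtopology ?T U))" using inj[OF U] by (simp only: tU)
    show "continuous_map (subtopology ?T U) (subtopology B (q ` U)) q"
      unfolding continuous_map_def
    proof (intro conjI allI impI)
      show "q \<in> topspace (subtopology ?T U) \<rightarrow> topspace (subtopology B (q ` U))" unfolding tU tq by blast
      fix V assume V: "openin (subtopology B (q ` U)) V"
      then have oV: "openin B V" using openin_trans_full op1[OF U] by blast
      have Vq: "V \<subseteq> q ` U" using openin_subset[OF V] tq by simp
      have "openin B (q ` ({x \<in> U. q x \<in> V} \<inter> U'))" if U': "U' \<in> \<U>" for U'
      proof -
        have "q ` ({x \<in> U. q x \<in> V} \<inter> U') = V \<inter> q ` (U \<inter> U')" by auto
        then show ?thesis using oV op[OF U U'] by auto
      qed
      then have "openin ?T {x \<in> U. q x \<in> V}" unfolding oT using U by blast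
      then show "openin (subtopology ?T U) {x \<in> topspace (subtopology ?T U). q x \<in> V}"
        unfolding tU by (rule subset_openin_subtopology) blast
    qed
    show "open_map (subtopology ?T U) (subtopology B (q ` U)) q"
      unfolding open_map_def
    proof (intro allI impI)
      fix S assume "openin (subtopology ?T U) S"
      then obtain S0 where "openin ?T S0" "S = S0 \<inter> U" by (auto simp: openin_subtopology)
      then have "openin B (q ` S)" using U oT by blast
      then show "openin (subtopology B (q ` U)) (q ` S)"
        by (rule subset_openin_subtopology) (use \<open>S = S0 \<inter> U\<close> in blast)
    qed
  qed
  ultimately show "\<exists>T. topspace T = \<Union>\<U> \<and>
    (\<forall>U\<in>\<U>. openin T U \<and> homeomorphic_map (subtopology T U) (subtopology B (q ` U)) q)"
    using oU by blast
next
  have *: "openin T' S"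
    if T: "topspace T = \<Union>\<U> \<and>
        (\<forall>U\<in>\<U>. openin T U \<and> homeomorphic_map (subtopology T U) (subtopology B (q ` U)) q)"
      and T': "topspace T' = \<Union>\<U> \<and>
        (\<forall>U\<in>\<U>. openin T' U \<and> homeomorphic_map (subtopology T' U) (subtopology B (q ` U)) q)"
      and S: "openin T S" for T T' S
  proof -
    have "openin T' (S \<inter> U)" if U: "U \<in> \<U>" for U
    proof -
      have "openin (subtopology T U) (S \<inter> U)" using S by (rule openin_subtopology_Int)
      moreover have "open_map (subtopology T U) (subtopology B (q ` U)) q"
        using T U homeomorphic_imp_open_map by blast
      ultimately have "openin (subtopology B (q ` U)) (q ` (S \<inter> U))" by (simp add: open_map_def)
      moreover have "continuous_map (subtopology T' U) (subtopology B (q ` U)) q"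
        using T' U homeomorphic_imp_continuous_map by blast
      ultimately have "openin (subtopology T' U) {x \<in> topspace (subtopology T' U). q x \<in> q ` (S \<inter> U)}"
        by (rule openin_continuous_map_preimage[rotated])
      moreover have tU: "topspace (subtopology T' U) = U" using T' U openin_subset by fastforce
      moreover have "{x \<in> U. q x \<in> q ` (S \<inter> U)} = S \<inter> U"
        using inj[OF U] by (auto simp: inj_on_def)
      ultimately have "openin (subtopology T' U) (S \<inter> U)" by (simp only: tU)
      then show ?thesis using T' U openin_trans_full by blast
    qed
    then have "openin T' (\<Union>U\<in>\<U>. S \<inter> U)" by blast
    moreover have "(\<Union>U\<in>\<U>. S \<inter> U) = S" using openin_subset[OF S] T by auto
    ultimately show ?thesis by simp
  qed
  fix T T' assume
      T: "topspace T = \<Union>\<U> \<and>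
        (\<forall>U\<in>\<U>. openin T U \<and> homeomorphic_map (subtopology T U) (subtopology B (q ` U)) q)" and
      T': "topspace T' = \<Union>\<U> \<and>
        (\<forall>U\<in>\<U>. openin T' U \<and> homeomorphic_map (subtopology T' U) (subtopology B (q ` U)) q)"
  have "openin T S \<longleftrightarrow> openin T' S" for S using *[OF T T'] *[OF T' T] by (rule iffI)
  then show "T = T'" unfolding topology_eq by (rule allI)
qed

section \<open>The covering graph\<close>

lemma edge_param_eq_Inner: "edge_param e s = Inner e' t \<longleftrightarrow> e' = e \<and> t = s \<and> s \<noteq> 0 \<and> s \<noteq> 1"
  by (auto simp: edge_param_def)

lemma edge_param_eq_Vertex: "edge_param e s = Vertex v \<longleftrightarrow> s = 0 \<and> src e = v \<or> s = 1 \<and> tgt e = v"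
  by (auto simp: edge_param_def)

context word_enumeration
begin

text \<open>The permutation of the vertices by the generator \<open>a\<^sub>i\<close>, with the
  loops as its fixed points. The graph is determined by these permutations
  (\<open>hat_edges_iff\<close>).\<close>

definition act :: "nat \<Rightarrow> word \<Rightarrow> word" where
  "act i u = (if i \<in> E_set w u then rmul u (i, True) else u)"

lemma act_in: "u \<in> Gam_star w \<Longrightarrow> act i u \<in> Gam_star w"
  using E_set_rmul[of u i True] by (simp add: act_def)

lemma act_E_set:
  assumes "u \<in> Gam_star w"
  shows "i \<in> E_set w (act i u) \<longleftrightarrow> i \<in> E_set w u"
  using E_set_rmul_eq[OF assms, of i True] by (auto simp: act_def)

text \<open>A step with label \<open>i\<close> does not change whether \<open>i\<close> belongs to
  the \<open>E_set\<close> of the vertex, so either both vertices move along tree edges or both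
  stay.\<close>

lemma act_inj:
  assumes "u \<in> Gam_star w" "v \<in> Gam_star w" "act i u = act i v"
  shows "u = v"
proof -
  have "i \<in> E_set w u \<longleftrightarrow> i \<in> E_set w v" using act_E_set assms by metis
  then show ?thesis
    using assms rmul_rmul_inv[OF Gam_star_reduced] by (metis act_def)
qed

lemma act_surj:
  assumes v: "v \<in> Gam_star w"
  obtains u where "u \<in> Gam_star w" "act i u = v"
proof (cases "i \<in> E_set w v")
  case True
  have "rmul v (i, False) \<in> Gam_star w" using True E_set_rmul[OF v, of i False] by simp
  moreover have "act i (rmul v (i, False)) = v"
    using E_set_rmul_eq[OF v True, of False] rmul_rmul_inv[OF Gam_star_reduced[OF v], of "(i, False)"]
    by (simp add: act_def)
  ultimately show ?thesis using that by blast
next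
  case False
  then show ?thesis using that[of v] v by (simp add: act_def)
qed

lemma hat_edges_iff: "(u, i, v) \<in> hat_edges w \<longleftrightarrow> u \<in> Gam_star w \<and> 1 \<le> i \<and> v = act i u"
proof -
  have "(u, i, v) \<in> tree_edges (Gam_star w) \<longleftrightarrow> u \<in> Gam_star w \<and> i \<in> E_set w u \<and> v = rmul u (i, True)"
    unfolding tree_edges_iff[OF Gam_star_tree_verts] using E_set_rmul[of u i True] by auto
  moreover have "(u, i, v) \<in> hat_loops w \<longleftrightarrow> u \<in> Gam_star w \<and> 1 \<le> i \<and> i \<notin> E_set w u \<and> v = u"
    by (auto simp: hat_loops_def)
  moreover have "i \<in> E_set w u \<Longrightarrow> u \<in> Gam_star w \<Longrightarrow> 1 \<le> i" using E_set_rmul[of u i True] by simp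
  ultimately show ?thesis by (auto simp: hat_edges_def act_def)
qed

lemma hat_edgeE:
  assumes "e \<in> hat_edges w"
  obtains u i where "e = (u, i, act i u)" "u \<in> Gam_star w" "1 \<le> i" "src e = u" "lab e = i" "tgt e = act i u"
  using assms hat_edges_iff by (cases e) (auto simp: src_def lab_def tgt_def)

lemma hat_edge_eqI:
  assumes "e \<in> hat_edges w" "e' \<in> hat_edges w" "lab e = lab e'" "src e = src e' \<or> tgt e = tgt e'"
  shows "e = e'"
proof -
  obtain u i where e: "e = (u, i, act i u)" "u \<in> Gam_star w" "src e = u" "lab e = i" "tgt e = act i u"
    using hat_edgeE[OF assms(1)] by metis
  obtain u' i' where e': "e' = (u', i', act i' u')" "u' \<in> Gam_star w" "src e' = u'" "lab e' = i'" "tgt e' = act i' u'"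
    using hat_edgeE[OF assms(2)] by metis
  have "i = i'" using e e' assms by simp
  moreover from this have "u = u'" using e e' assms act_inj[OF e(2) e'(2)] by auto
  ultimately show ?thesis using e e' by simp
qed

lemma nvert_props:
  assumes v: "v \<in> Gam_star w"
  shows "2 \<le> nvert w v" "E_set w v \<subseteq> {1..nvert w v}"
proof -
  have "E_set w v \<subseteq> {1..max 2 (Max (insert 0 (E_set w v)))}"
    using finite_E_set[OF v] by (auto simp: le_max_iff_disj)
  then have "2 \<le> max 2 (Max (insert 0 (E_set w v))) \<and> E_set w v \<subseteq> {1..max 2 (Max (insert 0 (E_set w v)))}"
    by simp
  then have "2 \<le> nvert w v \<and> E_set w v \<subseteq> {1..nvert w v}" unfolding nvert_def by (rule LeastI)
  then show "2 \<le> nvert w v" "E_set w v \<subseteq> {1..nvert w v}" by auto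
qed

lemma act_fixed: "v \<in> Gam_star w \<Longrightarrow> nvert w v < i \<Longrightarrow> act i v = v"
  using nvert_props(2)[of v] by (auto simp: act_def)

lemma loop_at:
  assumes "e \<in> hat_edges w" "v \<in> Gam_star w" "src e = v \<or> tgt e = v" "nvert w v < lab e"
  shows "src e = v" "tgt e = v"
proof -
  obtain u i where e: "u \<in> Gam_star w" "1 \<le> i" "src e = u" "lab e = i" "tgt e = act i u"
    using hat_edgeE[OF assms(1)] by metis
  have "act i v = v" using act_fixed[OF assms(2)] assms(4) e by simp
  then have "u = v" using assms(3) e act_inj[OF e(1) assms(2)] by metis
  then show "src e = v" "tgt e = v" using e \<open>act i v = v\<close> by auto
qed

lemma hat_loops_iff:
  assumes "v \<in> Gam_star w" "src e = v" "nvert w v < lab e"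
  shows "e \<in> hat_loops w \<longleftrightarrow> e \<in> hat_edges w"
proof
  assume "e \<in> hat_edges w"
  then obtain i where "e = (v, i, act i v)" "1 \<le> i" "lab e = i"
    using hat_edgeE assms(2) by metis
  moreover from this have "act i v = v" "i \<notin> E_set w v"
    using act_fixed[OF assms(1)] nvert_props(2)[OF assms(1)] assms(3) by auto
  ultimately show "e \<in> hat_loops w" using assms(1) by (auto simp: hat_loops_def)
qed (simp add: hat_edges_def)

lemma Inner_vertex_nbhd:
  assumes v: "v \<in> Gam_star w"
  shows "Inner e t \<in> vertex_nbhd w v \<longleftrightarrow> e \<in> hat_edges w \<and> 0 < t \<and> t < 1 \<and>
    (src e = v \<and> t < 3/8 \<or> tgt e = v \<and> 5/8 < t \<or> src e = v \<and> nvert w v < lab e)"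
  (is "?L \<longleftrightarrow> ?R")
proof -
  have im: "Inner e t \<in> edge_param e' ` A \<longleftrightarrow> e' = e \<and> t \<in> A \<and> t \<noteq> 0 \<and> t \<noteq> 1" for e' A
    using edge_param_eq_Inner by (metis (no_types, lifting) imageE image_eqI)
  have "?L \<longleftrightarrow> (e \<in> hat_edges w \<and> src e = v \<and> t \<in> {0..<3/8} \<and> t \<noteq> 0 \<and> t \<noteq> 1) \<or>
      (e \<in> hat_edges w \<and> tgt e = v \<and> t \<in> {5/8<..1} \<and> t \<noteq> 0 \<and> t \<noteq> 1) \<or>
      (e \<in> hat_loops w \<and> src e = v \<and> nvert w v < lab e \<and> t \<in> {0..1} \<and> t \<noteq> 0 \<and> t \<noteq> 1)"
    unfolding vertex_nbhd_def Un_iff UN_iff im by blast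
  also have "\<dots> \<longleftrightarrow> ?R"
    using hat_loops_iff[OF v, of e] by auto
  finally show ?thesis .
qed

lemma Vertex_vertex_nbhd:
  assumes v: "v \<in> Gam_star w"
  shows "Vertex u \<in> vertex_nbhd w v \<longleftrightarrow> u = v"
proof
  assume "Vertex u \<in> vertex_nbhd w v"
  then consider e s where "src e = v" "s \<in> {0..<3/8}" "Vertex u = edge_param e s"
    | e s where "tgt e = v" "s \<in> {5/8<..1}" "Vertex u = edge_param e s"
    | e s where "src e = v" "e \<in> hat_loops w" "Vertex u = edge_param e s"
    unfolding vertex_nbhd_def by blast
  then show "u = v"
  proof cases
    case 1
    then show ?thesis using edge_param_eq_Vertex[THEN iffD1, OF 1(3)[symmetric]] by auto
  next
    case 2
    then show ?thesis using edge_param_eq_Vertex[THEN iffD1, OF 2(3)[symmetric]] by auto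
  next
    case 3
    then have "tgt e = v" by (auto simp: hat_loops_def src_def tgt_def)
    then show ?thesis using 3(1) edge_param_eq_Vertex[THEN iffD1, OF 3(3)[symmetric]] by auto
  qed
next
  assume "u = v"
  have "(v, 1, act 1 v) \<in> {e \<in> hat_edges w. src e = v}"
    using v hat_edges_iff by (simp add: src_def)
  moreover have "Vertex v = edge_param (v, 1, act 1 v) 0" by (simp add: edge_param_def src_def)
  moreover have "(0::real) \<in> {0..<3/8}" by simp
  ultimately show "Vertex u \<in> vertex_nbhd w v" unfolding vertex_nbhd_def \<open>u = v\<close> by blast
qed

lemma vertex_nbhd_subset:
  assumes v: "v \<in> Gam_star w"
  shows "vertex_nbhd w v \<subseteq> hat_points w"
proof
  fix x assume "x \<in> vertex_nbhd w v"
  then show "x \<in> hat_points w"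
    using v by (cases x) (auto simp: hat_points_def Inner_vertex_nbhd[OF v] Vertex_vertex_nbhd[OF v])
qed

lemma Inner_edge_nbhd: "Inner e t \<in> edge_nbhd e' \<longleftrightarrow> e = e' \<and> 1/4 < t \<and> t < 3/4"
proof
  assume "Inner e t \<in> edge_nbhd e'"
  then obtain s where s: "s \<in> {1/4<..<3/4}" "Inner e t = edge_param e' s" unfolding edge_nbhd_def by blast
  show "e = e' \<and> 1/4 < t \<and> t < 3/4" using s(1) edge_param_eq_Inner[THEN iffD1, OF s(2)[symmetric]] by auto
next
  assume a: "e = e' \<and> 1/4 < t \<and> t < 3/4"
  then have "edge_param e' t = Inner e t" by (simp add: edge_param_def)
  then show "Inner e t \<in> edge_nbhd e'" using a unfolding edge_nbhd_def by (metis greaterThanLessThan_iff image_eqI)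
qed

lemma Vertex_edge_nbhd: "Vertex v \<notin> edge_nbhd e"
proof
  assume "Vertex v \<in> edge_nbhd e"
  then obtain s where s: "s \<in> {1/4<..<3/4}" "Vertex v = edge_param e s" unfolding edge_nbhd_def by blast
  show False using s(1) edge_param_eq_Vertex[THEN iffD1, OF s(2)[symmetric]] by auto
qed

section \<open>Charts of the covering graph\<close>

definition charts :: "hat_point set set" where
  "charts = edge_nbhd ` hat_edges w \<union> vertex_nbhd w ` Gam_star w"

lemma Union_charts: "\<Union>charts = hat_points w"
proof (intro equalityI subsetI)
  fix x assume "x \<in> \<Union>charts"
  then show "x \<in> hat_points w"
  proof (elim UnionE)
    fix U assume U: "U \<in> charts" "x \<in> U"
    show "x \<in> hat_points w"
    proof (cases "U \<in> vertex_nbhd w ` Gam_star w")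
      case True
      then show ?thesis using U vertex_nbhd_subset by blast
    next
      case False
      then obtain e where "e \<in> hat_edges w" "x \<in> edge_nbhd e" using U by (auto simp: charts_def)
      then show ?thesis
      proof (cases x)
        case (Inner e' t)
        then have "e' = e" "0 < t" "t < 1" using \<open>x \<in> edge_nbhd e\<close> Inner_edge_nbhd by auto
        then show ?thesis using \<open>e \<in> hat_edges w\<close> Inner unfolding hat_points_def by blast
      qed (use Vertex_edge_nbhd \<open>x \<in> edge_nbhd e\<close> in simp)
    qed
  qed
next
  fix x assume x: "x \<in> hat_points w"
  show "x \<in> \<Union>charts"
  proof (cases x)
    case (Vertex v)
    then have "v \<in> Gam_star w" using x by (auto simp: hat_points_def)
    then show ?thesis using Vertex_vertex_nbhd Vertex unfolding charts_def by blast
  next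
    case (Inner e t)
    then have e: "e \<in> hat_edges w" "0 < t" "t < 1" using x by (auto simp: hat_points_def)
    obtain u i where u: "u \<in> Gam_star w" "src e = u" "tgt e = act i u" using hat_edgeE[OF e(1)] by metis
    consider "t < 3/8" | "5/8 < t" | "1/4 < t" "t < 3/4" by linarith
    then show ?thesis
    proof cases
      case 1
      then have "x \<in> vertex_nbhd w u" using Inner_vertex_nbhd[OF u(1)] Inner e u by simp
      then show ?thesis using u unfolding charts_def by blast
    next
      case 2
      then have "x \<in> vertex_nbhd w (act i u)" using Inner_vertex_nbhd[OF act_in[OF u(1)]] Inner e u by simp
      then show ?thesis using act_in[OF u(1)] unfolding charts_def by blast
    next
      case 3
      then have "x \<in> edge_nbhd e" using Inner Inner_edge_nbhd by simp
      then show ?thesis using e unfolding charts_def by blast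
    qed
  qed
qed

lemma q_map_Inner_eqD:
  assumes "e \<in> hat_edges w" "e' \<in> hat_edges w" "0 < t" "t < 1" "0 < t'" "t' < 1"
    and "q_map (Inner e t) = q_map (Inner e' t')"
  shows "lab e = lab e'" "t = t'"
proof -
  have "1 \<le> lab e" "1 \<le> lab e'" using assms(1,2) hat_edgeE by metis+
  then show "lab e = lab e'" "t = t'"
    using circ_loop_eqD[of "lab e" "lab e'" t t'] assms by auto
qed

lemma q_map_Inner_neq_0:
  "e \<in> hat_edges w \<Longrightarrow> 0 < t \<Longrightarrow> t < 1 \<Longrightarrow> q_map (Inner e t) \<noteq> (0, 0)"
  using circ_loop_eq_0[of "lab e" t] hat_edgeE[of e] by (metis q_map.simps(2))

lemma inj_on_chart:
  assumes "U \<in> charts"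
  shows "inj_on q_map U"
proof (cases "U \<in> vertex_nbhd w ` Gam_star w")
  case True
  then obtain v where v: "v \<in> Gam_star w" and U: "U = vertex_nbhd w v" by blast
  show ?thesis
  proof (rule inj_onI)
    fix x y assume xy: "x \<in> U" "y \<in> U" "q_map x = q_map y"
    show "x = y"
    proof (cases x)
      case (Vertex a)
      then show ?thesis
      proof (cases y)
        case (Vertex b)
        then show ?thesis using xy \<open>x = Vertex a\<close> Vertex_vertex_nbhd[OF v] U by simp
      next
        case (Inner e t)
        then show ?thesis
          using xy Inner_vertex_nbhd[OF v] q_map_Inner_neq_0[of e t] U \<open>x = Vertex a\<close> by simp
      qed
    next
      case (Inner e t)
      then have e: "e \<in> hat_edges w" "0 < t" "t < 1"
        "src e = v \<and> t < 3/8 \<or> tgt e = v \<and> 5/8 < t \<or> src e = v \<and> nvert w v < lab e"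
        using xy Inner_vertex_nbhd[OF v] U by auto
      show ?thesis
      proof (cases y)
        case (Vertex b)
        then show ?thesis
          using xy q_map_Inner_neq_0[of e t] e \<open>x = Inner e t\<close> by simp
      next
        case y: (Inner e' t')
        then have e': "e' \<in> hat_edges w" "0 < t'" "t' < 1"
          "src e' = v \<and> t' < 3/8 \<or> tgt e' = v \<and> 5/8 < t' \<or> src e' = v \<and> nvert w v < lab e'"
          using xy Inner_vertex_nbhd[OF v] U by auto
        have l: "lab e = lab e'" "t = t'"
          using q_map_Inner_eqD[OF e(1) e'(1) e(2,3) e'(2,3)] xy(3) Inner y by auto
        \<comment> \<open>For labels above \<open>nvert w v\<close> both edges are loops at
          \<open>v\<close>. For the others the common parameter decides: below 3/8 both leave
          \<open>v\<close>, above 5/8 both enter it.\<close>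
        have "src e = src e' \<or> tgt e = tgt e'"
        proof (cases "nvert w v < lab e")
          case True
          then have "nvert w v < lab e'" using l(1) by simp
          then have "src e' = v" using loop_at(1)[OF e'(1) v] e'(4) by blast
          moreover have "src e = v" using loop_at(1)[OF e(1) v] e(4) True by blast
          ultimately show ?thesis by simp
        next
          case False
          then have "\<not> nvert w v < lab e'" using l(1) by simp
          moreover have "\<not> (t < 3/8 \<and> 5/8 < t)" by simp
          ultimately show ?thesis using False e(4) e'(4)[folded l(2)] by metis
        qed
        then have "e = e'" by (rule hat_edge_eqI[OF e(1) e'(1) l(1)])
        then show ?thesis using Inner y l by simp
      qed
    qed
  qed
next
  case False
  then obtain e where e: "e \<in> hat_edges w" and U: "U = edge_nbhd e" using assms by (auto simp: charts_def)
  show ?thesis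
  proof (rule inj_onI)
    fix x y assume xy: "x \<in> U" "y \<in> U" "q_map x = q_map y"
    obtain s where s: "x = Inner e s" "1/4 < s" "s < 3/4"
      using xy(1) U Inner_edge_nbhd Vertex_edge_nbhd by (cases x) auto
    obtain t where t: "y = Inner e t" "1/4 < t" "t < 3/4"
      using xy(2) U Inner_edge_nbhd Vertex_edge_nbhd by (cases y) auto
    show "x = y" using q_map_Inner_eqD(2)[OF e e, of s t] s t xy(3) by simp
  qed
qed

lemma q_map_edge_nbhd: "q_map ` edge_nbhd e = H_arc (lab e)"
  by (simp add: edge_nbhd_def H_arc_def image_image q_map_edge_param)

lemma q_map_vertex_nbhd:
  assumes v: "v \<in> Gam_star w"
  shows "q_map ` vertex_nbhd w v = H_nbhd (Suc (nvert w v))"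
proof -
  let ?A = "{e \<in> hat_edges w. src e = v}" and ?B = "{e \<in> hat_edges w. tgt e = v}"
    and ?C = "{e \<in> hat_loops w. src e = v \<and> nvert w v < lab e}"
  have A: "lab ` ?A = {1..}"
  proof (intro equalityI subsetI)
    fix i :: nat assume "i \<in> {1..}"
    then have "(v, i, act i v) \<in> ?A" using v hat_edges_iff by (simp add: src_def)
    then show "i \<in> lab ` ?A" by (rule rev_image_eqI) (simp add: lab_def)
  qed (auto elim: hat_edgeE)
  have B: "lab ` ?B = {1..}"
  proof (intro equalityI subsetI)
    fix i :: nat assume i: "i \<in> {1..}"
    obtain u where "u \<in> Gam_star w" "act i u = v" using act_surj[OF v] by metis
    then have "(u, i, v) \<in> ?B" using hat_edges_iff i by (simp add: tgt_def)
    then show "i \<in> lab ` ?B" by (rule rev_image_eqI) (simp add: lab_def)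
  qed (auto elim: hat_edgeE)
  have C: "lab ` ?C = {Suc (nvert w v)..}"
  proof (intro equalityI subsetI)
    fix i assume i: "i \<in> {Suc (nvert w v)..}"
    then have "i \<notin> E_set w v" "1 \<le> i" using nvert_props(2)[OF v] by auto
    then have "(v, i, v) \<in> ?C" using v i by (simp add: hat_loops_def src_def lab_def)
    then show "i \<in> lab ` ?C" by (rule rev_image_eqI) (simp add: lab_def)
  qed auto
  have im: "q_map ` edge_param e ` S = circ_loop (lab e) ` S" for e S
    by (simp add: image_image q_map_edge_param)
  have UNlab: "(\<Union>e\<in>D. circ_loop (lab e) ` S) = (\<Union>i\<in>lab ` D. circ_loop i ` S)" for D S
    by blast
  have "q_map ` vertex_nbhd w v = (\<Union>i\<in>{1..}. circ_loop i ` {0..<3/8}) \<union> (\<Union>i\<in>{1..}. circ_loop i ` {5/8<..1})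
      \<union> (\<Union>i\<in>{Suc (nvert w v)..}. circ_loop i ` {0..1})"
    unfolding vertex_nbhd_def image_Un image_UN im UNlab A B C ..
  also have "\<dots> = H_nbhd (Suc (nvert w v))"
  proof (intro equalityI subsetI)
    fix p assume "p \<in> (\<Union>i\<in>{1..}. circ_loop i ` {0..<3/8}) \<union> (\<Union>i\<in>{1..}. circ_loop i ` {5/8<..1})
      \<union> (\<Union>i\<in>{Suc (nvert w v)..}. circ_loop i ` {0..1})"
    then have "\<exists>i t. 1 \<le> i \<and> p = circ_loop i t \<and>
      (t \<in> {0..<3/8} \<union> {5/8<..1} \<or> Suc (nvert w v) \<le> i)"
    proof (elim UnE UN_E imageE)
      fix i t assume "i \<in> {Suc (nvert w v)..}" "p = circ_loop i t"
      then have "1 \<le> i \<and> p = circ_loop i t \<and> Suc (nvert w v) \<le> i" by simp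
      then show ?thesis by blast
    qed blast+
    then obtain i t where i: "1 \<le> i" "p = circ_loop i t"
      "t \<in> {0..<3/8} \<union> {5/8<..1} \<or> Suc (nvert w v) \<le> i" by blast
    show "p \<in> H_nbhd (Suc (nvert w v))"
    proof (cases "Suc (nvert w v) \<le> i")
      case True
      then show ?thesis using i circ_loop_in_circ[OF i(1)] unfolding H_nbhd_def by blast
    next
      case False
      then have "i \<in> {1..<Suc (nvert w v)}" "t \<in> {0..<3/8} \<union> {5/8<..1}" using i by auto
      then show ?thesis using i(2) unfolding H_nbhd_def by blast
    qed
  next
    fix p assume "p \<in> H_nbhd (Suc (nvert w v))"
    then consider i where "1 \<le> i" "p \<in> circ_loop i ` {0..<3/8}" | i where "1 \<le> i" "p \<in> circ_loop i ` {5/8<..1}"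
      | i where "Suc (nvert w v) \<le> i" "p \<in> circ i"
      unfolding H_nbhd_def by (elim UnE UN_E) auto
    then show "p \<in> (\<Union>i\<in>{1..}. circ_loop i ` {0..<3/8}) \<union> (\<Union>i\<in>{1..}. circ_loop i ` {5/8<..1})
      \<union> (\<Union>i\<in>{Suc (nvert w v)..}. circ_loop i ` {0..1})"
    proof cases
      case 3
      then have "p \<in> circ_loop i ` {0..1}" using circ_eq_image[of i] by auto
      then show ?thesis using 3 by blast
    qed auto
  qed
  finally show ?thesis .
qed

lemma openin_q_map_edge:
  assumes e: "e \<in> hat_edges w" and J: "open {t. 0 < t \<and> t < 1 \<and> Inner e t \<in> U}"
  shows "openin (top_of_set hawaiian) (q_map ` (edge_nbhd e \<inter> U))"
proof -
  let ?J = "{1/4<..<3/4} \<inter> {t. 0 < t \<and> t < 1 \<and> Inner e t \<in> U}"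
  have "1 \<le> lab e" using e hat_edgeE by metis
  moreover have "open ?J" using J by (intro open_Int) auto
  ultimately have "openin (top_of_set hawaiian) (circ_loop (lab e) ` ?J)"
    by (rule openin_circ_loop_image) auto
  moreover have "edge_nbhd e \<inter> U = Inner e ` ?J"
  proof (intro equalityI subsetI)
    fix x assume "x \<in> edge_nbhd e \<inter> U"
    then show "x \<in> Inner e ` ?J" using Inner_edge_nbhd Vertex_edge_nbhd by (cases x) auto
  qed (auto simp: Inner_edge_nbhd)
  ultimately show ?thesis by (simp add: image_image)
qed

lemma open_chart_section:
  assumes e: "e \<in> hat_edges w" and U: "U \<in> charts"
  shows "open {t. 0 < t \<and> t < 1 \<and> Inner e t \<in> U}"
proof (cases "U \<in> vertex_nbhd w ` Gam_star w")
  case True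
  then obtain v where v: "v \<in> Gam_star w" and U: "U = vertex_nbhd w v" by blast
  have "{t. 0 < t \<and> t < 1 \<and> Inner e t \<in> U} = {t. 0 < t \<and> t < 1 \<and>
      (src e = v \<and> t < 3/8 \<or> tgt e = v \<and> 5/8 < t \<or> src e = v \<and> nvert w v < lab e)}"
    using e by (auto simp: U Inner_vertex_nbhd[OF v])
  moreover have "open \<dots>"
    by (intro open_Collect_conj open_Collect_disj open_Collect_less open_Collect_const continuous_intros)
  ultimately show ?thesis by simp
next
  case False
  then obtain e' where U: "U = edge_nbhd e'" using assms by (auto simp: charts_def)
  have "{t. 0 < t \<and> t < 1 \<and> Inner e t \<in> U} = {t. 0 < t \<and> t < 1 \<and> e = e' \<and> 1/4 < t \<and> t < 3/4}"
    by (auto simp: U Inner_edge_nbhd)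
  moreover have "open \<dots>"
    by (intro open_Collect_conj open_Collect_disj open_Collect_less open_Collect_const continuous_intros)
  ultimately show ?thesis by simp
qed

text \<open>An overlap with an edge neighborhood is an open set of parameters. Neighborhoods of
  different vertices are disjoint: a point of an edge belongs to that of the source only with
  parameter below 3/8, to that of the target only with parameter above 5/8, and entire edges are
  contained only if they are loops.\<close>

lemma openin_chart_overlap:
  assumes "U \<in> charts" "V \<in> charts"
  shows "openin (top_of_set hawaiian) (q_map ` (U \<inter> V))"
proof (cases "U \<in> edge_nbhd ` hat_edges w \<or> V \<in> edge_nbhd ` hat_edges w")
  case True
  then show ?thesis
  proof
    assume "U \<in> edge_nbhd ` hat_edges w"
    then show ?thesis using openin_q_map_edge open_chart_section assms(2) by auto
  next
    assume "V \<in> edge_nbhd ` hat_edges w"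
    then obtain e where e: "e \<in> hat_edges w" "V = edge_nbhd e" by blast
    then have "openin (top_of_set hawaiian) (q_map ` (V \<inter> U))"
      using openin_q_map_edge open_chart_section assms(1) by simp
    then show ?thesis by (simp add: Int_commute)
  qed
next
  case False
  then obtain u v where u: "u \<in> Gam_star w" "U = vertex_nbhd w u" and v: "v \<in> Gam_star w" "V = vertex_nbhd w v"
    using assms by (auto simp: charts_def)
  show ?thesis
  proof (cases "u = v")
    case True
    then show ?thesis using u v openin_H_nbhd by (simp add: q_map_vertex_nbhd)
  next
    case False
    have "x \<notin> V" if x: "x \<in> U" for x
    proof (cases x)
      case (Vertex a)
      then show ?thesis using x u v False by (simp add: Vertex_vertex_nbhd)
    next
      case (Inner e t)
      show ?thesis
      proof
        assume "x \<in> V"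
        then have V: "e \<in> hat_edges w"
          "src e = v \<and> t < 3/8 \<or> tgt e = v \<and> 5/8 < t \<or> src e = v \<and> nvert w v < lab e"
          using Inner v Inner_vertex_nbhd by simp_all
        have U: "src e = u \<and> t < 3/8 \<or> tgt e = u \<and> 5/8 < t \<or> src e = u \<and> nvert w u < lab e"
          using x Inner u Inner_vertex_nbhd by simp
        have "nvert w u < lab e \<and> src e = u \<Longrightarrow> tgt e = u" "nvert w v < lab e \<and> src e = v \<Longrightarrow> tgt e = v"
          using loop_at(2)[OF V(1) u(1)] loop_at(2)[OF V(1) v(1)] by blast+
        moreover have "\<not> (t < 3/8 \<and> 5/8 < t)" by simp
        ultimately show False using U V(2) False by metis
      qed
    qed
    then have "U \<inter> V = {}" by blast
    then show ?thesis by simp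
  qed
qed

lemma subset_hawaiian_chart: "U \<in> charts \<Longrightarrow> q_map ` U \<subseteq> hawaiian"
  using openin_subset[OF openin_chart_overlap[of U U]] by simp

text \<open>The sets \<open>H_arc\<close> and \<open>H_nbhd\<close> in the definition of
  \<open>hat_space\<close> are the images of the charts, so the definition is an instance of
  \<open>glued_topology_unique\<close>.\<close>

lemma hat_space_props:
  "topspace (hat_space w) = hat_points w"
  "U \<in> charts \<Longrightarrow> openin (hat_space w) U"
  "U \<in> charts \<Longrightarrow> continuous_map (subtopology (hat_space w) U) (top_of_set hawaiian) q_map"
proof -
  let ?P = "\<lambda>T. topspace T = hat_points w \<and>
     (\<forall>e\<in>hat_edges w. openin T (edge_nbhd e) \<and>
        homeomorphic_map (subtopology T (edge_nbhd e)) (top_of_set (H_arc (lab e))) q_map) \<and>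
     (\<forall>v\<in>Gam_star w. openin T (vertex_nbhd w v) \<and>
        homeomorphic_map (subtopology T (vertex_nbhd w v))
          (top_of_set (H_nbhd (Suc (nvert w v)))) q_map)"
  let ?Q = "\<lambda>T. topspace T = \<Union>charts \<and>
    (\<forall>U\<in>charts. openin T U \<and>
      homeomorphic_map (subtopology T U) (subtopology (top_of_set hawaiian) (q_map ` U)) q_map)"
  have sub: "subtopology (top_of_set hawaiian) (q_map ` U) = top_of_set (q_map ` U)" if "U \<in> charts" for U
    using subset_hawaiian_chart[OF that] by (simp add: subtopology_subtopology Int_absorb1)
  have PQ: "?P T \<longleftrightarrow> ?Q T" for T
  proof -
    have "(\<forall>U\<in>charts. openin T U \<and>
        homeomorphic_map (subtopology T U) (subtopology (top_of_set hawaiian) (q_map ` U)) q_map) \<longleftrightarrow>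
      (\<forall>U\<in>charts. openin T U \<and> homeomorphic_map (subtopology T U) (top_of_set (q_map ` U)) q_map)"
      using sub by simp
    also have "\<dots> \<longleftrightarrow> (\<forall>e\<in>hat_edges w. openin T (edge_nbhd e) \<and>
        homeomorphic_map (subtopology T (edge_nbhd e)) (top_of_set (H_arc (lab e))) q_map) \<and>
     (\<forall>v\<in>Gam_star w. openin T (vertex_nbhd w v) \<and>
        homeomorphic_map (subtopology T (vertex_nbhd w v))
          (top_of_set (H_nbhd (Suc (nvert w v)))) q_map)"
      unfolding charts_def ball_Un ball_simps q_map_edge_nbhd
      by (simp add: q_map_vertex_nbhd cong: ball_cong)
    finally show ?thesis unfolding Union_charts by blast
  qed
  have "\<exists>!T. ?Q T"
    by (rule glued_topology_unique) (use inj_on_chart openin_chart_overlap in auto)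
  then have "\<exists>!T. ?P T" unfolding PQ .
  then have "?P (hat_space w)" unfolding hat_space_def by (rule theI')
  then have Q: "?Q (hat_space w)" unfolding PQ .
  then show "topspace (hat_space w) = hat_points w" using Union_charts by simp
  show "openin (hat_space w) U" if "U \<in> charts" using Q that by blast
  show "continuous_map (subtopology (hat_space w) U) (top_of_set hawaiian) q_map" if "U \<in> charts"
  proof -
    have "continuous_map (subtopology (hat_space w) U) (subtopology (top_of_set hawaiian) (q_map ` U)) q_map"
      using Q that homeomorphic_imp_continuous_map by blast
    then show ?thesis using continuous_map_into_fulltopology by blast
  qed
qed

lemma continuous_map_q_map: "continuous_map (hat_space w) (top_of_set hawaiian) q_map"
  unfolding continuous_map_openin_preimage_eq
proof (intro conjI allI impI)
  show "q_map \<in> topspace (hat_space w) \<rightarrow> topspace (top_of_set hawaiian)"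
    using subset_hawaiian_chart unfolding hat_space_props(1) Union_charts[symmetric] by fastforce
  fix V assume V: "openin (top_of_set hawaiian) V"
  have "openin (hat_space w) (U \<inter> q_map -` V)" if U: "U \<in> charts" for U
  proof -
    have "openin (subtopology (hat_space w) U) (topspace (subtopology (hat_space w) U) \<inter> q_map -` V)"
      using hat_space_props(3)[OF U] V unfolding continuous_map_openin_preimage_eq by blast
    moreover have "topspace (subtopology (hat_space w) U) = U"
      using openin_subset[OF hat_space_props(2)[OF U]] by auto
    ultimately show ?thesis using openin_trans_full hat_space_props(2)[OF U] by fastforce
  qed
  then have "openin (hat_space w) (\<Union>U\<in>charts. U \<inter> q_map -` V)" by blast
  moreover have "(\<Union>U\<in>charts. U \<inter> q_map -` V) = topspace (hat_space w) \<inter> q_map -` V"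
    unfolding hat_space_props(1) Union_charts[symmetric] by blast
  ultimately show "openin (hat_space w) (topspace (hat_space w) \<inter> q_map -` V)" by simp
qed

end

section \<open>Covering spaces with tree coordinates\<close>

definition fword :: "nat \<Rightarrow> word set" where
  "fword m = {u. is_reduced u \<and> (\<forall>l\<in>set u. fst l \<in> {1..m})}"

lemma fword_snoc:
  "u @ [l] \<in> fword m \<longleftrightarrow> u \<in> fword m \<and> fst l \<in> {1..m} \<and> (u = [] \<or> last u \<noteq> inv_letter l)"
  by (auto simp: fword_def is_reduced_snoc)

lemma fword_prefix: "u \<in> fword m \<Longrightarrow> prefix v u \<Longrightarrow> v \<in> fword m"
  by (auto simp: fword_def is_reduced_prefix dest: set_mono_prefix)

lemma Nil_fword [simp]: "[] \<in> fword m"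
  by (simp add: fword_def)

text \<open>A nonempty reduced word \<open>v\<close> stands for the edge of the tree that ends at \<open>v\<close> and leads away from
  the root. A point of the tree is encoded by the function that maps each edge to the portion of it
  that lies on the geodesic from the root to the point.\<close>

definition vertex_vec :: "word \<Rightarrow> word \<Rightarrow>\<^sub>0 real" where
  "vertex_vec u = (\<Sum>v\<in>{v. v \<noteq> [] \<and> prefix v u}. Poly_Mapping.single v 1)"

lemma finite_prefixes: "finite {v. v \<noteq> [] \<and> prefix v u}"
  by (rule finite_subset[of _ "set (prefixes u)"]) auto

lemma lookup_vertex_vec: "Poly_Mapping.lookup (vertex_vec u) v = (if v \<noteq> [] \<and> prefix v u then 1 else 0)"
proof -
  have "Poly_Mapping.lookup (vertex_vec u) v = (\<Sum>z\<in>{v. v \<noteq> [] \<and> prefix v u}. if z = v then 1 else 0)"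
    by (simp add: vertex_vec_def lookup_sum lookup_single when_def)
  also have "\<dots> = (if v \<in> {v. v \<noteq> [] \<and> prefix v u} then 1 else 0)"
    by (rule sum.delta[OF finite_prefixes])
  finally show ?thesis by simp
qed

lemma vertex_vec_inj: "vertex_vec u = vertex_vec v \<Longrightarrow> u = v"
proof -
  assume e: "vertex_vec u = vertex_vec v"
  have "prefix a b" if "vertex_vec a = vertex_vec b" for a b
    using lookup_vertex_vec[of a a] lookup_vertex_vec[of b a] that by (cases "a = []") (auto split: if_splits)
  then show "u = v" using e prefix_order.antisym by metis
qed

lemma vertex_vec_snoc: "vertex_vec (u @ [l]) = vertex_vec u + Poly_Mapping.single (u @ [l]) 1"
  by (rule poly_mapping_eqI) (auto simp: lookup_vertex_vec lookup_add lookup_single when_def)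

lemma lookup_le_norm: "\<bar>Poly_Mapping.lookup x v\<bar> \<le> norm (x :: word \<Rightarrow>\<^sub>0 real)"
proof -
  have n: "norm x = (\<Sum>n\<in>Poly_Mapping.keys x. \<bar>Poly_Mapping.lookup x n\<bar>)"
    by (simp add: norm_poly_mapping_def dist_poly_mapping_def dist_norm)
  show ?thesis
  proof (cases "v \<in> Poly_Mapping.keys x")
    case True
    then show ?thesis unfolding n by (intro member_le_sum) auto
  next
    case False
    then show ?thesis unfolding n by (simp add: in_keys_iff sum_nonneg)
  qed
qed

lemma bounded_linear_lookup: "bounded_linear (\<lambda>x :: word \<Rightarrow>\<^sub>0 real. Poly_Mapping.lookup x v)"
  by (rule bounded_linear_intro[of _ 1])
    (auto simp: lookup_add scaleR_poly_mapping_def lookup_le_norm)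

lemmas continuous_on_lookup [continuous_intros] = bounded_linear.continuous_on[OF bounded_linear_lookup]

lemma single_eq_scaleR: "Poly_Mapping.single v s = s *\<^sub>R (Poly_Mapping.single v 1 :: word \<Rightarrow>\<^sub>0 real)"
  by (rule poly_mapping_eqI) (simp add: scaleR_poly_mapping_def lookup_single when_def)

definition letter_loop :: "letter \<Rightarrow> real \<Rightarrow> real \<times> real" where
  "letter_loop l s = circ_loop (fst l) (if snd l then s else 1 - s)"

text \<open>The points of the loops with labels above \<open>m\<close> at a vertex are only told apart by their image in the
  Hawaiian earring, hence the first component.\<close>

definition tree_cover :: "nat \<Rightarrow> ((real \<times> real) \<times> (word \<Rightarrow>\<^sub>0 real)) set" where
  "tree_cover m = {(p, x). (\<exists>u i. u \<in> fword m \<and> m < i \<and> p \<in> circ i \<and> x = vertex_vec u) \<or>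
     (\<exists>u l s. u @ [l] \<in> fword m \<and> 0 \<le> s \<and> s \<le> 1 \<and> p = letter_loop l s \<and>
        x = vertex_vec u + Poly_Mapping.single (u @ [l]) s)}"

lemma tree_coverI:
  "u @ [l] \<in> fword m \<Longrightarrow> 0 \<le> s \<Longrightarrow> s \<le> 1 \<Longrightarrow>
    (letter_loop l s, vertex_vec u + Poly_Mapping.single (u @ [l]) s) \<in> tree_cover m"
  unfolding tree_cover_def by blast

lemma letter_loop_inv: "letter_loop (inv_letter l) s = letter_loop l (1 - s)"
  by (simp add: letter_loop_def inv_letter_def)

lemma letter_loop_0 [simp]: "letter_loop l 0 = (0, 0)" "letter_loop l 1 = (0, 0)"
  by (simp_all add: letter_loop_def)

lemma letter_loop_eqD:
  assumes "1 \<le> fst k" "1 \<le> fst l" "0 < s" "s < 1" "0 \<le> t" "t \<le> 1" "letter_loop k s = letter_loop l t"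
  shows "k = l \<and> s = t \<or> k = inv_letter l \<and> s = 1 - t"
proof -
  let ?s = "if snd k then s else 1 - s" and ?t = "if snd l then t else 1 - t"
  have "fst k = fst l" "?s = ?t"
    using circ_loop_eqD[of "fst k" "fst l" ?s ?t] assms by (auto simp: letter_loop_def)
  then show ?thesis by (cases k; cases l) (auto split: if_splits)
qed

lemma continuous_on_letter_loop: "continuous_on S (letter_loop l)"
  unfolding letter_loop_def by (cases "snd l") (auto intro!: continuous_on_compose2[OF continuous_on_circ_loop[of UNIV]] continuous_intros)

lemma inj_on_letter_loop: "1 \<le> fst l \<Longrightarrow> inj_on (letter_loop l) {0..3/4}"
proof (rule inj_onI)
  fix s t assume l: "1 \<le> fst l" and st: "s \<in> {0..3/4}" "t \<in> {0..3/4}" "letter_loop l s = letter_loop l t"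
  have ne: "l \<noteq> inv_letter l" by (cases l) simp
  show "s = t"
  proof (cases "s = 0")
    case True
    then show ?thesis using st letter_loop_eqD[OF l l, of t s] ne by (cases "t = 0") auto
  next
    case False
    then show ?thesis using st letter_loop_eqD[OF l l, of s t] ne by auto
  qed
qed

text \<open>The interval \<open>{0..3/4}\<close> contains the parameters of the middle arc
  \<open>H_arc\<close> and those of the half edge \<open>{0..3/8}\<close>, while
  \<open>letter_loop l\<close> is still injective on it.\<close>

definition arc_coord :: "letter \<Rightarrow> real \<times> real \<Rightarrow> real" where
  "arc_coord l p = (if p \<in> letter_loop l ` {0..3/4} then inv_into {0..3/4} (letter_loop l) p else 0)"

lemma arc_coord_letter_loop:
  "1 \<le> fst l \<Longrightarrow> 0 \<le> s \<Longrightarrow> s \<le> 3/4 \<Longrightarrow> arc_coord l (letter_loop l s) = s"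
  using inv_into_f_f[OF inj_on_letter_loop, of l s] by (auto simp: arc_coord_def)

lemma continuous_on_arc_coord_image:
  assumes l: "1 \<le> fst l"
  shows "continuous_on (letter_loop l ` {0..3/4}) (arc_coord l)"
proof -
  have "continuous_on (letter_loop l ` {0..3/4}) (inv_into {0..3/4} (letter_loop l))"
    by (rule continuous_on_inv[OF continuous_on_letter_loop compact_Icc])
      (simp add: inv_into_f_f[OF inj_on_letter_loop[OF l]])
  then show ?thesis by (rule continuous_on_eq) (auto simp: arc_coord_def)
qed

text \<open>The coordinate along the branch \<open>l\<close> of the star that \<open>H_nbhd\<close>
  forms around the origin, zero on all other branches.\<close>

definition star_coord :: "letter \<Rightarrow> real \<times> real \<Rightarrow> real" where
  "star_coord l p = (if p \<in> letter_loop l ` {0..3/8} then arc_coord l p else 0)"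

lemma openin_letter_loop_image:
  assumes "1 \<le> fst l" "0 \<le> a" "b \<le> 1"
  shows "openin (top_of_set hawaiian) (letter_loop l ` {a<..<b})"
proof (cases "snd l")
  case True
  have "{a<..<b} \<subseteq> {0<..<1}" using assms by auto
  then show ?thesis
    using True openin_circ_loop_image[of "fst l" "{a<..<b}"] assms by (simp add: letter_loop_def)
next
  case False
  have "(\<lambda>s. 1 - s) ` {a<..<b} = {1 - b<..<1 - a}"
  proof (intro equalityI subsetI)
    fix x assume "x \<in> {1 - b<..<1 - a}"
    then have "x = 1 - (1 - x)" "1 - x \<in> {a<..<b}" by auto
    then show "x \<in> (\<lambda>s. 1 - s) ` {a<..<b}" by (rule image_eqI)
  qed auto
  then have "letter_loop l ` {a<..<b} = circ_loop (fst l) ` {1 - b<..<1 - a}"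
    using False by (simp add: letter_loop_def image_image flip: \<open>(\<lambda>s. 1 - s) ` {a<..<b} = {1 - b<..<1 - a}\<close>)
  moreover have "{1 - b<..<1 - a} \<subseteq> {0<..<1}" using assms by auto
  ultimately show ?thesis
    using openin_circ_loop_image[of "fst l" "{1 - b<..<1 - a}"] assms by simp
qed

lemma H_nbhd_letter_loop:
  assumes "fst l \<in> {1..m}" "0 \<le> s" "s \<le> 1"
  shows "letter_loop l s \<in> H_nbhd (Suc m) \<longleftrightarrow> s < 3/8 \<or> 5/8 < s"
proof -
  let ?t = "if snd l then s else 1 - s"
  have i: "1 \<le> fst l" using assms by simp
  have "letter_loop l s \<in> (\<Union>i\<in>{1..<Suc m}. circ_loop i ` {3/8..5/8}) \<longleftrightarrow> ?t \<in> {3/8..5/8}"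
  proof
    assume "letter_loop l s \<in> (\<Union>i\<in>{1..<Suc m}. circ_loop i ` {3/8..5/8})"
    then obtain j t where j: "1 \<le> j" "t \<in> {3/8..5/8}" "circ_loop (fst l) ?t = circ_loop j t"
      by (auto simp: letter_loop_def)
    then have "t = ?t" using circ_loop_eqD(2)[of j "fst l" t ?t] assms by auto
    then show "?t \<in> {3/8..5/8}" using j by simp
  next
    assume "?t \<in> {3/8..5/8}"
    then have "letter_loop l s \<in> circ_loop (fst l) ` {3/8..5/8}" unfolding letter_loop_def by (rule imageI)
    moreover have "fst l \<in> {1..<Suc m}" using assms by simp
    ultimately show "letter_loop l s \<in> (\<Union>i\<in>{1..<Suc m}. circ_loop i ` {3/8..5/8})" by blast
  qed
  moreover have "letter_loop l s \<in> hawaiian" unfolding letter_loop_def by (rule circ_loop_hawaiian[OF i])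
  ultimately have "letter_loop l s \<in> H_nbhd (Suc m) \<longleftrightarrow> ?t \<notin> {3/8..5/8}" unfolding H_nbhd_eq by blast
  also have "\<dots> \<longleftrightarrow> s < 3/8 \<or> 5/8 < s" by auto
  finally show ?thesis .
qed

lemma continuous_on_star_coord:
  assumes l: "fst l \<in> {1..m}"
  shows "continuous_on (H_nbhd (Suc m)) (star_coord l)"
proof -
  let ?A = "H_nbhd (Suc m)" and ?P = "letter_loop l ` {0..3/8}" and ?Q = "letter_loop l ` {0<..<3/8}"
  have l1: "1 \<le> fst l" using l by simp
  have AH: "?A \<subseteq> hawaiian" by (auto simp: H_nbhd_eq)
  have "openin (top_of_set ?A) (?A \<inter> ?Q)"
    using openin_letter_loop_image[OF l1, of 0 "3/8"] AH by (auto simp: openin_open)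
  moreover have "?A - (?A - ?Q) = ?A \<inter> ?Q" by blast
  ultimately have c1: "closedin (top_of_set ?A) (?A - ?Q)" by (simp add: closedin_def)
  have c2: "closedin (top_of_set ?A) (?A \<inter> ?P)"
    by (intro closedin_closed_Int compact_imp_closed compact_continuous_image continuous_on_letter_loop compact_Icc)
  have un: "?A = (?A \<inter> ?P) \<union> (?A - ?Q)" by auto
  have "continuous_on ((?A \<inter> ?P) \<union> (?A - ?Q)) (\<lambda>p. if p \<in> ?P then arc_coord l p else 0)"
  proof (rule continuous_on_cases_local)
    show "closedin (top_of_set (?A \<inter> ?P \<union> (?A - ?Q))) (?A \<inter> ?P)" using c2 un by metis
    show "closedin (top_of_set (?A \<inter> ?P \<union> (?A - ?Q))) (?A - ?Q)" using c1 un by metis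
    show "continuous_on (?A \<inter> ?P) (arc_coord l)"
      by (rule continuous_on_subset[OF continuous_on_arc_coord_image[OF l1]]) auto
    show "continuous_on (?A - ?Q) (\<lambda>p. 0 :: real)" by simp
    \<comment> \<open>The end point with parameter 3/8 is missing from
      \<open>H_nbhd (Suc m)\<close>, so the two closed pieces meet only in the origin, where the
      coordinate vanishes.\<close>
    show "arc_coord l p = 0" if p: "p \<in> ?A \<inter> ?P \<and> p \<notin> ?P \<or> p \<in> ?A - ?Q \<and> p \<in> ?P" for p
    proof -
      have p: "p \<in> ?A" "p \<in> ?P" "p \<notin> ?Q" using p by auto
      obtain s where s: "s \<in> {0..3/8}" "p = letter_loop l s" using p(2) by blast
      have "s \<noteq> 3/8" using H_nbhd_letter_loop[OF l, of s] s p by auto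
      then have "s = 0" using s p by auto
      then show ?thesis using arc_coord_letter_loop[OF l1, of s] s by simp
    qed
  qed
  then show ?thesis unfolding star_coord_def using un by simp
qed

lemma star_coord_0: "1 \<le> fst l \<Longrightarrow> star_coord l (0, 0) = 0"
  using arc_coord_letter_loop[of l 0] by (simp add: star_coord_def)

lemma star_coord_letter_loop:
  assumes "1 \<le> fst k" "1 \<le> fst l" "0 < s" "s < 3/8"
  shows "star_coord l (letter_loop k s) = (if l = k then s else 0)"
proof (cases "l = k")
  case True
  then show ?thesis using arc_coord_letter_loop[of l s] assms by (auto simp: star_coord_def)
next
  case False
  have "letter_loop k s \<noteq> letter_loop l t" if "t \<in> {0..3/8}" for t
    using letter_loop_eqD[OF assms(1,2), of s t] that assms False by auto
  then have "letter_loop k s \<notin> letter_loop l ` {0..3/8}" by blast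
  then show ?thesis using False by (simp add: star_coord_def)
qed

lemma star_coord_high:
  assumes "1 \<le> fst l" "fst l < i" "p \<in> circ i"
  shows "star_coord l p = 0"
proof (cases "p = (0, 0)")
  case True
  then show ?thesis using star_coord_0 assms by simp
next
  case False
  have i: "1 \<le> i" using assms by simp
  have "p \<noteq> letter_loop l t" for t
    using inv_radius_circ[OF i assms(3) False] inv_radius_circ[OF assms(1) circ_loop_in_circ[OF assms(1)]] False assms(2)
    unfolding letter_loop_def by (metis of_nat_eq_iff less_irrefl)
  then show ?thesis by (auto simp: star_coord_def)
qed

section \<open>Sheets of the tree cover around its vertices\<close>

definition letters_upto :: "nat \<Rightarrow> letter set" where
  "letters_upto m = {1..m} \<times> UNIV"

lemma letters_upto_iff: "l \<in> letters_upto m \<longleftrightarrow> fst l \<in> {1..m}"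
  by (cases l) (simp add: letters_upto_def)

lemma finite_letters_upto [simp]: "finite (letters_upto m)"
  by (simp add: letters_upto_def)

text \<open>The direction of the half edge \<open>l\<close> at the vertex \<open>u\<close>: away
  from the root the coordinate of the edge \<open>u @ [l]\<close> grows, towards the root the
  coordinate of \<open>u\<close> shrinks.\<close>

definition star_dir :: "word \<Rightarrow> letter \<Rightarrow> word \<Rightarrow>\<^sub>0 real" where
  "star_dir u l = (if u \<noteq> [] \<and> last u = inv_letter l then - Poly_Mapping.single u 1
     else Poly_Mapping.single (u @ [l]) 1)"

text \<open>The tree coordinates of the lift of \<open>p\<close> near the vertex \<open>u\<close>.
  For \<open>p\<close> in \<open>H_nbhd (Suc m)\<close> at most one summand is nonzero, and there is
  none for a circle with index above \<open>m\<close>, which lifts to a loop at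
  \<open>u\<close>.\<close>

definition star_section :: "nat \<Rightarrow> word \<Rightarrow> real \<times> real \<Rightarrow> word \<Rightarrow>\<^sub>0 real" where
  "star_section m u p = vertex_vec u + (\<Sum>l\<in>letters_upto m. star_coord l p *\<^sub>R star_dir u l)"

lemma continuous_on_star_section: "continuous_on (H_nbhd (Suc m)) (star_section m u)"
  unfolding star_section_def
  by (intro continuous_intros continuous_on_star_coord) (simp add: letters_upto_iff)

lemma star_section_high:
  assumes "m < i" "p \<in> circ i"
  shows "star_section m u p = vertex_vec u"
proof -
  have "star_coord l p = 0" if "l \<in> letters_upto m" for l
    using star_coord_high[of l i p] assms that by (simp add: letters_upto_iff)
  then show ?thesis by (simp add: star_section_def)
qed

lemma star_section_0: "star_section m u (0, 0) = vertex_vec u"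
  using star_section_high[of m "Suc m" "(0, 0)" u] circ_loop_in_circ[of "Suc m" 0] by simp

lemma star_section_letter_loop:
  assumes k: "k \<in> letters_upto m" and s: "0 \<le> s" "s < 3/8"
  shows "star_section m u (letter_loop k s) = vertex_vec u + s *\<^sub>R star_dir u k"
proof (cases "s = 0")
  case True
  then show ?thesis using star_section_0 by simp
next
  case False
  have "(\<Sum>l\<in>letters_upto m. star_coord l (letter_loop k s) *\<^sub>R star_dir u l)
      = (\<Sum>l\<in>letters_upto m. if l = k then s *\<^sub>R star_dir u k else 0)"
    using assms False by (intro sum.cong refl) (auto simp: letters_upto_iff star_coord_letter_loop)
  then show ?thesis using k by (simp add: star_section_def sum.delta)
qed

lemma star_section_forward:
  assumes "u @ [l] \<in> fword m" "0 \<le> s" "s < 3/8"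
  shows "star_section m u (letter_loop l s) = vertex_vec u + Poly_Mapping.single (u @ [l]) s"
proof -
  have "l \<in> letters_upto m" "\<not> (u \<noteq> [] \<and> last u = inv_letter l)"
    using assms(1) fword_snoc by (auto simp: letters_upto_iff)
  moreover from this(2) have "star_dir u l = Poly_Mapping.single (u @ [l]) 1"
    unfolding star_dir_def by (rule if_not_P)
  ultimately show ?thesis
    using star_section_letter_loop[of l m s u] assms(2,3) single_eq_scaleR[of "u @ [l]" s] by simp
qed

lemma star_section_backward:
  assumes "u @ [l] \<in> fword m" "5/8 < s" "s \<le> 1"
  shows "star_section m (u @ [l]) (letter_loop l s) = vertex_vec u + Poly_Mapping.single (u @ [l]) s"
proof -
  have "inv_letter l \<in> letters_upto m"
    using assms(1) fword_snoc by (auto simp: letters_upto_iff inv_letter_def)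
  then have "star_section m (u @ [l]) (letter_loop (inv_letter l) (1 - s))
      = vertex_vec (u @ [l]) + (1 - s) *\<^sub>R star_dir (u @ [l]) (inv_letter l)"
    using assms(2,3) by (intro star_section_letter_loop) auto
  moreover have "star_dir (u @ [l]) (inv_letter l) = - Poly_Mapping.single (u @ [l]) 1"
    by (simp add: star_dir_def)
  moreover have "Poly_Mapping.single (u @ [l]) 1 - (1 - s) *\<^sub>R Poly_Mapping.single (u @ [l]) 1
      = (Poly_Mapping.single (u @ [l]) s :: word \<Rightarrow>\<^sub>0 real)"
    by (simp add: single_eq_scaleR[of "u @ [l]" s] scaleR_left_diff_distrib)
  ultimately show ?thesis
    by (simp add: letter_loop_inv vertex_vec_snoc add_diff_eq[symmetric])
qed

lemma tree_cover_cases: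
  assumes "(p, x) \<in> tree_cover m"
  obtains u i where "u \<in> fword m" "m < i" "p \<in> circ i" "x = vertex_vec u"
  | u l s where "u @ [l] \<in> fword m" "0 \<le> s" "s \<le> 1" "p = letter_loop l s"
      "x = vertex_vec u + Poly_Mapping.single (u @ [l]) s"
  using assms unfolding tree_cover_def by blast

lemma tree_cover_hawaiian:
  assumes "(p, x) \<in> tree_cover m"
  shows "p \<in> hawaiian"
  using assms
proof (cases rule: tree_cover_cases)
  case (1 u i)
  then have "i \<in> {1..}" by simp
  then show ?thesis using 1(3) unfolding hawaiian_def by blast
next
  case (2 u l s)
  then have "1 \<le> fst l" using fword_snoc by simp
  then show ?thesis using 2(4) circ_loop_hawaiian by (simp add: letter_loop_def)
qed

lemma lookup_edge_point:
  "Poly_Mapping.lookup (vertex_vec u + Poly_Mapping.single (u @ [l]) s) v =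
    (if v = u @ [l] then s else if v \<noteq> [] \<and> prefix v u then 1 else 0)"
  by (auto simp: lookup_add lookup_vertex_vec lookup_single when_def)

lemma H_nbhd_cases:
  assumes "p \<in> H_nbhd (Suc m)"
  obtains i where "m < i" "p \<in> circ i"
  | l s where "l \<in> letters_upto m" "0 < s" "s < 3/8" "p = letter_loop l s"
proof -
  have pH: "p \<in> hawaiian" using assms by (simp add: H_nbhd_eq)
  show ?thesis
  proof (rule hawaiian_cases[OF pH])
    assume "p = (0, 0)"
    then have "p \<in> circ (Suc m)" using circ_loop_in_circ[of "Suc m" 0] by simp
    then show ?thesis using that(1)[of "Suc m"] by simp
  next
    fix i t assume i: "1 \<le> i" "0 < t" "t < 1" "p = circ_loop i t"
    show ?thesis
    proof (cases "m < i")
      case True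
      then show ?thesis using that(1) circ_loop_in_circ[OF i(1)] i(4) by blast
    next
      case False
      then have im: "fst (i, True) \<in> {1..m}" using i by simp
      have p: "p = letter_loop (i, True) t" "p = letter_loop (i, False) (1 - t)"
        using i(4) by (simp_all add: letter_loop_def)
      have "t < 3/8 \<or> 5/8 < t"
        using H_nbhd_letter_loop[OF im, of t] assms i(2,3) unfolding p(1) by simp
      then show ?thesis
        using that(2)[of "(i, True)" t] that(2)[of "(i, False)" "1 - t"] im i p
        by (auto simp: letters_upto_iff)
    qed
  qed
qed

text \<open>In the star all coordinates are less than 3/8 away from those of the vertex
  \<open>u\<close>, which are 0 or 1. So comparison with the threshold 1/2 recovers
  \<open>u\<close>.\<close>

lemma star_section_in_cover:
  assumes u: "u \<in> fword m" and p: "p \<in> H_nbhd (Suc m)"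
  shows "(p, star_section m u p) \<in> tree_cover m"
    and "1/2 < Poly_Mapping.lookup (star_section m u p) v \<longleftrightarrow> v \<noteq> [] \<and> prefix v u"
    and "Poly_Mapping.lookup (star_section m u p) v < 1/2 \<longleftrightarrow> \<not> (v \<noteq> [] \<and> prefix v u)"
proof -
  have "(p, star_section m u p) \<in> tree_cover m \<and>
     (1/2 < Poly_Mapping.lookup (star_section m u p) v \<longleftrightarrow> v \<noteq> [] \<and> prefix v u) \<and>
     (Poly_Mapping.lookup (star_section m u p) v < 1/2 \<longleftrightarrow> \<not> (v \<noteq> [] \<and> prefix v u))"
  proof (rule H_nbhd_cases[OF p])
    fix i assume "m < i" "p \<in> circ i"
    then show ?thesis using star_section_high[of m i p u] u
      by (auto simp: tree_cover_def lookup_vertex_vec)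
  next
    fix l s assume l: "l \<in> letters_upto m" "0 < s" "s < 3/8" "p = letter_loop l s"
    show ?thesis
    proof (cases "u \<noteq> [] \<and> last u = inv_letter l")
      case True
      define u' where "u' = butlast u"
      have uu: "u = u' @ [inv_letter l]" using True by (metis append_butlast_last_id u'_def)
      have pl: "p = letter_loop (inv_letter l) (1 - s)" using l(4) by (simp add: letter_loop_inv)
      have x: "star_section m u p = vertex_vec u' + Poly_Mapping.single u (1 - s)"
        unfolding pl uu using l u uu by (intro star_section_backward) auto
      have "(p, star_section m u p) \<in> tree_cover m"
        unfolding x unfolding pl uu using u uu l by (intro tree_coverI) auto
      moreover have "\<not> prefix (u' @ [inv_letter l]) u'" using prefix_length_le by fastforce
      ultimately show ?thesis
        unfolding x unfolding uu lookup_edge_point using l by (auto simp: prefix_snoc)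
    next
      case False
      then have ul: "u @ [l] \<in> fword m" using u l(1) by (auto simp: fword_snoc letters_upto_iff)
      have x: "star_section m u p = vertex_vec u + Poly_Mapping.single (u @ [l]) s"
        unfolding l(4) using ul l by (intro star_section_forward) auto
      have "(p, star_section m u p) \<in> tree_cover m"
        unfolding x unfolding l(4) using ul l by (intro tree_coverI) auto
      moreover have "\<not> prefix (u @ [l]) u" using prefix_length_le by fastforce
      ultimately show ?thesis
        unfolding x lookup_edge_point using l by auto
    qed
  qed
  then show "(p, star_section m u p) \<in> tree_cover m"
    "1/2 < Poly_Mapping.lookup (star_section m u p) v \<longleftrightarrow> v \<noteq> [] \<and> prefix v u"
    "Poly_Mapping.lookup (star_section m u p) v < 1/2 \<longleftrightarrow> \<not> (v \<noteq> [] \<and> prefix v u)" by auto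
qed

lemma tree_cover_star:
  assumes E: "(p, x) \<in> tree_cover m" and p: "p \<in> H_nbhd (Suc m)"
  obtains u where "u \<in> fword m" "x = star_section m u p"
  using E
proof (cases rule: tree_cover_cases)
  case (1 u i)
  then show ?thesis using that star_section_high by metis
next
  case (2 u l s)
  have l: "fst l \<in> {1..m}" using 2(1) fword_snoc by simp
  then have "s < 3/8 \<or> 5/8 < s" using H_nbhd_letter_loop[OF l 2(2,3)] p 2(4) by simp
  then show ?thesis
  proof
    assume "s < 3/8"
    then have "x = star_section m u p" using star_section_forward[OF 2(1,2)] 2 by simp
    moreover have "u \<in> fword m" using 2(1) fword_snoc by simp
    ultimately show ?thesis using that by blast
  next
    assume "5/8 < s"
    then have "x = star_section m (u @ [l]) p" using star_section_backward[OF 2(1) _ 2(3)] 2 by simp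
    then show ?thesis using that 2(1) by blast
  qed
qed

text \<open>A coordinate strictly between 0 and 1 places the point inside one edge and thereby fixes
  the image in the earring and all other coordinates.\<close>

lemma tree_cover_fraction:
  assumes E: "(p, x) \<in> tree_cover m" and v: "0 < Poly_Mapping.lookup x v" "Poly_Mapping.lookup x v < 1"
  obtains u l where "v = u @ [l]" "v \<in> fword m" "p = letter_loop l (Poly_Mapping.lookup x v)"
    "x = vertex_vec u + Poly_Mapping.single v (Poly_Mapping.lookup x v)"
  using E
proof (cases rule: tree_cover_cases)
  case (1 u i)
  then show ?thesis using v by (auto simp: lookup_vertex_vec split: if_splits)
next
  case (2 u l s)
  then have "v = u @ [l]" using v by (auto simp: lookup_edge_point split: if_splits)
  moreover from this have "Poly_Mapping.lookup x v = s" using 2(5) lookup_edge_point by simp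
  ultimately show ?thesis using that 2 by simp
qed

lemma tree_cover_arc:
  assumes E: "(p, x) \<in> tree_cover m" and p: "p = circ_loop i t" "1 \<le> i" "i \<le> m" "0 < t" "t < 1"
  obtains u b where "u @ [(i, b)] \<in> fword m"
    "x = vertex_vec u + Poly_Mapping.single (u @ [(i, b)]) (if b then t else 1 - t)"
  using E
proof (cases rule: tree_cover_cases)
  case (1 u k)
  then have "p \<noteq> (0, 0)" using p circ_loop_eq_0 by simp
  then have "real k = real i"
    using inv_radius_circ[of k p] inv_radius_circ[OF p(2), of p] circ_loop_in_circ[OF p(2), of t] 1 p by simp
  then show ?thesis using 1 p by simp
next
  case (2 u l s)
  have l: "1 \<le> fst l" using 2(1) fword_snoc by simp
  let ?s = "if snd l then s else 1 - s"
  have "i = fst l" "t = ?s"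
    using circ_loop_eqD[OF p(2) l p(4,5), of ?s] 2 p(1) by (auto simp: letter_loop_def)
  then have "l = (i, snd l)" "s = (if snd l then t else 1 - t)" by (auto simp: prod_eq_iff)
  then show ?thesis using that[of u "snd l"] 2 by simp
qed

lemma openin_tree_cover_preimage:
  assumes "openin (top_of_set hawaiian) T"
  shows "openin (top_of_set (tree_cover m)) (tree_cover m \<inter> fst -` T)"
proof (rule continuous_openin_preimage[OF _ _ assms])
  show "continuous_on (tree_cover m) fst" by (intro continuous_intros)
  show "fst \<in> tree_cover m \<rightarrow> hawaiian" using tree_cover_hawaiian by auto
qed

text \<open>The sheet of \<open>u\<close> is cut out by the coordinate of \<open>u\<close> being
  above 1/2 and those of its continuations being below. These are finitely many open conditions
  because only \<open>m\<close> generators can extend a word.\<close>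

lemma openin_star_sheet:
  assumes u: "u \<in> fword m"
  shows "openin (top_of_set (tree_cover m)) ((\<lambda>p. (p, star_section m u p)) ` H_nbhd (Suc m))"
proof -
  let ?T = "H_nbhd (Suc m)"
  let ?S = "\<lambda>u. (\<lambda>p. (p, star_section m u p)) ` ?T"
  let ?D = "\<lambda>u. {x :: word \<Rightarrow>\<^sub>0 real. (u = [] \<or> 1/2 < Poly_Mapping.lookup x u) \<and>
      (\<forall>l\<in>letters_upto m. Poly_Mapping.lookup x (u @ [l]) < 1/2)}"
  have "open (?D u)" for u
  proof -
    have "?D u = {x :: word \<Rightarrow>\<^sub>0 real. u = [] \<or> 1/2 < Poly_Mapping.lookup x u} \<inter>
        (\<Inter>l\<in>letters_upto m. {x :: word \<Rightarrow>\<^sub>0 real. Poly_Mapping.lookup x (u @ [l]) < 1/2})"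
      by blast
    moreover have "open \<dots>"
      by (intro open_Int open_INT ballI open_Collect_disj open_Collect_const open_Collect_less
          continuous_intros finite_letters_upto)
    ultimately show ?thesis by simp
  qed
  then have oD: "open (UNIV \<times> ?D u :: ((real \<times> real) \<times> (word \<Rightarrow>\<^sub>0 real)) set)" for u
    by (intro open_Times) auto
  have S: "?S u = (tree_cover m \<inter> fst -` ?T) \<inter> (UNIV \<times> ?D u)" if u: "u \<in> fword m" for u
  proof (intro equalityI subsetI)
    fix z assume "z \<in> ?S u"
    then obtain p where p: "p \<in> ?T" "z = (p, star_section m u p)" by blast
    have "star_section m u p \<in> ?D u"
      using star_section_in_cover(2)[OF u p(1), of u] star_section_in_cover(3)[OF u p(1)]
      by (auto dest: prefix_length_le)
    then show "z \<in> (tree_cover m \<inter> fst -` ?T) \<inter> (UNIV \<times> ?D u)"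
      using p star_section_in_cover(1)[OF u p(1)] by simp
  next
    fix z assume "z \<in> (tree_cover m \<inter> fst -` ?T) \<inter> (UNIV \<times> ?D u)"
    then obtain p x where z: "z = (p, x)" "(p, x) \<in> tree_cover m" "p \<in> ?T" "x \<in> ?D u" by (cases z) auto
    obtain u' where u': "u' \<in> fword m" "x = star_section m u' p" using tree_cover_star[OF z(2,3)] by metis
    have "prefix u u'"
      using z(4) star_section_in_cover(2)[OF u'(1) z(3), of u] u'(2) by auto
    then obtain y where y: "u' = u @ y" by (auto simp: prefix_def)
    have "y = []"
    proof (rule ccontr)
      assume "y \<noteq> []"
      then obtain l y' where y': "y = l # y'" by (cases y) auto
      then have "l \<in> letters_upto m" using u'(1) y by (auto simp: fword_def letters_upto_iff)
      then have "Poly_Mapping.lookup x (u @ [l]) < 1/2" using z(4) by blast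
      then show False
        using star_section_in_cover(3)[OF u'(1) z(3), of "u @ [l]"] u'(2) y y' by simp
    qed
    then show "z \<in> ?S u" using z u' y by auto
  qed
  show ?thesis
    unfolding S[OF u] using openin_tree_cover_preimage[OF openin_H_nbhd, of m "Suc m"] oD[of u]
    by (rule openin_Int_open)
qed

section \<open>The covering property\<close>

lemma homeomorphism_graph:
  fixes \<xi> :: "'a::topological_space \<Rightarrow> 'b::topological_space"
  assumes "continuous_on T \<xi>"
  shows "homeomorphism ((\<lambda>p. (p, \<xi> p)) ` T) T fst (\<lambda>p. (p, \<xi> p))"
  by (rule homeomorphismI) (auto intro!: continuous_intros assms)

lemma hawaiian_cover: 
  assumes "p \<in> hawaiian" "p \<notin> H_nbhd (Suc m)"
  obtains i where "i \<in> {1..m}" "p \<in> H_arc i"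
proof -
  obtain i t where "i \<in> {1..<Suc m}" "t \<in> {3/8..5/8}" "p = circ_loop i t"
    using assms unfolding H_nbhd_eq by blast
  then have "i \<in> {1..m}" "p \<in> H_arc i" by (auto simp: H_arc_def)
  then show ?thesis using that by blast
qed

text \<open>Over the star around the origin the sheets correspond to the vertices; over the middle
  arc of a circle \<open>i \<le> m\<close> they correspond to the edges with label \<open>i\<close>,
  that is, to the words whose last letter has index \<open>i\<close>. The circles above
  \<open>m\<close> lie entirely in the star.\<close>

lemma covering_space_tree_cover: "covering_space (tree_cover m) fst hawaiian"
proof
  show "continuous_on (tree_cover m) fst" by (intro continuous_intros)
  have "fst z \<in> hawaiian" if "z \<in> tree_cover m" for z
    using tree_cover_hawaiian[of "fst z" "snd z"] that by simp
  moreover have "p \<in> fst ` tree_cover m" if p: "p \<in> hawaiian" for p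
  proof (cases "p \<in> H_nbhd (Suc m)")
    case True
    then have "(p, star_section m [] p) \<in> tree_cover m" by (intro star_section_in_cover) simp
    then show ?thesis by (rule rev_image_eqI) simp
  next
    case False
    then obtain i where i: "i \<in> {1..m}" "p \<in> H_arc i" using hawaiian_cover[OF p] by blast
    then obtain t where t: "1/4 < t" "t < 3/4" "p = letter_loop (i, True) t"
      by (auto simp: H_arc_def letter_loop_def)
    moreover have "[] @ [(i, True)] \<in> fword m" using i fword_snoc[of "[]"] by simp
    ultimately have "(p, vertex_vec [] + Poly_Mapping.single ([] @ [(i, True)]) t) \<in> tree_cover m"
      using tree_coverI[of "[]" "(i, True)" m t] by simp
    then show ?thesis by (rule rev_image_eqI) simp
  qed
  ultimately show "fst ` tree_cover m = hawaiian" by blast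
next
  fix p assume p: "p \<in> hawaiian"
  let ?ok = "\<lambda>T \<V>. \<Union>\<V> = tree_cover m \<inter> fst -` T \<and>
     (\<forall>u\<in>\<V>. openin (top_of_set (tree_cover m)) u) \<and>
     pairwise disjnt \<V> \<and> (\<forall>u\<in>\<V>. \<exists>q. homeomorphism u T fst q)"

  show "\<exists>T. p \<in> T \<and> openin (top_of_set hawaiian) T \<and> (\<exists>\<V>. ?ok T \<V>)"
  proof (cases "p \<in> H_nbhd (Suc m)")
    case True
    let ?T = "H_nbhd (Suc m)"
    let ?S = "\<lambda>u. (\<lambda>p. (p, star_section m u p)) ` ?T"
    have "?ok ?T (?S ` fword m)"
    proof (intro conjI ballI)
      show "\<Union>(?S ` fword m) = tree_cover m \<inter> fst -` ?T"
      proof (intro equalityI subsetI)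
        fix z assume "z \<in> \<Union>(?S ` fword m)"
        then show "z \<in> tree_cover m \<inter> fst -` ?T" using star_section_in_cover(1) by auto
      next
        fix z assume "z \<in> tree_cover m \<inter> fst -` ?T"
        then obtain p x where z: "z = (p, x)" "(p, x) \<in> tree_cover m" "p \<in> ?T" by (cases z) auto
        obtain u where "u \<in> fword m" "x = star_section m u p" using tree_cover_star[OF z(2,3)] by metis
        then show "z \<in> \<Union>(?S ` fword m)" using z by blast
      qed
      show "openin (top_of_set (tree_cover m)) V" if "V \<in> ?S ` fword m" for V
        using that openin_star_sheet by blast
      show "pairwise disjnt (?S ` fword m)"
      proof (rule pairwiseI)
        fix V V' assume V: "V \<in> ?S ` fword m" "V' \<in> ?S ` fword m" "V \<noteq> V'"
        then obtain u u' where u: "u \<in> fword m" "u' \<in> fword m" "V = ?S u" "V' = ?S u'" by blast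
        have "u \<noteq> u'" using V u by blast
        moreover have "u = u'" if "p \<in> ?T" "star_section m u p = star_section m u' p" for p
        proof -
          have "v \<noteq> [] \<and> prefix v u \<longleftrightarrow> v \<noteq> [] \<and> prefix v u'" for v
            using star_section_in_cover(2)[OF u(1) that(1), of v] star_section_in_cover(2)[OF u(2) that(1), of v] that(2)
            by simp
          then have "prefix u u'" "prefix u' u" by (metis Nil_prefix prefix_order.refl)+
          then show ?thesis by (rule prefix_order.antisym)
        qed
        ultimately show "disjnt V V'" unfolding u(3,4) disjnt_def by blast
      qed
      show "\<exists>q. homeomorphism V ?T fst q" if "V \<in> ?S ` fword m" for V
        using that homeomorphism_graph[OF continuous_on_star_section] by blast
    qed
    then have ex: "\<exists>\<V>. ?ok ?T \<V>" by (rule exI[of "?ok ?T"])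
    show ?thesis by (intro exI[of _ ?T] conjI True openin_H_nbhd ex)
  next
    case False
    then obtain i where i: "i \<in> {1..m}" "p \<in> H_arc i" using hawaiian_cover[OF p] by blast
    let ?T = "H_arc i"
    have i1: "1 \<le> i" "i \<le> m" using i by auto
    have oT: "openin (top_of_set hawaiian) ?T"
      unfolding H_arc_def by (intro openin_circ_loop_image i1) auto
    define I where "I = {v \<in> fword m. v \<noteq> [] \<and> fst (last v) = i}"
    let ?x = "\<lambda>v p. vertex_vec (butlast v) + Poly_Mapping.single v (arc_coord (last v) p)"
    let ?S = "\<lambda>v. (\<lambda>p. (p, ?x v p)) ` ?T"
    let ?D = "\<lambda>v. {x :: word \<Rightarrow>\<^sub>0 real. 0 < Poly_Mapping.lookup x v \<and> Poly_Mapping.lookup x v < (1::real)}"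
    have "open (?D v)" for v
      by (intro open_Collect_conj open_Collect_less continuous_intros)
    then have oD: "open (UNIV \<times> ?D v :: ((real \<times> real) \<times> (word \<Rightarrow>\<^sub>0 real)) set)" for v
      by (intro open_Times) auto
    have Tl: "\<exists>s. 1/4 < s \<and> s < 3/4 \<and> p = letter_loop l s" if "fst l = i" "p \<in> ?T" for l p
    proof -
      obtain t where t: "1/4 < t" "t < 3/4" "p = circ_loop i t" using \<open>p \<in> ?T\<close> by (auto simp: H_arc_def)
      then show ?thesis using \<open>fst l = i\<close> unfolding letter_loop_def
        by (cases "snd l") (auto intro: exI[of _ t] exI[of _ "1 - t"])
    qed
    have vl: "v = butlast v @ [last v]" "fst (last v) = i" "v \<in> fword m" if "v \<in> I" for v
      using that by (auto simp: I_def)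
    have point: "\<exists>s. 1/4 < s \<and> s < 3/4 \<and> p = letter_loop (last v) s \<and> ?x v p = vertex_vec (butlast v) + Poly_Mapping.single v s"
      if v: "v \<in> I" and p: "p \<in> ?T" for v p
    proof -
      obtain s where s: "1/4 < s" "s < 3/4" "p = letter_loop (last v) s" using Tl[OF vl(2)[OF v] p] by blast
      have "arc_coord (last v) p = s"
        unfolding s(3) using s vl(2)[OF v] i1 by (intro arc_coord_letter_loop) auto
      then show ?thesis using s by blast
    qed
    have lk: "Poly_Mapping.lookup (?x v p) v = s" if "v \<in> I" "?x v p = vertex_vec (butlast v) + Poly_Mapping.single v s" for v p s
      using that(2) lookup_edge_point[of "butlast v" "last v" s v] vl(1)[OF that(1)] by simp
    have S: "?S v = (tree_cover m \<inter> fst -` ?T) \<inter> (UNIV \<times> ?D v)" if v: "v \<in> I" for v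
    proof (intro equalityI subsetI)
      fix z assume "z \<in> ?S v"
      then obtain p where p: "p \<in> ?T" "z = (p, ?x v p)" by blast
      obtain s where s: "1/4 < s" "s < 3/4" "p = letter_loop (last v) s"
          "?x v p = vertex_vec (butlast v) + Poly_Mapping.single v s"
        using point[OF v p(1)] by blast
      have "z = (p, vertex_vec (butlast v) + Poly_Mapping.single (butlast v @ [last v]) s)"
        using p(2) s(4) vl(1)[OF v] by simp
      moreover have "butlast v @ [last v] \<in> fword m" using vl(1,3)[OF v] by simp
      ultimately have "z \<in> tree_cover m"
        using tree_coverI[of "butlast v" "last v" m s] s(1-3) by simp
      then show "z \<in> (tree_cover m \<inter> fst -` ?T) \<inter> (UNIV \<times> ?D v)"
        using p s lk[OF v s(4)] by auto
    next
      fix z assume "z \<in> (tree_cover m \<inter> fst -` ?T) \<inter> (UNIV \<times> ?D v)"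
      then obtain p x where z: "z = (p, x)" "(p, x) \<in> tree_cover m" "p \<in> ?T" "x \<in> ?D v" by (cases z) auto
      obtain u l where u: "v = u @ [l]" "p = letter_loop l (Poly_Mapping.lookup x v)"
          "x = vertex_vec u + Poly_Mapping.single v (Poly_Mapping.lookup x v)"
        using tree_cover_fraction[OF z(2), of v] z(4) by blast
      obtain s where s: "1/4 < s" "s < 3/4" "p = letter_loop (last v) s"
          "?x v p = vertex_vec (butlast v) + Poly_Mapping.single v s"
        using point[OF v z(3)] by blast
      have l: "1 \<le> fst l" using vl(2)[OF v] u(1) i1 by simp
      have ne: "l \<noteq> inv_letter l" by (cases l) simp
      have "s = Poly_Mapping.lookup x v"
        using letter_loop_eqD[OF l l, of s "Poly_Mapping.lookup x v"] s u z(4) ne by auto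
      then have "x = ?x v p" using u(1,3) s(4) by simp
      then show "z \<in> ?S v" using z by blast
    qed
    have "?ok ?T (?S ` I)"
    proof (intro conjI ballI)
      show "\<Union>(?S ` I) = tree_cover m \<inter> fst -` ?T"
      proof (intro equalityI subsetI)
        fix z assume "z \<in> \<Union>(?S ` I)"
        then show "z \<in> tree_cover m \<inter> fst -` ?T" using S by blast
      next
        fix z assume "z \<in> tree_cover m \<inter> fst -` ?T"
        then obtain p x where z: "z = (p, x)" "(p, x) \<in> tree_cover m" "p \<in> ?T" by (cases z) auto
        obtain t where t: "1/4 < t" "t < 3/4" "p = circ_loop i t" using z(3) by (auto simp: H_arc_def)
        obtain u b where u: "u @ [(i, b)] \<in> fword m"
            "x = vertex_vec u + Poly_Mapping.single (u @ [(i, b)]) (if b then t else 1 - t)"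
          by (rule tree_cover_arc[OF z(2) t(3) i1]) (use t in auto)
        have vI: "u @ [(i, b)] \<in> I" using u(1) by (simp add: I_def)
        moreover have "x \<in> ?D (u @ [(i, b)])" unfolding u(2) using t by (simp add: lookup_edge_point)
        ultimately have "z \<in> ?S (u @ [(i, b)])" unfolding S[OF vI] using z by simp
        then show "z \<in> \<Union>(?S ` I)" using vI by blast
      qed
      show "openin (top_of_set (tree_cover m)) V" if V: "V \<in> ?S ` I" for V
      proof -
        obtain v where v: "v \<in> I" "V = ?S v" using V by blast
        show ?thesis unfolding v(2) S[OF v(1)]
          using openin_tree_cover_preimage[OF oT] oD[of v] by (rule openin_Int_open)
      qed
      show "pairwise disjnt (?S ` I)"
      proof (rule pairwiseI)
        fix V V' assume V: "V \<in> ?S ` I" "V' \<in> ?S ` I" "V \<noteq> V'"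
        then obtain v v' where v: "v \<in> I" "v' \<in> I" "V = ?S v" "V' = ?S v'" by blast
        have "v \<noteq> v'" using V v by blast
        moreover have "v = v'" if z: "z \<in> V" "z \<in> V'" for z
        proof -
          obtain p x where zz: "z = (p, x)" by (cases z)
          have "z \<in> (tree_cover m \<inter> fst -` ?T) \<inter> (UNIV \<times> ?D v)" "z \<in> (tree_cover m \<inter> fst -` ?T) \<inter> (UNIV \<times> ?D v')"
            using z S v by blast+
          then have x: "(p, x) \<in> tree_cover m" "x \<in> ?D v" "x \<in> ?D v'" using zz by auto
          obtain u l where u: "v = u @ [l]" "x = vertex_vec u + Poly_Mapping.single v (Poly_Mapping.lookup x v)"
            using tree_cover_fraction[OF x(1), of v] x(2) by blast
          then have "x = vertex_vec u + Poly_Mapping.single (u @ [l]) (Poly_Mapping.lookup x v)" by simp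
          then have "Poly_Mapping.lookup x v' =
              (if v' = u @ [l] then Poly_Mapping.lookup x v else if v' \<noteq> [] \<and> prefix v' u then 1 else 0)"
            by (metis lookup_edge_point)
          then show ?thesis using x(3) u(1) by (auto split: if_splits)
        qed
        ultimately show "disjnt V V'" unfolding disjnt_def by blast
      qed
      show "\<exists>q. homeomorphism V ?T fst q" if V: "V \<in> ?S ` I" for V
      proof -
        obtain v where v: "v \<in> I" "V = ?S v" using V by blast
        have "?T \<subseteq> letter_loop (last v) ` {0..3/4}"
        proof
          fix p assume "p \<in> ?T"
          then obtain s where "1/4 < s" "s < 3/4" "p = letter_loop (last v) s"
            using Tl[OF vl(2)[OF v(1)]] by blast
          then show "p \<in> letter_loop (last v) ` {0..3/4}" by auto
        qed
        moreover have "1 \<le> fst (last v)" using vl(2)[OF v(1)] i1 by simp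
        ultimately have "continuous_on ?T (arc_coord (last v))"
          using continuous_on_arc_coord_image continuous_on_subset by blast
        then have "continuous_on ?T (?x v)"
          unfolding single_eq_scaleR[of v "arc_coord _ _"] by (intro continuous_intros)
        then show ?thesis unfolding v(2) using homeomorphism_graph by blast
      qed
    qed
    then have ex: "\<exists>\<V>. ?ok ?T \<V>" by (rule exI[of "?ok ?T"])
    show ?thesis by (intro exI[of _ ?T] conjI i(2) oT ex)
  qed
qed

section \<open>Lifts as functions to the vertices\<close>

text \<open>A lift of a path \<open>\<gamma>\<close> to a graph with one incoming and one outgoing edge per label at every
  vertex is recorded by the function \<open>g\<close> mapping each time to the source of the edge that contains
  the lifted point. The condition at a time with \<open>\<gamma> t0 = 0\<close> says that the lift passes through the vertex
  \<open>g t0\<close>; \<open>act i v\<close> is the target of the edge with label \<open>i\<close> emanating from \<open>v\<close>.\<close>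

definition tracks_at ::
  "(nat \<Rightarrow> 'v \<Rightarrow> 'v) \<Rightarrow> ('a \<Rightarrow> real \<times> real) \<Rightarrow> ('a \<Rightarrow> 'v) \<Rightarrow> 'a \<Rightarrow> 'a \<Rightarrow> bool" where
  "tracks_at act \<gamma> g t0 t \<longleftrightarrow> (if \<gamma> t0 = (0, 0)
     then \<forall>i\<ge>1. \<forall>\<tau>\<in>{0..<1}. \<gamma> t = circ_loop i \<tau> \<longrightarrow>
       (if \<tau> < 1/2 then g t = g t0 else act i (g t) = g t0)
     else g t = g t0)"

definition tracks ::
  "(nat \<Rightarrow> 'v \<Rightarrow> 'v) \<Rightarrow> 'a::topological_space set \<Rightarrow> ('a \<Rightarrow> real \<times> real) \<Rightarrow> ('a \<Rightarrow> 'v) \<Rightarrow> bool" where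
  "tracks act S \<gamma> g \<longleftrightarrow>
     (\<forall>t0\<in>S. \<exists>U. openin (top_of_set S) U \<and> t0 \<in> U \<and> (\<forall>t\<in>U. tracks_at act \<gamma> g t0 t))"

lemma tracksE:
  assumes "tracks act S \<gamma> g" "t0 \<in> S"
  obtains U where "openin (top_of_set S) U" "t0 \<in> U" "\<And>t. t \<in> U \<Longrightarrow> tracks_at act \<gamma> g t0 t"
proof -
  have "\<exists>U. openin (top_of_set S) U \<and> t0 \<in> U \<and> (\<forall>t\<in>U. tracks_at act \<gamma> g t0 t)"
    using assms unfolding tracks_def by (rule bspec)
  then show ?thesis using that by (elim exE conjE) (simp add: Ball_def)
qed

lemma hawaiian_circ_loop:
  assumes "p \<in> hawaiian"
  obtains i \<tau> where "1 \<le> i" "\<tau> \<in> {0..<1}" "p = circ_loop i \<tau>"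
proof -
  obtain i where "1 \<le> i" "p \<in> circ i" using assms by (auto simp: hawaiian_def)
  then show ?thesis using that circ_eq_image by auto
qed

text \<open>Whether the two functions agree is locally constant in time: near a passage through the
  origin each value is the vertex passed or its preimage under some \<open>act i\<close>, with the
  same choice for both functions, and \<open>act i\<close> is injective.\<close>

lemma tracks_unique:
  assumes S: "connected S" and \<gamma>: "\<And>t. t \<in> S \<Longrightarrow> \<gamma> t \<in> hawaiian"
    and g: "tracks act S \<gamma> g" "\<And>t. t \<in> S \<Longrightarrow> g t \<in> V" and g': "tracks act S \<gamma> g'" "\<And>t. t \<in> S \<Longrightarrow> g' t \<in> V"
    and inj: "\<And>i. 1 \<le> i \<Longrightarrow> inj_on (act i) V" and s: "s \<in> S" "g s = g' s" and t: "t \<in> S"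
  shows "g t = g' t"
proof -
  have "(g s = g' s) = (g t = g' t)"
  proof (rule connected_local_const[OF S s(1) t], rule ballI)
    fix t0 assume t0: "t0 \<in> S"
    obtain U where U: "openin (top_of_set S) U" "t0 \<in> U" "\<And>t. t \<in> U \<Longrightarrow> tracks_at act \<gamma> g t0 t"
      by (rule tracksE[OF g(1) t0]) blast
    obtain U' where U': "openin (top_of_set S) U'" "t0 \<in> U'" "\<And>t. t \<in> U' \<Longrightarrow> tracks_at act \<gamma> g' t0 t"
      by (rule tracksE[OF g'(1) t0]) blast
    have "openin (top_of_set S) (U \<inter> U')" using U(1) U'(1) by (rule openin_Int)
    then obtain W where W: "open W" "U \<inter> U' = S \<inter> W" by (auto simp: openin_open)
    have *: "(g t0 = g' t0) = (g t = g' t)" if tt: "t \<in> S" "t \<in> W" for t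
    proof -
      have tU: "tracks_at act \<gamma> g t0 t" "tracks_at act \<gamma> g' t0 t" using U(3) U'(3) W(2) tt by blast+
      show ?thesis
      proof (cases "\<gamma> t0 = (0, 0)")
        case True
        obtain i \<tau> where i: "1 \<le> i" "\<tau> \<in> {0..<1}" "\<gamma> t = circ_loop i \<tau>"
          using hawaiian_circ_loop[OF \<gamma>[OF tt(1)]] by blast
        have "if \<tau> < 1/2 then g t = g t0 else act i (g t) = g t0"
          "if \<tau> < 1/2 then g' t = g' t0 else act i (g' t) = g' t0"
          using tU True i unfolding tracks_at_def by auto
        then show ?thesis
          using inj_on_eq_iff[OF inj[OF i(1)] g(2)[OF tt(1)] g'(2)[OF tt(1)]] by (auto split: if_splits)
      next
        case False
        then show ?thesis using tU unfolding tracks_at_def by auto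
      qed
    qed
    have "t0 \<in> W" using W(2) U(2) U'(2) by blast
    then show "\<forall>\<^sub>F t in at t0 within S. (g t0 = g' t0) = (g t = g' t)"
      unfolding eventually_at_topological using W(1) * by blast
  qed
  then show ?thesis using s(2) by simp
qed

text \<open>Equivariant maps of vertices carry lifts to lifts. This transfers lifts from the trees
  to the covering graph without constructing paths there.\<close>

lemma tracks_map:
  assumes "tracks act S \<gamma> g" "\<And>t i. t \<in> S \<Longrightarrow> 1 \<le> i \<Longrightarrow> \<phi> (act i (g t)) = act' i (\<phi> (g t))"
  shows "tracks act' S \<gamma> (\<lambda>t. \<phi> (g t))"
  unfolding tracks_def
proof
  fix t0 assume t0: "t0 \<in> S"
  obtain U where U: "openin (top_of_set S) U" "t0 \<in> U" "\<And>t. t \<in> U \<Longrightarrow> tracks_at act \<gamma> g t0 t"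
    by (rule tracksE[OF assms(1) t0]) blast
  have "tracks_at act' \<gamma> (\<lambda>t. \<phi> (g t)) t0 t" if "t \<in> U" for t
  proof -
    have "t \<in> S" using openin_subset[OF U(1)] that by auto
    then show ?thesis using U(3)[OF that] assms(2)[of t] unfolding tracks_at_def by (metis (no_types, lifting))
  qed
  then show "\<exists>U. openin (top_of_set S) U \<and> t0 \<in> U \<and> (\<forall>t\<in>U. tracks_at act' \<gamma> (\<lambda>t. \<phi> (g t)) t0 t)"
    using U by blast
qed

lemma tracks_compose:
  assumes "tracks act S \<gamma> g" and h: "continuous_on T h" "\<And>t. t \<in> T \<Longrightarrow> h t \<in> S"
  shows "tracks act T (\<lambda>t. \<gamma> (h t)) (\<lambda>t. g (h t))"
  unfolding tracks_def
proof
  fix t0 assume t0: "t0 \<in> T"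
  obtain U where U: "openin (top_of_set S) U" "h t0 \<in> U" "\<And>t. t \<in> U \<Longrightarrow> tracks_at act \<gamma> g (h t0) t"
    by (rule tracksE[OF assms(1) h(2)[OF t0]]) blast
  have "openin (top_of_set T) (T \<inter> h -` U)"
    using h by (intro continuous_openin_preimage[OF h(1) _ U(1)]) auto
  moreover have "tracks_at act (\<lambda>t. \<gamma> (h t)) (\<lambda>t. g (h t)) t0 t" if "t \<in> T \<inter> h -` U" for t
    using U(3)[of "h t"] that unfolding tracks_at_def by simp
  ultimately show "\<exists>U. openin (top_of_set T) U \<and> t0 \<in> U \<and>
      (\<forall>t\<in>U. tracks_at act (\<lambda>t. \<gamma> (h t)) (\<lambda>t. g (h t)) t0 t)"
    using t0 U(2) by (intro exI[of _ "T \<inter> h -` U"]) blast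
qed

text \<open>Near each time a lift takes no other values than its current vertex and the preimages of
  this vertex under generators. Finitely many such neighborhoods cover the compact set of
  times.\<close>

lemma tracks_finite:
  assumes S: "compact S" and \<gamma>: "\<And>t. t \<in> S \<Longrightarrow> \<gamma> t \<in> hawaiian" and g: "tracks act S \<gamma> g"
    and V: "\<And>t. t \<in> S \<Longrightarrow> g t \<in> V"
    and fin: "\<And>v. v \<in> V \<Longrightarrow> finite {u \<in> V. \<exists>i\<ge>1. act i u = v}"
  shows "finite (g ` S)"
proof -
  have "\<exists>W. open W \<and> t0 \<in> W \<and> finite (g ` (S \<inter> W))" if t0: "t0 \<in> S" for t0
  proof -
    obtain U where U: "openin (top_of_set S) U" "t0 \<in> U" "\<And>t. t \<in> U \<Longrightarrow> tracks_at act \<gamma> g t0 t"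
      by (rule tracksE[OF g t0]) blast
    obtain W where W: "open W" "U = S \<inter> W" using U(1) by (auto simp: openin_open)
    have "g t \<in> insert (g t0) {u \<in> V. \<exists>i\<ge>1. act i u = g t0}" if t: "t \<in> S \<inter> W" for t
    proof (cases "\<gamma> t0 = (0, 0)")
      case True
      obtain i \<tau> where i: "1 \<le> i" "\<tau> \<in> {0..<1}" "\<gamma> t = circ_loop i \<tau>"
        using hawaiian_circ_loop[OF \<gamma>] t by blast
      then have "if \<tau> < 1/2 then g t = g t0 else act i (g t) = g t0"
        using U(3)[of t] t W True unfolding tracks_at_def by auto
      then show ?thesis using i V t by (auto split: if_splits)
    next
      case False
      then show ?thesis using U(3)[of t] t W unfolding tracks_at_def by auto
    qed
    then have "g ` (S \<inter> W) \<subseteq> insert (g t0) {u \<in> V. \<exists>i\<ge>1. act i u = g t0}" by blast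
    moreover have "finite (insert (g t0) {u \<in> V. \<exists>i\<ge>1. act i u = g t0})" using fin[OF V[OF t0]] by simp
    ultimately show ?thesis using W U(2) finite_subset by blast
  qed
  then obtain W where W: "\<And>t0. t0 \<in> S \<Longrightarrow> open (W t0) \<and> t0 \<in> W t0 \<and> finite (g ` (S \<inter> W t0))" by metis
  obtain D where D: "D \<subseteq> S" "finite D" "S \<subseteq> (\<Union>t0\<in>D. W t0)"
    by (rule compactE_image[OF S, of S W]) (use W in blast)+
  have "g ` S \<subseteq> (\<Union>t0\<in>D. g ` (S \<inter> W t0))" using D(3) by blast
  moreover have "finite \<dots>" using D W by blast
  ultimately show ?thesis by (rule finite_subset)
qed

section \<open>Sources of the points of the tree covers\<close>

definition free_act :: "nat \<Rightarrow> nat \<Rightarrow> word \<Rightarrow> word" where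
  "free_act m i u = (if i \<le> m then rmul u (i, True) else u)"

lemma inj_on_free_act: "inj_on (free_act m i) (fword m)"
proof (rule inj_onI)
  fix u v assume uv: "u \<in> fword m" "v \<in> fword m" "free_act m i u = free_act m i v"
  then have "is_reduced u" "is_reduced v" by (auto simp: fword_def)
  then show "u = v" using uv(3) rmul_rmul_inv by (metis free_act_def)
qed

text \<open>If the coordinate \<open>v\<close> is fractional, the point lies inside the edge that
  ends at \<open>v\<close> away from the root, and the direction of its label points to
  \<open>v\<close> exactly if the last letter of \<open>v\<close> is positive. On loops and at
  vertices the source is the vertex itself.\<close>

definition edge_source :: "(word \<Rightarrow>\<^sub>0 real) \<Rightarrow> word" where
  "edge_source x = (if \<exists>v. 0 < Poly_Mapping.lookup x v \<and> Poly_Mapping.lookup x v < 1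
     then let v = SOME v. 0 < Poly_Mapping.lookup x v \<and> Poly_Mapping.lookup x v < 1
       in if snd (last v) then butlast v else v
     else SOME u. x = vertex_vec u)"

lemma edge_source_vertex [simp]: "edge_source (vertex_vec u) = u"
proof -
  have "\<not> (\<exists>v. 0 < Poly_Mapping.lookup (vertex_vec u) v \<and> Poly_Mapping.lookup (vertex_vec u) v < 1)"
    by (simp add: lookup_vertex_vec)
  then have "edge_source (vertex_vec u) = (SOME v. vertex_vec u = vertex_vec v)"
    unfolding edge_source_def by (rule if_not_P)
  also have "\<dots> = u" by (rule some_equality) (auto dest: vertex_vec_inj)
  finally show ?thesis .
qed

lemma edge_source_edge:
  assumes "0 < s" "s < 1"
  shows "edge_source (vertex_vec u + Poly_Mapping.single (u @ [l]) s) = (if snd l then u else u @ [l])"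
proof -
  let ?x = "vertex_vec u + Poly_Mapping.single (u @ [l]) s"
  have f: "0 < Poly_Mapping.lookup ?x v \<and> Poly_Mapping.lookup ?x v < 1 \<longleftrightarrow> v = u @ [l]" for v
    using assms by (simp add: lookup_edge_point)
  have "edge_source ?x = (let v = u @ [l] in if snd (last v) then butlast v else v)"
    unfolding edge_source_def f by simp
  then show ?thesis by simp
qed

lemma edge_source_in: "(p, x) \<in> tree_cover m \<Longrightarrow> edge_source x \<in> fword m"
proof (erule tree_cover_cases)
  fix u l s assume a: "u @ [l] \<in> fword m" "0 \<le> s" "s \<le> 1" "x = vertex_vec u + Poly_Mapping.single (u @ [l]) s"
  then have u: "u \<in> fword m" using fword_snoc by simp
  consider "s = 0" | "s = 1" | "0 < s" "s < 1" using a by linarith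
  then show ?thesis
  proof cases
    case 1
    then have "x = vertex_vec u" using a by simp
    then show ?thesis using u by simp
  next
    case 2
    then have "x = vertex_vec (u @ [l])" using a vertex_vec_snoc by simp
    then show ?thesis using a(1) by simp
  next
    case 3
    then show ?thesis using a u edge_source_edge by simp
  qed
qed simp

text \<open>The condition \<open>tracks_at\<close> at a passage through the vertex \<open>u\<close>:
  with parameter below 1/2 the lifted point has just left \<open>u\<close> along its edge, otherwise
  it is about to arrive there.\<close>

lemma edge_source_star:
  assumes u: "u \<in> fword m" and p: "p \<in> H_nbhd (Suc m)" "p = circ_loop i \<tau>" "1 \<le> i" "\<tau> \<in> {0..<1}"
  shows "if \<tau> < 1/2 then edge_source (star_section m u p) = u
    else free_act m i (edge_source (star_section m u p)) = u"
proof (cases "m < i")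
  case True
  then have "star_section m u p = vertex_vec u" using star_section_high circ_loop_in_circ[OF p(3)] p(2) by blast
  then show ?thesis using True by (simp add: free_act_def)
next
  case False
  then have im: "i \<in> {1..m}" using p by simp
  have pT: "p = letter_loop (i, True) \<tau>" and pF: "p = letter_loop (i, False) (1 - \<tau>)"
    using p(2) by (simp_all add: letter_loop_def)
  have h: "\<tau> < 3/8 \<or> 5/8 < \<tau>"
    using H_nbhd_letter_loop[of "(i, True)" m \<tau>] im p(1,4) unfolding pT by simp
  \<comment> \<open>Both halves become half edges leaving \<open>u\<close>: a point about to arrive
    along \<open>a\<^sub>i\<close> is at parameter \<open>1 - \<tau>\<close> on the half edge of the
    inverse letter.\<close>
  define l :: letter where "l = (if \<tau> < 1/2 then (i, True) else (i, False))"
  define s where "s = (if \<tau> < 1/2 then \<tau> else 1 - \<tau>)"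
  have l: "l \<in> letters_upto m" "fst l = i" and s: "0 \<le> s" "s < 3/8" and pl: "p = letter_loop l s"
    using im h p(4) pT pF by (auto simp: l_def s_def letters_upto_iff)
  have red: "is_reduced u" using u by (simp add: fword_def)
  consider "\<tau> = 0" | "0 < s" "u \<noteq> []" "last u = inv_letter l" | "0 < s" "u @ [l] \<in> fword m"
    using s(1) u l by (auto simp: s_def fword_snoc letters_upto_iff)
      (metis (full_types) atLeastLessThan_iff less_eq_real_def p(4) diff_gt_0_iff_gt)+
  then show ?thesis
  proof cases
    case 1
    then show ?thesis using star_section_0 pT by simp
  next
    case 2
    define u' where "u' = butlast u"
    have uu: "u = u' @ [inv_letter l]" using 2 by (metis append_butlast_last_id u'_def)
    have "p = letter_loop (inv_letter l) (1 - s)" using pl by (simp add: letter_loop_inv)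
    then have "star_section m u p = vertex_vec u' + Poly_Mapping.single (u' @ [inv_letter l]) (1 - s)"
      using star_section_backward[of u' "inv_letter l" m "1 - s"] u s uu by simp
    then have e: "edge_source (star_section m u p) = (if snd l then u else u')"
      using edge_source_edge[of "1 - s" u' "inv_letter l"] 2 s uu by (simp add: inv_letter_def)
    show ?thesis
    proof (cases "\<tau> < 1/2")
      case True
      then show ?thesis using e by (simp add: l_def)
    next
      case False
      then have "u = u' @ [(i, True)]" using uu by (simp add: l_def)
      then have "rmul u' (i, True) = u" using red by (auto simp: rmul_def is_reduced_snoc)
      then show ?thesis using False e im by (simp add: l_def free_act_def)
    qed
  next
    case 3
    then have "star_section m u p = vertex_vec u + Poly_Mapping.single (u @ [l]) s"
      unfolding pl using s by (intro star_section_forward)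
    then have e: "edge_source (star_section m u p) = (if snd l then u else u @ [l])"
      using edge_source_edge 3 s by simp
    show ?thesis
    proof (cases "\<tau> < 1/2")
      case True
      then show ?thesis using e by (simp add: l_def)
    next
      case False
      then have "l = inv_letter (i, True)" by (simp add: l_def)
      then have "rmul (u @ [l]) (i, True) = u" by (simp add: rmul_def)
      then show ?thesis using False e im by (simp add: l_def free_act_def)
    qed
  qed
qed

lemma tracks_tree_lift:
  assumes c: "continuous_on S \<gamma>" "continuous_on S x" and E: "\<And>t. t \<in> S \<Longrightarrow> (\<gamma> t, x t) \<in> tree_cover m"
  shows "tracks (free_act m) S \<gamma> (\<lambda>t. edge_source (x t))"
  unfolding tracks_def
proof
  fix t0 assume t0: "t0 \<in> S"
  let ?f = "\<lambda>t. (\<gamma> t, x t)"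
  have cf: "continuous_on S ?f" using c by (intro continuous_intros)
  have fE: "?f \<in> S \<rightarrow> tree_cover m" using E by blast
  have \<gamma>H: "\<gamma> \<in> S \<rightarrow> hawaiian" using E tree_cover_hawaiian by blast
  note E0 = E[OF t0]
  show "\<exists>U. openin (top_of_set S) U \<and> t0 \<in> U \<and> (\<forall>t\<in>U. tracks_at (free_act m) \<gamma> (\<lambda>t. edge_source (x t)) t0 t)"
  proof (cases "\<gamma> t0 \<in> H_nbhd (Suc m)")
    case True
    obtain u where u: "u \<in> fword m" "x t0 = star_section m u (\<gamma> t0)" using tree_cover_star[OF E0 True] by metis
    let ?S = "(\<lambda>p. (p, star_section m u p)) ` H_nbhd (Suc m)"
    let ?U = "S \<inter> ?f -` ?S"
    have oU: "openin (top_of_set S) ?U"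
      by (rule continuous_openin_preimage[OF cf fE openin_star_sheet[OF u(1)]])
    have t0U: "t0 \<in> ?U" using t0 u True by auto
    have U: "\<gamma> t \<in> H_nbhd (Suc m)" "x t = star_section m u (\<gamma> t)" if "t \<in> ?U" for t
      using that by auto
    show ?thesis
    proof (cases "\<gamma> t0 = (0, 0)")
      case z: True
      have "x t0 = vertex_vec u" using u z star_section_0 by simp
      then have s0: "edge_source (x t0) = u" by simp
      have "tracks_at (free_act m) \<gamma> (\<lambda>t. edge_source (x t)) t0 t" if t: "t \<in> ?U" for t
        unfolding tracks_at_def if_P[OF z] s0
      proof (intro allI ballI impI)
        fix i :: nat and \<tau> assume "1 \<le> i" "\<tau> \<in> {0..<1}" "\<gamma> t = circ_loop i \<tau>"
        then show "if \<tau> < 1/2 then edge_source (x t) = u else free_act m i (edge_source (x t)) = u"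
          using edge_source_star[OF u(1) U(1)[OF t]] unfolding U(2)[OF t] by blast
      qed
      then show ?thesis using oU t0U by blast
    next
      case nz: False
      obtain i \<tau>0 where i: "1 \<le> i" "0 < \<tau>0" "\<tau>0 < 1" "\<gamma> t0 = circ_loop i \<tau>0"
        using hawaiian_cases[of "\<gamma> t0"] \<gamma>H t0 nz by blast
      \<comment> \<open>Away from the origin the source has to be locally constant, so
        \<open>\<tau>\<close> is kept on one side of 1/2; a circle above \<open>m\<close> is a loop
        at \<open>u\<close> as a whole and needs no such separation.\<close>
      define J where "J = (if m < i then {0<..<1} else if \<tau>0 < 1/2 then {0<..<1/2} else {1/2<..<(1::real)})"
      have J: "open J" "J \<subseteq> {0<..<1}" by (auto simp: J_def)
      have half: "\<tau>0 \<noteq> 1/2" if "i \<le> m"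
        using H_nbhd_letter_loop[of "(i, True)" m \<tau>0] True i that by (auto simp: letter_loop_def)
      have \<tau>0: "\<tau>0 \<in> J" using i half by (auto simp: J_def)
      let ?W = "?U \<inter> (S \<inter> \<gamma> -` (circ_loop i ` J))"
      have "openin (top_of_set S) (S \<inter> \<gamma> -` (circ_loop i ` J))"
        by (rule continuous_openin_preimage[OF c(1) \<gamma>H openin_circ_loop_image[OF i(1) J]])
      then have oW: "openin (top_of_set S) ?W" using oU by (rule openin_Int[rotated])
      have t0W: "t0 \<in> ?W" using t0U t0 i(4) \<tau>0 by blast
      have "edge_source (x t) = edge_source (x t0)" if t: "t \<in> ?W" for t
      proof -
        have tU: "t \<in> ?U" using t by blast
        obtain \<tau> where \<tau>: "\<tau> \<in> J" "\<gamma> t = circ_loop i \<tau>" using t by blast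
        have \<tau>1: "\<tau> \<in> {0..<1}" using \<tau>(1) J(2) by auto
        have e: "if \<tau> < 1/2 then edge_source (x t) = u else free_act m i (edge_source (x t)) = u"
          using edge_source_star[OF u(1) U(1)[OF tU] \<tau>(2) i(1) \<tau>1] U(2)[OF tU] by simp
        have e0: "if \<tau>0 < 1/2 then edge_source (x t0) = u else free_act m i (edge_source (x t0)) = u"
          using edge_source_star[OF u(1) U(1)[OF t0U] i(4) i(1)] i(2,3) U(2)[OF t0U] by simp
        have "t \<in> S" using t by blast
        then have f: "edge_source (x t) \<in> fword m" "edge_source (x t0) \<in> fword m"
          using edge_source_in E E0 by blast+
        show ?thesis
        proof (cases "m < i")
          case True
          then show ?thesis using e e0 by (simp add: free_act_def split: if_splits)
        next
          case False
          then have "\<tau> < 1/2 \<longleftrightarrow> \<tau>0 < 1/2" using \<tau>(1) half by (auto simp: J_def split: if_splits)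
          then show ?thesis using e e0 inj_onD[OF inj_on_free_act _ f] by (auto split: if_splits)
        qed
      qed
      then have "\<forall>t\<in>?W. tracks_at (free_act m) \<gamma> (\<lambda>t. edge_source (x t)) t0 t"
        unfolding tracks_at_def using nz by simp
      then show ?thesis using oW t0W by blast
    qed
  next
    case False
    have "\<gamma> t0 \<in> hawaiian" using \<gamma>H t0 by blast
    then obtain i where i: "i \<in> {1..m}" "\<gamma> t0 \<in> H_arc i" using hawaiian_cover False by blast
    then obtain \<tau> where \<tau>: "1/4 < \<tau>" "\<tau> < 3/4" "\<gamma> t0 = circ_loop i \<tau>" by (auto simp: H_arc_def)
    have nz: "\<gamma> t0 \<noteq> (0, 0)" using \<tau> circ_loop_eq_0[of i \<tau>] i by simp
    obtain u b where u: "u @ [(i, b)] \<in> fword m"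
        "x t0 = vertex_vec u + Poly_Mapping.single (u @ [(i, b)]) (if b then \<tau> else 1 - \<tau>)"
      by (rule tree_cover_arc[OF E0 \<tau>(3)]) (use i \<tau> in auto)
    let ?v = "u @ [(i, b)]"
    \<comment> \<open>As long as the coordinate of this edge is fractional, the lift stays inside
      the edge and its source does not change.\<close>
    let ?D = "{x :: word \<Rightarrow>\<^sub>0 real. 0 < Poly_Mapping.lookup x ?v \<and> Poly_Mapping.lookup x ?v < 1}"
    have "open ?D" by (intro open_Collect_conj open_Collect_less continuous_intros)
    then have oU: "openin (top_of_set S) (S \<inter> x -` ?D)"
      using c(2) by (intro continuous_openin_preimage_gen)
    have src: "edge_source (x t) = (if b then u else ?v)" if "t \<in> S \<inter> x -` ?D" for t
    proof -
      have t: "0 < Poly_Mapping.lookup (x t) ?v" "Poly_Mapping.lookup (x t) ?v < 1" "t \<in> S" using that by auto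
      then obtain u' l where "?v = u' @ [l]"
        "x t = vertex_vec u' + Poly_Mapping.single ?v (Poly_Mapping.lookup (x t) ?v)"
        using tree_cover_fraction[OF E t(1,2)] by metis
      then have "x t = vertex_vec u + Poly_Mapping.single (u @ [(i, b)]) (Poly_Mapping.lookup (x t) ?v)" by simp
      then show ?thesis using edge_source_edge[OF t(1,2), of u "(i, b)"] by simp
    qed
    have "t0 \<in> S \<inter> x -` ?D" using t0 \<tau> u(2) by (simp add: lookup_edge_point)
    then show ?thesis using oU src nz unfolding tracks_at_def by (intro exI[of _ "S \<inter> x -` ?D"]) simp
  qed
qed

section \<open>Lifts of loops that start at the root\<close>

definition tree_lift :: "nat \<Rightarrow> (real \<Rightarrow> real \<times> real) \<Rightarrow> (real \<Rightarrow> word \<Rightarrow>\<^sub>0 real) \<Rightarrow> bool" where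
  "tree_lift m \<gamma> x \<longleftrightarrow> continuous_on {0..1} x \<and> (\<forall>t\<in>{0..1}. (\<gamma> t, x t) \<in> tree_cover m) \<and> x 0 = 0"

abbreviation H_loops :: "(real \<Rightarrow> real \<times> real) set" where
  "H_loops \<equiv> loops_at (top_of_set hawaiian) (0, 0)"

lemma H_loopsD:
  assumes "\<gamma> \<in> H_loops"
  shows "continuous_on {0..1} \<gamma>" "\<And>t. t \<in> {0..1} \<Longrightarrow> \<gamma> t \<in> hawaiian" "\<gamma> 0 = (0, 0)" "\<gamma> 1 = (0, 0)"
  using assms by (auto simp: loops_at_def pathin_def)

lemma vertex_vec_Nil: "vertex_vec [] = 0"
  by (rule poly_mapping_eqI) (simp add: lookup_vertex_vec)

lemma origin_in_tree_cover: "((0, 0), vertex_vec u) \<in> tree_cover m" if "u \<in> fword m"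
proof -
  have "(0, 0) \<in> circ (Suc m)" using circ_loop_in_circ[of "Suc m" 0] by simp
  then show ?thesis using that unfolding tree_cover_def by blast
qed

lemma tree_cover_origin:
  assumes "((0, 0), x) \<in> tree_cover m"
  obtains u where "u \<in> fword m" "x = vertex_vec u"
proof -
  have "(0, 0) \<in> H_nbhd (Suc m)" using circ_loop_in_circ[of "Suc m" 0] by (force simp: H_nbhd_def)
  then obtain u where "u \<in> fword m" "x = star_section m u (0, 0)" using tree_cover_star[OF assms] by metis
  then show ?thesis using that star_section_0 by simp
qed

lemma tree_lift_exists:
  assumes "\<gamma> \<in> H_loops"
  obtains x where "tree_lift m \<gamma> x"
proof -
  have "path \<gamma>" "path_image \<gamma> \<subseteq> hawaiian" "pathstart \<gamma> = fst ((0, 0), 0 :: word \<Rightarrow>\<^sub>0 real)"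
    using H_loopsD[OF assms] by (auto simp: path_def path_image_def pathstart_def)
  moreover have "((0, 0), 0) \<in> tree_cover m"
    using origin_in_tree_cover[of "[]"] by (simp add: vertex_vec_Nil)
  ultimately obtain h where h: "path h" "path_image h \<subseteq> tree_cover m" "pathstart h = ((0, 0), 0)"
      "\<And>t. t \<in> {0..1} \<Longrightarrow> fst (h t) = \<gamma> t"
    using covering_space_lift_path_strong[OF covering_space_tree_cover] by metis
  have "tree_lift m \<gamma> (\<lambda>t. snd (h t))"
    unfolding tree_lift_def
  proof (intro conjI ballI)
    show "continuous_on {0..1} (\<lambda>t. snd (h t))" using h(1) unfolding path_def by (intro continuous_intros)
    show "(\<gamma> t, snd (h t)) \<in> tree_cover m" if "t \<in> {0..1}" for t
    proof -
      have "h t \<in> tree_cover m" using h(2) that by (auto simp: path_image_def)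
      then show ?thesis using h(4)[OF that] by (metis prod.collapse)
    qed
    show "snd (h 0) = 0" using h(3) by (simp add: pathstart_def)
  qed
  then show ?thesis using that by blast
qed

lemma tree_lift_homotopic:
  assumes hom: "loop_homotopic (top_of_set hawaiian) (0, 0) \<gamma> \<gamma>'" and x: "tree_lift m \<gamma> x" and x': "tree_lift m \<gamma>' x'"
  shows "x 1 = x' 1"
proof -
  note l = loop_homotopic_imp_loops[OF hom]
  note g = H_loopsD[OF l(1)] and g' = H_loopsD[OF l(2)]
  let ?h = "\<lambda>t. (\<gamma> t, x t)" and ?h' = "\<lambda>t. (\<gamma>' t, x' t)"
  have hp: "homotopic_paths hawaiian \<gamma> \<gamma>'"
    using hom g(3,4) unfolding homotopic_paths_def loop_homotopic_def by (simp add: pathstart_def pathfinish_def)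
  have "pathfinish ?h = pathfinish ?h'"
  proof (rule covering_space_monodromy[OF covering_space_tree_cover _ _ _ _ hp])
    show "path \<gamma>" "path \<gamma>'" "path_image \<gamma> \<subseteq> hawaiian" "path_image \<gamma>' \<subseteq> hawaiian"
      using g g' by (auto simp: path_def path_image_def)
    show "path ?h" "path ?h'"
      using g g' x x' by (auto simp: path_def tree_lift_def intro!: continuous_intros)
    show "path_image ?h \<subseteq> tree_cover m" "path_image ?h' \<subseteq> tree_cover m"
      using x x' by (auto simp: path_image_def tree_lift_def)
    show "pathstart ?h = pathstart ?h'"
      using x x' g g' by (simp add: pathstart_def tree_lift_def)
  qed simp_all
  then show ?thesis by (simp add: pathfinish_def)
qed

lemma tracks_lift:
  assumes "\<gamma> \<in> H_loops" "tree_lift m \<gamma> x"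
  shows "tracks (free_act m) {0..1} \<gamma> (\<lambda>t. edge_source (x t))"
    and "\<And>t. t \<in> {0..1} \<Longrightarrow> edge_source (x t) \<in> fword m"
    and "edge_source (x 0) = []"
    and "edge_source (x 1) = u \<longleftrightarrow> x 1 = vertex_vec u"
proof -
  show "tracks (free_act m) {0..1} \<gamma> (\<lambda>t. edge_source (x t))"
    using assms H_loopsD[OF assms(1)] by (intro tracks_tree_lift) (auto simp: tree_lift_def)
  show "edge_source (x t) \<in> fword m" if "t \<in> {0..1}" for t
    using assms(2) that edge_source_in[of "\<gamma> t" "x t" m] unfolding tree_lift_def by blast
  have "x 0 = vertex_vec []" using assms(2) by (simp add: tree_lift_def vertex_vec_Nil)
  then show "edge_source (x 0) = []" by simp
  have "((0, 0), x 1) \<in> tree_cover m"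
    using assms(2) H_loopsD(4)[OF assms(1)] unfolding tree_lift_def
    by (metis atLeastAtMost_iff order_refl zero_le_one)
  then obtain v where "x 1 = vertex_vec v" by (rule tree_cover_origin)
  then show "edge_source (x 1) = u \<longleftrightarrow> x 1 = vertex_vec u" by (auto dest: vertex_vec_inj)
qed

section \<open>Paths in the covering graph\<close>

definition point_source :: "hat_point \<Rightarrow> word" where
  "point_source x = (case x of Vertex v \<Rightarrow> v | Inner e t \<Rightarrow> src e)"

context word_enumeration
begin

lemma point_source_in: "x \<in> hat_points w \<Longrightarrow> point_source x \<in> Gam_star w"
  by (cases x) (auto simp: hat_points_def point_source_def elim!: hat_edgeE)

text \<open>In a chart around the point, take the points whose image lies in the part of the circle
  that comes from this edge. As \<open>q_map\<close> is injective on the chart, they all lie on the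
  edge.\<close>

lemma hat_point_nbhd_Inner:
  assumes e: "e \<in> hat_edges w" "0 < s" "s < 1"
  obtains W where "openin (hat_space w) W" "Inner e s \<in> W" "W \<subseteq> range (Inner e)"
proof -
  have "Inner e s \<in> \<Union>charts" unfolding Union_charts hat_points_def using e by blast
  then obtain U where U: "U \<in> charts" "Inner e s \<in> U" by blast
  let ?J = "{t. 0 < t \<and> t < 1 \<and> Inner e t \<in> U}"
  have i: "1 \<le> lab e" using e(1) hat_edgeE by metis
  have oJ: "openin (top_of_set hawaiian) (circ_loop (lab e) ` ?J)"
    by (rule openin_circ_loop_image[OF i open_chart_section[OF e(1) U(1)]]) auto
  let ?W = "{x \<in> topspace (hat_space w). q_map x \<in> circ_loop (lab e) ` ?J} \<inter> U"
  have "openin (hat_space w) ?W"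
    by (intro openin_Int openin_continuous_map_preimage[OF continuous_map_q_map oJ] hat_space_props(2)[OF U(1)])
  moreover have "Inner e s \<in> topspace (hat_space w)"
    unfolding hat_space_props(1) Union_charts[symmetric] using U by blast
  then have "Inner e s \<in> ?W" using e U by auto
  moreover have "?W \<subseteq> range (Inner e)"
  proof
    fix x assume x: "x \<in> ?W"
    then obtain t where t: "0 < t" "t < 1" "Inner e t \<in> U" "q_map x = circ_loop (lab e) t" by blast
    have "x = Inner e t"
      using inj_onD[OF inj_on_chart[OF U(1)], of x "Inner e t"] x t by simp
    then show "x \<in> range (Inner e)" by simp
  qed
  ultimately show ?thesis using that by blast
qed

text \<open>The three kinds of points in \<open>vertex_nbhd\<close> fit the cases of
  \<open>tracks_at\<close>: shortly after leaving the vertex, shortly before arriving, and anywhere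
  on a loop, where both alternatives hold.\<close>

lemma tracks_hat:
  assumes f: "pathin (hat_space w) f"
  shows "tracks act {0..1} (q_map \<circ> f) (\<lambda>t. point_source (f t))"
  unfolding tracks_def
proof
  fix t0 :: real assume t0: "t0 \<in> {0..1}"
  have cf: "continuous_map (top_of_set {0..1}) (hat_space w) f" using f by (simp add: pathin_def)
  have pre: "openin (top_of_set {0..1}) {t \<in> {0..1}. f t \<in> W}" if "openin (hat_space w) W" for W
    using openin_continuous_map_preimage[OF cf that] by simp
  have ft0: "f t0 \<in> hat_points w"
    using continuous_map_image_subset_topspace[OF cf] t0 hat_space_props(1) by auto
  show "\<exists>U. openin (top_of_set {0..1}) U \<and> t0 \<in> U \<and>
      (\<forall>t\<in>U. tracks_at act (q_map \<circ> f) (\<lambda>t. point_source (f t)) t0 t)"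
  proof (cases "f t0")
    case (Vertex v)
    then have v: "v \<in> Gam_star w" using ft0 by (auto simp: hat_points_def)
    let ?U = "{t \<in> {0..1}. f t \<in> vertex_nbhd w v}"
    have "vertex_nbhd w v \<in> charts" using v by (simp add: charts_def)
    then have oU: "openin (top_of_set {0..1}) ?U" by (intro pre hat_space_props(2))
    have t0U: "t0 \<in> ?U" using t0 Vertex Vertex_vertex_nbhd[OF v] by simp
    have z: "(q_map \<circ> f) t0 = (0, 0)" using Vertex by simp
    have s0: "point_source (f t0) = v" using Vertex by (simp add: point_source_def)
    have "tracks_at act (q_map \<circ> f) (\<lambda>t. point_source (f t)) t0 t" if t: "t \<in> ?U" for t
      unfolding tracks_at_def if_P[OF z] s0
    proof (intro allI ballI impI)
      fix i :: nat and \<tau> assume i: "1 \<le> i" "\<tau> \<in> {0..<1}" "(q_map \<circ> f) t = circ_loop i \<tau>"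
      show "if \<tau> < 1/2 then point_source (f t) = v else act i (point_source (f t)) = v"
      proof (cases "f t")
        case V: (Vertex u)
        then have "u = v" using t Vertex_vertex_nbhd[OF v] by simp
        moreover have "\<tau> = 0" using circ_loop_eq_0[OF i(1), of \<tau>] i V by (cases "\<tau> = 0") auto
        ultimately show ?thesis using V by (simp add: point_source_def)
      next
        case (Inner e s)
        then have e: "e \<in> hat_edges w" "0 < s" "s < 1"
          and c: "src e = v \<and> s < 3/8 \<or> tgt e = v \<and> 5/8 < s \<or> src e = v \<and> nvert w v < lab e"
          using t Inner_vertex_nbhd[OF v] by auto
        obtain u k where u: "u \<in> Gam_star w" "1 \<le> k" "src e = u" "lab e = k" "tgt e = act k u"
          using hat_edgeE[OF e(1)] by metis
        have "k = i" "s = \<tau>" using circ_loop_eqD[OF u(2) i(1) e(2,3), of \<tau>] i Inner u(4) by auto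
        moreover have "point_source (f t) = u" using Inner u by (simp add: point_source_def)
        moreover have "tgt e = v" if "src e = v" "nvert w v < lab e"
          using loop_at(2)[OF e(1) v] that by blast
        ultimately show ?thesis using c u by (auto split: if_splits)
      qed
    qed
    then show ?thesis using oU t0U by (intro exI[of _ ?U]) blast
  next
    case (Inner e s)
    then have e: "e \<in> hat_edges w" "0 < s" "s < 1" using ft0 by (auto simp: hat_points_def)
    obtain W where W: "openin (hat_space w) W" "Inner e s \<in> W" "W \<subseteq> range (Inner e)"
      by (rule hat_point_nbhd_Inner[OF e])
    have nz: "(q_map \<circ> f) t0 \<noteq> (0, 0)" using q_map_Inner_neq_0[OF e] Inner by simp
    have "tracks_at act (q_map \<circ> f) (\<lambda>t. point_source (f t)) t0 t" if t: "t \<in> {t \<in> {0..1}. f t \<in> W}" for t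
    proof -
      obtain s' where "f t = Inner e s'" using t W(3) by blast
      then have "point_source (f t) = point_source (f t0)" using Inner by (simp add: point_source_def)
      then show ?thesis using nz unfolding tracks_at_def by simp
    qed
    moreover have "t0 \<in> {t \<in> {0..1}. f t \<in> W}" using t0 W(2) Inner by simp
    ultimately show ?thesis using pre[OF W(1)] by (intro exI[of _ "{t \<in> {0..1}. f t \<in> W}"]) blast
  qed
qed

text \<open>Only finitely many vertices are visited by a path, and almost all labels are loops at these. So a
  path has the same lift if the generators with large labels act trivially; this makes the lift an
  image of the lift to the tree cover.\<close>

definition trunc_act :: "nat \<Rightarrow> nat \<Rightarrow> word \<Rightarrow> word" where
  "trunc_act m i u = (if i \<le> m then act i u else u)"

lemma inj_on_trunc_act: "inj_on (trunc_act m i) (Gam_star w)"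
  by (auto simp: inj_on_def trunc_act_def dest: act_inj)

definition letter_act :: "letter \<Rightarrow> word \<Rightarrow> word" where
  "letter_act l u = (if snd l then act (fst l) u else (THE v. v \<in> Gam_star w \<and> act (fst l) v = u))"

lemma letter_act_inverse:
  assumes u: "u \<in> Gam_star w"
  shows "letter_act (i, False) u \<in> Gam_star w" "act i (letter_act (i, False) u) = u"
proof -
  obtain v where v: "v \<in> Gam_star w" "act i v = u" by (rule act_surj[OF u])
  have "letter_act (i, False) u = v"
    unfolding letter_act_def using v act_inj by (auto intro!: the_equality)
  then show "letter_act (i, False) u \<in> Gam_star w" "act i (letter_act (i, False) u) = u" using v by auto
qed

lemma letter_act_in: "u \<in> Gam_star w \<Longrightarrow> letter_act l u \<in> Gam_star w"
  using letter_act_inverse act_in by (cases l; cases "snd l") (auto simp: letter_act_def)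

definition word_act :: "word \<Rightarrow> word \<Rightarrow> word" where
  "word_act x u = fold letter_act x u"

lemma word_act_in: "u \<in> Gam_star w \<Longrightarrow> word_act x u \<in> Gam_star w"
  unfolding word_act_def by (induction x arbitrary: u) (auto intro: letter_act_in)

lemma word_act_snoc: "word_act (x @ [l]) u = letter_act l (word_act x u)"
  by (simp add: word_act_def)

text \<open>Cancelling a letter against its inverse does not change the action. So
  \<open>\<lambda>x. word_act x u\<close> is equivariant from the vertices of the tree to those of
  the graph, which is what \<open>tracks_map\<close> asks for.\<close>

lemma word_act_rmul:
  assumes u: "u \<in> Gam_star w"
  shows "word_act (rmul x (i, True)) u = act i (word_act x u)"
proof (rule rmul_cases[of x "(i, True)"])
  assume "rmul x (i, True) = x @ [(i, True)]"
  then show ?thesis by (simp add: word_act_snoc letter_act_def)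
next
  let ?y = "rmul x (i, True)"
  assume x: "x = ?y @ [inv_letter (i, True)]"
  have "word_act x u = letter_act (i, False) (word_act ?y u)"
    by (subst x) (simp add: word_act_snoc)
  then show ?thesis using letter_act_inverse(2)[OF word_act_in[OF u]] by simp
qed

lemma tracks_word_act:
  assumes "\<gamma> \<in> H_loops" "tree_lift m \<gamma> x" "u \<in> Gam_star w"
  shows "tracks (trunc_act m) {0..1} \<gamma> (\<lambda>t. word_act (edge_source (x t)) u)"
proof (rule tracks_map[OF tracks_lift(1)[OF assms(1,2)], of "\<lambda>x. word_act x u"])
  fix t :: real and i :: nat assume "t \<in> {0..1}" "1 \<le> i"
  show "word_act (free_act m i (edge_source (x t))) u = trunc_act m i (word_act (edge_source (x t)) u)"
    using word_act_rmul[OF assms(3)] by (simp add: free_act_def trunc_act_def)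
qed

lemma finite_act_preimage:
  assumes v: "v \<in> Gam_star w"
  shows "finite {u \<in> Gam_star w. \<exists>i\<ge>1. act i u = v}"
proof -
  have "u \<in> insert v ((\<lambda>i. rmul v (i, False)) ` E_set w v)" if u: "u \<in> Gam_star w" "act i u = v" for u i
  proof (cases "i \<in> E_set w u")
    case True
    then have "v = rmul u (i, True)" "i \<in> E_set w v"
      using u E_set_rmul_eq[OF u(1) True, of True] by (auto simp: act_def)
    then have "u = rmul v (i, False)"
      using rmul_rmul_inv[OF Gam_star_reduced[OF u(1)], of "(i, True)"] by simp
    then show ?thesis using \<open>i \<in> E_set w v\<close> by blast
  next
    case False
    then show ?thesis using u by (simp add: act_def)
  qed
  then have "{u \<in> Gam_star w. \<exists>i\<ge>1. act i u = v} \<subseteq> insert v ((\<lambda>i. rmul v (i, False)) ` E_set w v)" by blast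
  then show ?thesis using finite_E_set(1)[OF v] finite_subset by blast
qed

text \<open>\<open>m0\<close> bounds the labels of the tree edges at the finitely many vertices that
  \<open>f\<close> visits. For \<open>m\<close> beyond it, \<open>f\<close> follows the truncated
  action, as does the image of the lift to the tree; by uniqueness both end at the root.\<close>

lemma closed_lift_fixes_root:
  assumes f: "f \<in> loops_at (hat_space w) (Vertex [])"
  obtains m0 where "\<And>m x. m0 \<le> m \<Longrightarrow> tree_lift m (q_map \<circ> f) x \<Longrightarrow> word_act (edge_source (x 1)) [] = []"
proof -
  have p: "pathin (hat_space w) f" and f0: "f 0 = Vertex []" "f 1 = Vertex []"
    using f by (auto simp: loops_at_def)
  have cf: "continuous_map (top_of_set {0..1}) (hat_space w) f" using p by (simp add: pathin_def)
  have "continuous_map (top_of_set {0..1}) (top_of_set hawaiian) (q_map \<circ> f)"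
    by (rule continuous_map_compose[OF cf continuous_map_q_map])
  then have \<gamma>: "q_map \<circ> f \<in> H_loops" using f0 by (simp add: loops_at_def pathin_def)
  have ft: "f t \<in> hat_points w" if "t \<in> {0..1}" for t
    using continuous_map_image_subset_topspace[OF cf] that hat_space_props(1) by auto
  let ?g = "\<lambda>t. point_source (f t)"
  have g: "?g t \<in> Gam_star w" if "t \<in> {0..1}" for t using point_source_in[OF ft[OF that]] .
  have "finite (?g ` {0..1})"
    by (rule tracks_finite[OF compact_Icc _ tracks_hat[OF p] g finite_act_preimage])
      (use H_loopsD(2)[OF \<gamma>] in auto)
  then have fin: "finite (nvert w ` ?g ` {0..1})" by simp
  define m0 where "m0 = Max (nvert w ` ?g ` {0..1})"
  have "word_act (edge_source (x 1)) [] = []" if m: "m0 \<le> m" and x: "tree_lift m (q_map \<circ> f) x" for m x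
  proof -
    have "act i (?g t) = ?g t" if "t \<in> {0..1}" "m < i" for t i
    proof -
      have "nvert w (?g t) \<le> m0" unfolding m0_def using fin that(1) by (intro Max_ge) auto
      then show ?thesis using act_fixed[OF g[OF that(1)]] m that(2) by simp
    qed
    then have tg: "tracks (trunc_act m) {0..1} (q_map \<circ> f) ?g"
      using tracks_map[OF tracks_hat[OF p], of "\<lambda>v. v" "trunc_act m"] by (auto simp: trunc_act_def)
    have nil: "[] \<in> Gam_star w" using alternating_Gam_star[of 0] by (simp add: alternating_def)
    have "word_act (edge_source (x 1)) [] = ?g 1"
    proof (rule tracks_unique[OF _ _ tracks_word_act[OF \<gamma> x nil] _ tg g inj_on_trunc_act, of 0 1])
      show "word_act (edge_source (x 0)) [] = ?g 0"
        using tracks_lift(3)[OF \<gamma> x] f0 by (simp add: word_act_def point_source_def)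
    qed (use H_loopsD(2)[OF \<gamma>] word_act_in[OF nil] in auto)
    then show ?thesis using f0 by (simp add: point_source_def)
  qed
  then show ?thesis using that by blast
qed

end

section \<open>Lengths of lifts\<close>

text \<open>The chord depends only on the difference of the parameters, so a given change of the
  parameter moves the point by a fixed distance.\<close>

lemma dist_circ_loop:
  assumes "1 \<le> i"
  shows "dist (circ_loop i a) (circ_loop i b) = sqrt (2 - 2 * cos (2 * pi * (a - b))) / i"
proof -
  let ?A = "2 * pi * a" and ?B = "2 * pi * b"
  have "(dist (sin ?A / i) (sin ?B / i))\<^sup>2 + (dist ((1 - cos ?A) / i) ((1 - cos ?B) / i))\<^sup>2
      = ((sin ?A - sin ?B)\<^sup>2 + (cos ?A - cos ?B)\<^sup>2) / i\<^sup>2"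
  proof -
    have "sin ?A / i - sin ?B / i = (sin ?A - sin ?B) / i"
      "(1 - cos ?A) / i - (1 - cos ?B) / i = - (cos ?A - cos ?B) / i"
      by (simp_all add: diff_divide_distrib)
    then show ?thesis
      by (simp only: dist_real_def power2_abs power_divide power2_minus add_divide_distrib of_nat_power)
  qed
  also have "(sin ?A - sin ?B)\<^sup>2 + (cos ?A - cos ?B)\<^sup>2
      = ((sin ?A)\<^sup>2 + (cos ?A)\<^sup>2) + ((sin ?B)\<^sup>2 + (cos ?B)\<^sup>2) - 2 * (cos ?A * cos ?B + sin ?A * sin ?B)"
    by (simp only: power2_diff) (simp only: algebra_simps)
  also have "\<dots> = 2 - 2 * cos (?A - ?B)"
    by (simp only: sin_cos_squared_add cos_diff one_add_one)
  finally show ?thesis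
    using assms by (simp add: circ_loop_def dist_Pair_Pair real_sqrt_divide right_diff_distrib)
qed

lemma dist_letter_loop:
  assumes "1 \<le> fst l"
  shows "dist (letter_loop l a) (letter_loop l b) = sqrt (2 - 2 * cos (2 * pi * (a - b))) / fst l"
proof (cases "snd l")
  case True
  then show ?thesis using dist_circ_loop[OF assms] by (simp add: letter_loop_def)
next
  case False
  have "cos (2 * pi * ((1 - a) - (1 - b))) = cos (- (2 * pi * (a - b)))"
    by (rule arg_cong[where f = cos]) (simp add: algebra_simps)
  also have "\<dots> = cos (2 * pi * (a - b))" by (rule cos_minus)
  finally show ?thesis using False dist_circ_loop[OF assms, of "1 - a" "1 - b"] by (simp add: letter_loop_def)
qed

lemma tree_cover_lookup:
  assumes "(p, x) \<in> tree_cover m"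
  shows "0 \<le> Poly_Mapping.lookup x v" "Poly_Mapping.lookup x v \<le> 1"
  using assms by (cases rule: tree_cover_cases; simp add: lookup_vertex_vec lookup_edge_point)+

lemma tree_cover_keys:
  assumes "(p, x) \<in> tree_cover m" "v \<in> Poly_Mapping.keys x"
  shows "v \<noteq> [] \<and> v \<in> fword m"
  using assms(1)
proof (cases rule: tree_cover_cases)
  case (1 u i)
  then have "v \<noteq> [] \<and> prefix v u" using assms(2) by (simp add: in_keys_iff lookup_vertex_vec split: if_splits)
  then show ?thesis using 1 fword_prefix by auto
next
  case (2 u l s)
  then have "v \<noteq> [] \<and> (v = u @ [l] \<or> prefix v u)"
    using assms(2) by (auto simp: in_keys_iff lookup_edge_point split: if_splits)
  then show ?thesis using 2 fword_prefix[of "u @ [l]"] by auto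
qed

text \<open>Coordinates fill up from the root: a point that has entered an edge has passed all the
  edges before it.\<close>

lemma tree_cover_lookup_prefix:
  assumes "(p, x) \<in> tree_cover m" "0 < Poly_Mapping.lookup x v" "strict_prefix v' v" "v' \<noteq> []"
  shows "Poly_Mapping.lookup x v' = 1"
  using assms(1)
proof (cases rule: tree_cover_cases)
  case (1 u i)
  then have "prefix v u" using assms(2) by (simp add: lookup_vertex_vec split: if_splits)
  then have "prefix v' u" using assms(3) by (meson prefix_order.less_imp_le prefix_order.trans)
  then show ?thesis using 1 assms(4) by (simp add: lookup_vertex_vec)
next
  case (2 u l s)
  then have "v = u @ [l] \<or> prefix v u" using assms(2) by (simp add: lookup_edge_point split: if_splits)
  then have "prefix v' u"
  proof
    assume "v = u @ [l]"
    then show ?thesis using assms(3) by (auto simp: strict_prefix_def prefix_snoc)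
  next
    assume "prefix v u"
    then show ?thesis using assms(3) by (meson prefix_order.less_imp_le prefix_order.trans)
  qed
  moreover from this have "v' \<noteq> u @ [l]" using prefix_length_le by fastforce
  ultimately show ?thesis using 2 assms(4) by (simp add: lookup_edge_point)
qed

lemma tree_cover_fraction_unique:
  assumes "(p, x) \<in> tree_cover m" "0 < Poly_Mapping.lookup x v" "Poly_Mapping.lookup x v < 1"
    "0 < Poly_Mapping.lookup x v'" "Poly_Mapping.lookup x v' < 1"
  shows "v = v'"
proof -
  obtain u l where u: "v = u @ [l]" "x = vertex_vec u + Poly_Mapping.single v (Poly_Mapping.lookup x v)"
    using tree_cover_fraction[OF assms(1-3)] by metis
  then have "x = vertex_vec u + Poly_Mapping.single (u @ [l]) (Poly_Mapping.lookup x v)" by simp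
  then have "Poly_Mapping.lookup x v' =
      (if v' = u @ [l] then Poly_Mapping.lookup x v else if v' \<noteq> [] \<and> prefix v' u then 1 else 0)"
    by (metis lookup_edge_point)
  then show ?thesis using assms(4,5) u(1) by (auto split: if_splits)
qed

definition lifts :: "nat \<Rightarrow> (real \<Rightarrow> real \<times> real) \<Rightarrow> (real \<Rightarrow> word \<Rightarrow>\<^sub>0 real) \<Rightarrow> bool" where
  "lifts m \<gamma> x \<longleftrightarrow> continuous_on {0..1} x \<and> (\<forall>t\<in>{0..1}. (\<gamma> t, x t) \<in> tree_cover m)"

lemma lifts_ivt:
  assumes x: "lifts m \<gamma> x" and s: "s \<in> {0..1}" "s' \<in> {0..1}"
    and z: "Poly_Mapping.lookup (x s) v \<le> z" "z \<le> Poly_Mapping.lookup (x s') v"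
  obtains t where "t \<in> {min s s'..max s s'}" "Poly_Mapping.lookup (x t) v = z"
proof -
  let ?S = "{min s s'..max s s'}"
  have "continuous_on ?S (\<lambda>t. Poly_Mapping.lookup (x t) v)"
  proof -
    have "?S \<subseteq> {0..1}" using s by auto
    then have "continuous_on ?S x" using x continuous_on_subset unfolding lifts_def by blast
    then show ?thesis by (intro continuous_intros)
  qed
  then have "connected ((\<lambda>t. Poly_Mapping.lookup (x t) v) ` ?S)"
    by (rule connected_continuous_image) simp
  then have "z \<in> (\<lambda>t. Poly_Mapping.lookup (x t) v) ` ?S"
    by (rule connectedD_interval[OF _ _ _ z]) auto
  then show ?thesis using that by blast
qed

text \<open>The point is that \<open>d\<close> depends neither on \<open>m\<close> nor on the lift
  nor on the edge. While a coordinate is fractional it is the parameter of \<open>\<gamma>\<close>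
  on the circle \<open>i\<close>, so it cannot change faster than \<open>\<gamma>\<close> moves on
  that circle.\<close>

lemma lifts_equicontinuous:
  assumes \<gamma>: "continuous_on {0..1} \<gamma>" and i: "1 \<le> i" and e: "0 < e" "e < 1"
  obtains d where "0 < d" "\<And>m x s s' v. lifts m \<gamma> x \<Longrightarrow> s \<in> {0..1} \<Longrightarrow> s' \<in> {0..1} \<Longrightarrow> \<bar>s - s'\<bar> < d \<Longrightarrow>
    v \<noteq> [] \<Longrightarrow> fst (last v) = i \<Longrightarrow> \<bar>Poly_Mapping.lookup (x s) v - Poly_Mapping.lookup (x s') v\<bar> \<le> e"
proof -
  \<comment> \<open>The chord of the circle \<open>i\<close> over the parameter difference
    \<open>e / 2\<close>.\<close>
  let ?h = "sqrt (2 - 2 * cos (2 * pi * (e / 2))) / i"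
  have "cos (pi * e) < cos 0" using e by (intro cos_monotone_0_pi) auto
  then have h: "0 < ?h" using i by simp
  have "uniformly_continuous_on {0..1} \<gamma>" by (rule compact_uniformly_continuous[OF \<gamma> compact_Icc])
  then obtain d where d: "0 < d" "\<And>s s'. s \<in> {0..1} \<Longrightarrow> s' \<in> {0..1} \<Longrightarrow> dist s' s < d \<Longrightarrow> dist (\<gamma> s') (\<gamma> s) < ?h"
    using h unfolding uniformly_continuous_on_def by metis
  have *: "Poly_Mapping.lookup (x s') v - Poly_Mapping.lookup (x s) v \<le> e"
    if x: "lifts m \<gamma> x" and s: "s \<in> {0..1}" "s' \<in> {0..1}" "\<bar>s - s'\<bar> < d" and v: "v \<noteq> []" "fst (last v) = i"
    for m x s s' v
  proof (rule ccontr)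
    let ?a = "Poly_Mapping.lookup (x s) v" and ?b = "Poly_Mapping.lookup (x s') v"
    assume "\<not> ?b - ?a \<le> e"
    then have ab: "?a + e < ?b" by simp
    have E: "(\<gamma> t, x t) \<in> tree_cover m" if "t \<in> {0..1}" for t using x that by (simp add: lifts_def)
    have a0: "0 \<le> ?a" and b1: "?b \<le> 1" using tree_cover_lookup E s by blast+
    \<comment> \<open>The values \<open>?a + e / 4\<close> and \<open>?a + 3 * e / 4\<close> differ
      by \<open>e / 2\<close> and lie strictly between 0 and 1, where the coordinate determines
      \<open>\<gamma>\<close>.\<close>
    obtain t1 where t1: "t1 \<in> {min s s'..max s s'}" "Poly_Mapping.lookup (x t1) v = ?a + e / 4"
      by (rule lifts_ivt[OF x s(1,2), of v "?a + e / 4"]) (use ab e in auto)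
    obtain t2 where t2: "t2 \<in> {min s s'..max s s'}" "Poly_Mapping.lookup (x t2) v = ?a + 3 * e / 4"
      by (rule lifts_ivt[OF x s(1,2), of v "?a + 3 * e / 4"]) (use ab e in auto)
    have t12: "t1 \<in> {0..1}" "t2 \<in> {0..1}" "dist t1 t2 < d"
      using t1(1) t2(1) s by (auto simp: dist_real_def min_def max_def split: if_splits)
    have loc: "\<gamma> t = letter_loop (last v) (Poly_Mapping.lookup (x t) v)"
      if "t \<in> {0..1}" "0 < Poly_Mapping.lookup (x t) v" "Poly_Mapping.lookup (x t) v < 1" for t
      using tree_cover_fraction[OF E[OF that(1)] that(2,3)] by (metis last_snoc)
    have "\<gamma> t1 = letter_loop (last v) (?a + e / 4)" "\<gamma> t2 = letter_loop (last v) (?a + 3 * e / 4)"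
      using loc[OF t12(1)] loc[OF t12(2)] t1(2) t2(2) a0 b1 ab e by auto
    then have "dist (\<gamma> t2) (\<gamma> t1) = sqrt (2 - 2 * cos (2 * pi * ((?a + 3 * e / 4) - (?a + e / 4)))) / i"
      using dist_letter_loop[of "last v"] v(2) i by simp
    moreover have "(?a + 3 * e / 4) - (?a + e / 4) = e / 2" by simp
    ultimately have "dist (\<gamma> t2) (\<gamma> t1) = ?h" by (simp only:)
    moreover have "dist (\<gamma> t2) (\<gamma> t1) < ?h" using d(2)[OF t12(1,2)] t12(3) by (simp add: dist_commute)
    ultimately show False by simp
  qed
  show ?thesis
  proof (rule that[OF d(1)])
    fix m x s s' and v :: word
    assume a: "lifts m \<gamma> x" "s \<in> {0..1}" "s' \<in> {0..1}" "\<bar>s - s'\<bar> < d" "v \<noteq> []" "fst (last v) = i"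
    then show "\<bar>Poly_Mapping.lookup (x s) v - Poly_Mapping.lookup (x s') v\<bar> \<le> e"
      using *[OF a] *[OF a(1,3,2) _ a(5,6)] by (simp add: abs_minus_commute abs_le_iff)
  qed
qed

text \<open>Give the edge that ends at \<open>v\<close> the length \<open>h v\<close>. For points of
  the tree, \<open>wnorm h x\<close> is then the distance from the root and
  \<open>wnorm h (x - y)\<close> the distance between \<open>x\<close> and \<open>y\<close>.\<close>

definition wnorm :: "(word \<Rightarrow> real) \<Rightarrow> (word \<Rightarrow>\<^sub>0 real) \<Rightarrow> real" where
  "wnorm h z = (\<Sum>v\<in>Poly_Mapping.keys z. h v * \<bar>Poly_Mapping.lookup z v\<bar>)"

lemma wnorm_superset:
  "finite A \<Longrightarrow> Poly_Mapping.keys z \<subseteq> A \<Longrightarrow> wnorm h z = (\<Sum>v\<in>A. h v * \<bar>Poly_Mapping.lookup z v\<bar>)"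
  unfolding wnorm_def by (intro sum.mono_neutral_left) (auto simp: in_keys_iff)

lemma wnorm_triangle:
  assumes "\<And>v. 0 \<le> h v"
  shows "wnorm h (x + y) \<le> wnorm h x + wnorm h y"
proof -
  let ?A = "Poly_Mapping.keys x \<union> Poly_Mapping.keys y"
  have "wnorm h (x + y) = (\<Sum>v\<in>?A. h v * \<bar>Poly_Mapping.lookup (x + y) v\<bar>)"
    by (rule wnorm_superset) (auto simp: keys_add)
  also have "\<dots> \<le> (\<Sum>v\<in>?A. h v * \<bar>Poly_Mapping.lookup x v\<bar> + h v * \<bar>Poly_Mapping.lookup y v\<bar>)"
    using assms by (intro sum_mono) (simp add: lookup_add distrib_left[symmetric] mult_left_mono abs_triangle_ineq)
  also have "\<dots> = wnorm h x + wnorm h y"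
    using wnorm_superset[of ?A x h] wnorm_superset[of ?A y h] by (simp add: sum.distrib)
  finally show ?thesis .
qed

lemma wnorm_minus: "wnorm h (- x) = wnorm h x"
  by (simp add: wnorm_def)

lemma wnorm_nonneg: "(\<And>v. 0 \<le> h v) \<Longrightarrow> 0 \<le> wnorm h x"
  unfolding wnorm_def by (intro sum_nonneg) simp

lemma wnorm_component:
  assumes "\<And>v. 0 \<le> h v"
  shows "h v * \<bar>Poly_Mapping.lookup x v\<bar> \<le> wnorm h x"
proof -
  have "wnorm h x = (\<Sum>v\<in>insert v (Poly_Mapping.keys x). h v * \<bar>Poly_Mapping.lookup x v\<bar>)"
    by (rule wnorm_superset) auto
  also have "h v * \<bar>Poly_Mapping.lookup x v\<bar> \<le> \<dots>"
    using assms by (intro member_le_sum) auto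
  finally show ?thesis .
qed

text \<open>With this weight \<open>wnorm\<close> measures the part of a geodesic on edges with
  label \<open>i\<close>, each of length one.\<close>

definition label_weight :: "nat \<Rightarrow> word \<Rightarrow> real" where
  "label_weight i v = (if v \<noteq> [] \<and> fst (last v) = i then 1 else 0)"

lemma wnorm_by_label:
  assumes "\<And>v. v \<in> Poly_Mapping.keys z \<Longrightarrow> v \<noteq> [] \<and> fst (last v) \<in> {1..m}"
  shows "wnorm (\<lambda>v. c (fst (last v))) z = (\<Sum>i=1..m. c i * wnorm (label_weight i) z)"
proof -
  have "(\<Sum>i=1..m. c i * wnorm (label_weight i) z)
      = (\<Sum>v\<in>Poly_Mapping.keys z. \<Sum>i=1..m. c i * (label_weight i v * \<bar>Poly_Mapping.lookup z v\<bar>))"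
    unfolding wnorm_def sum_distrib_left by (rule sum.swap)
  also have "\<dots> = wnorm (\<lambda>v. c (fst (last v))) z"
    unfolding wnorm_def
  proof (rule sum.cong[OF refl])
    fix v assume v: "v \<in> Poly_Mapping.keys z"
    have "(\<Sum>i=1..m. c i * (label_weight i v * \<bar>Poly_Mapping.lookup z v\<bar>))
        = (\<Sum>i=1..m. if i = fst (last v) then c i * \<bar>Poly_Mapping.lookup z v\<bar> else 0)"
      using assms[OF v] by (intro sum.cong refl) (auto simp: label_weight_def)
    also have "\<dots> = c (fst (last v)) * \<bar>Poly_Mapping.lookup z v\<bar>"
      using assms[OF v] by (simp add: sum.delta)
    finally show "(\<Sum>i=1..m. c i * (label_weight i v * \<bar>Poly_Mapping.lookup z v\<bar>))
        = c (fst (last v)) * \<bar>Poly_Mapping.lookup z v\<bar>" .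
  qed
  finally show ?thesis by simp
qed

text \<open>A coordinate that is 0 or 1 at both points cannot differ by a positive amount below 1,
  and each point has at most one fractional coordinate. So at most two coordinates
  contribute.\<close>

lemma wnorm_label_le:
  assumes x: "(p, x) \<in> tree_cover m" and y: "(p', y) \<in> tree_cover m" and e: "0 < e" "e < 1"
    and d: "\<And>v. v \<noteq> [] \<Longrightarrow> fst (last v) = i \<Longrightarrow> \<bar>Poly_Mapping.lookup x v - Poly_Mapping.lookup y v\<bar> \<le> e"
  shows "wnorm (label_weight i) (x - y) \<le> 2 * e"
proof -
  let ?fr = "\<lambda>x v. 0 < Poly_Mapping.lookup x v \<and> Poly_Mapping.lookup x v < (1::real)"
  let ?F = "{v. ?fr x v} \<union> {v. ?fr y v}"
  let ?t = "\<lambda>v. label_weight i v * \<bar>Poly_Mapping.lookup (x - y) v\<bar>"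
  have one: "\<exists>v. {v. ?fr z v} \<subseteq> {v}" if "(q, z) \<in> tree_cover m" for q z
  proof (cases "\<exists>v. ?fr z v")
    case True
    then obtain v where "?fr z v" by blast
    then have "{v. ?fr z v} \<subseteq> {v}" using tree_cover_fraction_unique[OF that] by blast
    then show ?thesis by blast
  next
    case False
    then have "{v. ?fr z v} \<subseteq> {[]}" by blast
    then show ?thesis by blast
  qed
  obtain v1 v2 where v12: "?F \<subseteq> {v1, v2}" using one[OF x] one[OF y] by blast
  have le: "?t v \<le> e" for v
    using d[of v] e by (auto simp: label_weight_def lookup_minus)
  have zero: "?t v = 0" if "v \<notin> {v1, v2}" for v
  proof (rule ccontr)
    assume nz: "?t v \<noteq> 0"
    then have v: "v \<noteq> []" "fst (last v) = i" "Poly_Mapping.lookup x v \<noteq> Poly_Mapping.lookup y v"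
      by (auto simp: label_weight_def lookup_minus split: if_splits)
    have "v \<notin> ?F" using that v12 by blast
    then have "Poly_Mapping.lookup x v \<in> {0, 1}" "Poly_Mapping.lookup y v \<in> {0, 1}"
      using tree_cover_lookup[OF x, of v] tree_cover_lookup[OF y, of v] by auto
    then have "\<bar>Poly_Mapping.lookup x v - Poly_Mapping.lookup y v\<bar> = 1" using v(3) by auto
    then show False using d[OF v(1,2)] e by simp
  qed
  let ?A = "Poly_Mapping.keys (x - y) \<union> {v1, v2}"
  have "wnorm (label_weight i) (x - y) = (\<Sum>v\<in>?A. ?t v)" by (rule wnorm_superset) auto
  also have "\<dots> = (\<Sum>v\<in>{v1, v2}. ?t v)" using zero by (intro sum.mono_neutral_right) auto
  also have "\<dots> \<le> (\<Sum>v\<in>{v1, v2}. e)" using le by (intro sum_mono) blast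
  also have "\<dots> \<le> 2 * e" using e by (cases "v1 = v2") auto
  finally show ?thesis .
qed

text \<open>The bound is uniform in \<open>m\<close> and in the lift. The way from \<open>s'\<close>
  to \<open>s\<close> is cut into \<open>n\<close> pieces shorter than the modulus for 1/2; each
  contributes at most \<open>2 * (1/2)\<close>, so \<open>n\<close> itself serves as the
  bound.\<close>

lemma wnorm_label_bounded:
  assumes \<gamma>: "continuous_on {0..1} \<gamma>" and i: "1 \<le> i"
  obtains N where "1 \<le> N" "\<And>m x s s'. lifts m \<gamma> x \<Longrightarrow> s \<in> {0..1} \<Longrightarrow> s' \<in> {0..1} \<Longrightarrow>
    wnorm (label_weight i) (x s - x s') \<le> N"
proof -
  obtain d where d: "0 < d" "\<And>m x s s' v. lifts m \<gamma> x \<Longrightarrow> s \<in> {0..1} \<Longrightarrow> s' \<in> {0..1} \<Longrightarrow> \<bar>s - s'\<bar> < d \<Longrightarrow>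
      v \<noteq> [] \<Longrightarrow> fst (last v) = i \<Longrightarrow> \<bar>Poly_Mapping.lookup (x s) v - Poly_Mapping.lookup (x s') v\<bar> \<le> 1/2"
    by (rule lifts_equicontinuous[OF \<gamma> i, of "1/2"]) auto
  obtain n :: nat where n: "1 / d < n" using reals_Archimedean2 by blast
  then have n0: "0 < n" using d(1) by (metis divide_pos_pos gr0I less_asym of_nat_0 zero_less_one)
  have "wnorm (label_weight i) (x s - x s') \<le> n"
    if x: "lifts m \<gamma> x" and s: "s \<in> {0..1}" "s' \<in> {0..1}" for m x s s'
  proof -
    define p where "p k = s' + (k / n) * (s - s')" for k :: nat
    have p01: "p k \<in> {0..1}" if "k \<le> n" for k
    proof -
      define c where "c = k / n"
      have c: "0 \<le> c" "c \<le> 1" using that n0 by (simp_all add: c_def)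
      have "p k = (1 - c) *\<^sub>R s' + c *\<^sub>R s" by (simp add: p_def c_def[symmetric] algebra_simps)
      then show ?thesis using convexD_alt[OF convex_real_interval(5) s(2,1) c] by simp
    qed
    have nd: "1 / n < d" using n n0 d(1) by (simp add: field_simps)
    have "wnorm (label_weight i) (x (p k) - x s') \<le> k" if "k \<le> n" for k
      using that
    proof (induction k)
      case 0
      then show ?case by (simp add: p_def wnorm_def)
    next
      case (Suc k)
      then have k: "p (Suc k) \<in> {0..1}" "p k \<in> {0..1}" using p01 by auto
      have "p (Suc k) - p k = (s - s') / n" by (simp add: p_def add_divide_distrib algebra_simps)
      moreover have "\<bar>s - s'\<bar> \<le> 1" using s by auto
      ultimately have "\<bar>p (Suc k) - p k\<bar> \<le> 1 / n"
        using divide_right_mono[of "\<bar>s - s'\<bar>" 1 "real n"] by simp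
      then have near: "\<bar>p (Suc k) - p k\<bar> < d" using nd by simp
      have "wnorm (label_weight i) (x (p (Suc k)) - x (p k)) \<le> 2 * (1/2)"
      proof (rule wnorm_label_le)
        show "(\<gamma> (p (Suc k)), x (p (Suc k))) \<in> tree_cover m" "(\<gamma> (p k), x (p k)) \<in> tree_cover m"
          using x k unfolding lifts_def by blast+
        show "\<bar>Poly_Mapping.lookup (x (p (Suc k))) v - Poly_Mapping.lookup (x (p k)) v\<bar> \<le> 1/2"
          if "v \<noteq> []" "fst (last v) = i" for v
          by (rule d(2)[OF x k near that])
      qed simp_all
      moreover have "wnorm (label_weight i) (x (p (Suc k)) - x s')
          \<le> wnorm (label_weight i) (x (p (Suc k)) - x (p k)) + wnorm (label_weight i) (x (p k) - x s')"
        using wnorm_triangle[of "label_weight i" "x (p (Suc k)) - x (p k)" "x (p k) - x s'"]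
        by (simp add: label_weight_def)
      ultimately show ?case using Suc by simp
    qed
    from this[of n] show ?thesis using n0 by (simp add: p_def)
  qed
  then show ?thesis using that[of "real n"] n0 by simp
qed

text \<open>At a time \<open>r\<close> of least distance from the root, \<open>x r\<close> lies on
  the geodesic from the root to every other point of the lift over the interval, so the distance is
  a difference of heights. Otherwise some coordinate would fall below its value at \<open>r\<close>,
  and on the way the lift would come closer to the root.\<close>

lemma wnorm_min_le:
  assumes x: "lifts m \<gamma> x" and ab: "0 \<le> a" "b \<le> 1" and r: "r \<in> {a..b}"
    and h: "\<And>v. 0 < h v" and min: "\<And>t. t \<in> {a..b} \<Longrightarrow> wnorm h (x r) \<le> wnorm h (x t)"
    and t: "t \<in> {a..b}"
  shows "wnorm h (x t - x r) = wnorm h (x t) - wnorm h (x r)"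
proof -
  have E: "(\<gamma> t, x t) \<in> tree_cover m" if "t \<in> {a..b}" for t using x that ab by (simp add: lifts_def)
  have le: "Poly_Mapping.lookup (x r) v \<le> Poly_Mapping.lookup (x t) v" for v
  proof (rule ccontr)
    let ?p = "Poly_Mapping.lookup (x t) v" and ?q = "Poly_Mapping.lookup (x r) v"
    assume "\<not> ?q \<le> ?p"
    then have pq: "?p < ?q" by simp
    have b: "0 \<le> ?p" "?q \<le> 1" using tree_cover_lookup[OF E[OF t]] tree_cover_lookup[OF E[OF r]] by auto
    \<comment> \<open>A value between the two is fractional, so at time \<open>t'\<close> the lift
      lies inside the edge \<open>v\<close>, on the geodesic from the root to \<open>x r\<close> and
      strictly before \<open>x r\<close>.\<close>
    define z where "z = (?p + ?q) / 2"
    have z: "0 < z" "z < 1" "?p \<le> z" "z < ?q" using pq b by (auto simp: z_def)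
    obtain t' where t': "t' \<in> {min t r..max t r}" "Poly_Mapping.lookup (x t') v = z"
      by (rule lifts_ivt[OF x, of t r v z]) (use t r ab z in auto)
    have t'ab: "t' \<in> {a..b}" using t'(1) t r by (auto simp: min_def max_def split: if_splits)
    obtain u l where u: "v = u @ [l]" "x t' = vertex_vec u + Poly_Mapping.single v z"
      using tree_cover_fraction[OF E[OF t'ab], of v] t'(2) z by metis
    let ?A = "Poly_Mapping.keys (x t') \<union> Poly_Mapping.keys (x r) \<union> {v}"
    have l': "Poly_Mapping.lookup (x t') v' = (if v' = v then z else if v' \<noteq> [] \<and> prefix v' u then 1 else 0)" for v'
      unfolding u(2) unfolding u(1) by (rule lookup_edge_point)
    have lev: "Poly_Mapping.lookup (x t') v' \<le> Poly_Mapping.lookup (x r) v'" for v'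
    proof -
      consider "v' = v" | "v' \<noteq> v" "v' \<noteq> []" "prefix v' u" | "v' \<noteq> v" "\<not> (v' \<noteq> [] \<and> prefix v' u)" by blast
      then show ?thesis
      proof cases
        case 1
        then show ?thesis using l' z by simp
      next
        case 2
        have "strict_prefix v' v" using 2 u(1) by (auto simp: strict_prefix_def)
        then have "Poly_Mapping.lookup (x r) v' = 1"
          using tree_cover_lookup_prefix[OF E[OF r], of v v'] pq b 2 by simp
        then show ?thesis using l' 2 by simp
      next
        case 3
        then have "Poly_Mapping.lookup (x t') v' = 0" using l' by auto
        then show ?thesis using tree_cover_lookup[OF E[OF r]] by simp
      qed
    qed
    have nn: "0 \<le> Poly_Mapping.lookup (x t') v'" for v' using tree_cover_lookup[OF E[OF t'ab]] by simp
    have "wnorm h (x t') = (\<Sum>v\<in>?A. h v * \<bar>Poly_Mapping.lookup (x t') v\<bar>)" by (rule wnorm_superset) auto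
    also have "\<dots> < (\<Sum>v\<in>?A. h v * \<bar>Poly_Mapping.lookup (x r) v\<bar>)"
    proof (rule sum_strict_mono_ex1)
      show "finite ?A" by simp
      show "\<forall>v\<in>?A. h v * \<bar>Poly_Mapping.lookup (x t') v\<bar> \<le> h v * \<bar>Poly_Mapping.lookup (x r) v\<bar>"
      proof
        fix v' assume "v' \<in> ?A"
        have "\<bar>Poly_Mapping.lookup (x t') v'\<bar> \<le> \<bar>Poly_Mapping.lookup (x r) v'\<bar>" using nn[of v'] lev[of v'] by simp
        then show "h v' * \<bar>Poly_Mapping.lookup (x t') v'\<bar> \<le> h v' * \<bar>Poly_Mapping.lookup (x r) v'\<bar>"
          using h[of v'] by (intro mult_left_mono) simp_all
      qed
      show "\<exists>v\<in>?A. h v * \<bar>Poly_Mapping.lookup (x t') v\<bar> < h v * \<bar>Poly_Mapping.lookup (x r) v\<bar>"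
        using z h[of v] t'(2) by (intro bexI[of _ v]) auto
    qed
    also have "\<dots> = wnorm h (x r)" by (rule wnorm_superset[symmetric]) auto
    finally show False using min[OF t'ab] by simp
  qed
  let ?A = "Poly_Mapping.keys (x t) \<union> Poly_Mapping.keys (x r)"
  have "wnorm h (x t - x r) = (\<Sum>v\<in>?A. h v * \<bar>Poly_Mapping.lookup (x t - x r) v\<bar>)"
    by (rule wnorm_superset) (auto simp: keys_diff)
  also have "\<dots> = (\<Sum>v\<in>?A. h v * \<bar>Poly_Mapping.lookup (x t) v\<bar> - h v * \<bar>Poly_Mapping.lookup (x r) v\<bar>)"
  proof (rule sum.cong[OF refl])
    fix v assume "v \<in> ?A"
    have "0 \<le> Poly_Mapping.lookup (x r) v" using tree_cover_lookup[OF E[OF r]] by simp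
    then show "h v * \<bar>Poly_Mapping.lookup (x t - x r) v\<bar> =
        h v * \<bar>Poly_Mapping.lookup (x t) v\<bar> - h v * \<bar>Poly_Mapping.lookup (x r) v\<bar>"
      using le[of v] by (simp add: lookup_minus right_diff_distrib)
  qed
  also have "\<dots> = wnorm h (x t) - wnorm h (x r)"
    using wnorm_superset[of ?A "x t" h] wnorm_superset[of ?A "x r" h] by (simp add: sum_subtractf)
  finally show ?thesis .
qed

section \<open>Null-homotopic loops\<close>

text \<open>The points of the tree coded by \<open>f\<close> are classes of times. At stage \<open>s\<close> of the contraction along
  geodesics to the root, the point \<open>t\<close> has moved to the last time \<open>u\<close> before \<open>t\<close> at height \<open>min s (f t)\<close>.
  The homotopy is continuous because it is single-valued and the relation between \<open>(s, t)\<close> and \<open>u\<close> is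
  compact.\<close>

lemma null_homotopic_if_coded_by_tree:
  fixes \<gamma> :: "real \<Rightarrow> 'a::metric_space"
  assumes \<gamma>: "\<gamma> \<in> loops_at (top_of_set X) x0" and f: "continuous_on {0..1} f" "f 0 = 0" "f 1 = 0"
    and f01: "\<And>t. t \<in> {0..1} \<Longrightarrow> 0 \<le> f t \<and> f t \<le> (1::real)"
    and code: "\<And>s t. 0 \<le> s \<Longrightarrow> s < t \<Longrightarrow> t \<le> 1 \<Longrightarrow> f s = f t \<Longrightarrow> (\<And>v. v \<in> {s..t} \<Longrightarrow> f s \<le> f v) \<Longrightarrow> \<gamma> s = \<gamma> t"
  shows "loop_homotopic (top_of_set X) x0 (\<lambda>_. x0) \<gamma>"
proof -
  have c\<gamma>: "continuous_on {0..1} \<gamma>" and \<gamma>X: "\<And>t. t \<in> {0..1} \<Longrightarrow> \<gamma> t \<in> X" and \<gamma>01: "\<gamma> 0 = x0" "\<gamma> 1 = x0"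
    using \<gamma> by (auto simp: loops_at_def pathin_def)
  define R where "R z u \<longleftrightarrow> u \<in> {0..snd z} \<and> f u = min (fst z) (f (snd z)) \<and>
      (\<forall>v\<in>{u..snd z}. min (fst z) (f (snd z)) \<le> f v)" for z u
  let ?S = "{0..1} \<times> {0..1} :: (real \<times> real) set"
  have uniq: "\<gamma> u = \<gamma> u'" if R: "R z u" "R z u'" and z: "z \<in> ?S" for z u u'
  proof -
    have z1: "snd z \<le> 1" using z by auto
    have *: "\<gamma> u = \<gamma> u'" if a: "R z u" "R z u'" "u < u'" for u u'
    proof -
      have u: "0 \<le> u" "f u = min (fst z) (f (snd z))" "\<And>v. v \<in> {u..snd z} \<Longrightarrow> min (fst z) (f (snd z)) \<le> f v"
        using a(1) unfolding R_def by auto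
      have u': "u' \<le> snd z" "f u' = min (fst z) (f (snd z))" using a(2) unfolding R_def by auto
      show ?thesis
      proof (rule code[OF u(1) a(3)])
        show "u' \<le> 1" using u'(1) z1 by (rule order_trans)
        show "f u = f u'" unfolding u(2) u'(2) ..
        show "f u \<le> f v" if "v \<in> {u..u'}" for v
          unfolding u(2) by (rule u(3)) (use that u'(1) in auto)
      qed
    qed
    show ?thesis
    proof (cases u u' rule: linorder_cases)
      case less
      then show ?thesis by (rule *[OF R])
    next
      case greater
      then show ?thesis by (rule *[OF R(2,1), symmetric])
    qed simp
  qed
  have ex: "\<exists>u. R z u" if z: "z \<in> ?S" for z
  proof -
    obtain s t where st: "z = (s, t)" "0 \<le> s" "s \<le> 1" "0 \<le> t" "t \<le> 1" using z by auto
    show ?thesis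
    proof (cases "f t \<le> s")
      case True
      then have "R z t" using st by (auto simp: R_def)
      then show ?thesis by blast
    next
      case False
      let ?A = "{0..t} \<inter> f -` {..s}"
      have ct: "continuous_on {0..t} f" using f(1) st by (auto intro: continuous_on_subset)
      have "closed ?A" by (rule continuous_closed_preimage[OF ct]) auto
      then have "compact ({0..t} \<inter> ?A)" by (intro compact_Int_closed compact_Icc)
      then have "compact ?A" by (simp add: Int_absorb1 Int_assoc[symmetric])
      moreover have "0 \<in> ?A" using st f(2) by simp
      ultimately obtain u where u: "u \<in> ?A" "\<And>v. v \<in> ?A \<Longrightarrow> v \<le> u"
        using compact_attains_sup[of ?A] by blast
      have gt: "s < f v" if "v \<in> {u<..t}" for v
        using u(2)[of v] that u(1) by (cases "f v \<le> s") auto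
      have "f u = s"
      proof (rule ccontr)
        assume "f u \<noteq> s"
        then have "f u < s" using u(1) by simp
        have "continuous_on {u..t} f" using ct u(1) by (auto intro: continuous_on_subset)
        then obtain v where v: "u \<le> v" "v \<le> t" "f v = s"
          using IVT'[of f u s t] \<open>f u < s\<close> False u(1) by auto
        then show False using u(2)[of v] u(1) \<open>f u < s\<close> by (cases "u = v") auto
      qed
      then have "R z u" using u(1) gt False st by (auto simp: R_def less_imp_le) (metis greaterThanAtMost_iff less_imp_le order_le_less)
      then show ?thesis by blast
    qed
  qed
  define h where "h z = \<gamma> (SOME u. R z u)" for z
  have h: "h z = \<gamma> u" if "R z u" "z \<in> ?S" for z u
    unfolding h_def using uniq[OF someI[of "R z"] that(1) that(2)] that(1) by blast
  have R01: "u \<in> {0..1}" if "R z u" "z \<in> ?S" for z u using that by (auto simp: R_def mem_Times_iff)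
  have hX: "h z \<in> X" if zS: "z \<in> ?S" for z
  proof -
    obtain u where u: "R z u" using ex[OF zS] by blast
    show ?thesis using h[OF u zS] \<gamma>X[OF R01[OF u zS]] by simp
  qed
  have "continuous_on ?S h"
  proof (rule continuous_on_closed_vimage[THEN iffD2, rule_format])
    show "closed ?S" by (intro closed_Times closed_atLeastAtMost)
    fix B :: "'a set" assume B: "closed B"
    let ?T = "?S \<times> {0..1::real}"
    let ?m = "\<lambda>z. min (fst (fst z)) (f (snd (fst z)))"
    let ?K1 = "?T \<inter> (\<lambda>z. snd (fst z) - snd z) -` {0..}"
    let ?K2 = "?T \<inter> (\<lambda>z. f (snd z) - ?m z) -` {0}"
    \<comment> \<open>The condition on all times from \<open>u\<close> to \<open>t\<close> becomes
      one closed condition for each proportion \<open>c\<close>; \<open>max 0\<close> keeps the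
      argument in \<open>{0..1}\<close> where \<open>u\<close> exceeds \<open>t\<close>.\<close>
    let ?K3 = "\<lambda>c. ?T \<inter> (\<lambda>z. f (snd z + c * max 0 (snd (fst z) - snd z)) - ?m z) -` {0..}"
    let ?K4 = "?T \<inter> (\<lambda>z. \<gamma> (snd z)) -` B"
    have cT: "closed ?T" by (intro closed_Times closed_atLeastAtMost)
    have mid: "u + c * max 0 (t - u) \<in> {0..1}" if "u \<in> {0..1}" "t \<in> {0..1}" "c \<in> {0..1}" for u t c :: real
    proof (cases "u \<le> t")
      case True
      have "c * (t - u) \<le> 1 * (t - u)" using that True by (intro mult_right_mono) auto
      moreover have "0 \<le> c * (t - u)" using that True by simp
      ultimately show ?thesis using that True by auto
    next
      case False
      then show ?thesis using that by simp
    qed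
    have cf: "continuous_on ?T (\<lambda>z. f (snd z))" "continuous_on ?T (\<lambda>z. f (snd (fst z)))"
      by (rule continuous_on_compose2[OF f(1)]; force intro!: continuous_intros)+
    have K12: "closed ?K1" "closed ?K2"
      by (intro continuous_closed_preimage[OF _ cT] continuous_intros cf closed_atLeast closed_singleton)+
    have K4: "closed ?K4"
      by (intro continuous_closed_preimage[OF _ cT B] continuous_on_compose2[OF c\<gamma>] continuous_intros) auto
    have "closed (?K3 c)" if c: "c \<in> {0..1}" for c
    proof -
      have "continuous_on ?T (\<lambda>z. f (snd z + c * max 0 (snd (fst z) - snd z)))"
        by (rule continuous_on_compose2[OF f(1)]) (use mid c in \<open>auto intro!: continuous_intros\<close>)
      then show ?thesis by (intro continuous_closed_preimage[OF _ cT] continuous_intros cf closed_atLeast)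
    qed
    then have "closed (\<Inter>c\<in>{0..1}. ?K3 c)" by (intro closed_INT ballI)
    then have "closed (?K1 \<inter> ?K2 \<inter> (\<Inter>c\<in>{0..1}. ?K3 c) \<inter> ?K4)"
      by (rule closed_Int[OF closed_Int[OF closed_Int[OF K12]] K4])
    moreover have "compact ?T" by (intro compact_Times compact_Icc)
    ultimately have "compact (?T \<inter> (?K1 \<inter> ?K2 \<inter> (\<Inter>c\<in>{0..1}. ?K3 c) \<inter> ?K4))"
      by (rule compact_Int_closed[rotated])
    then have "compact (fst ` (?T \<inter> (?K1 \<inter> ?K2 \<inter> (\<Inter>c\<in>{0..1}. ?K3 c) \<inter> ?K4)))"
      by (rule compact_continuous_image[rotated]) (intro continuous_intros)
    moreover have "fst ` (?T \<inter> (?K1 \<inter> ?K2 \<inter> (\<Inter>c\<in>{0..1}. ?K3 c) \<inter> ?K4)) = h -` B \<inter> ?S"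
    proof (intro equalityI subsetI)
      fix z assume "z \<in> fst ` (?T \<inter> (?K1 \<inter> ?K2 \<inter> (\<Inter>c\<in>{0..1}. ?K3 c) \<inter> ?K4))"
      then obtain u where zu: "(z, u) \<in> ?T" "(z, u) \<in> ?K1" "(z, u) \<in> ?K2" "(z, u) \<in> ?K4"
        and K3: "\<And>c. c \<in> {0..1} \<Longrightarrow> (z, u) \<in> ?K3 c" by force
      have u: "0 \<le> u" "u \<le> snd z" and zS: "z \<in> ?S" using zu(1,2) by auto
      have "min (fst z) (f (snd z)) \<le> f v" if v: "v \<in> {u..snd z}" for v
      proof (cases "u = snd z")
        case True
        then show ?thesis using v zu(3) by auto
      next
        case False
        let ?c = "(v - u) / (snd z - u)"
        have "?c \<in> {0..1}" using v u False by (auto simp: divide_le_eq)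
        from K3[OF this] show ?thesis using v u False by simp
      qed
      then have "R z u" using u zu(3) by (auto simp: R_def)
      then show "z \<in> h -` B \<inter> ?S" using h zS zu(4) by auto
    next
      fix z assume z: "z \<in> h -` B \<inter> ?S"
      then have zS: "z \<in> ?S" by blast
      obtain u where u: "R z u" using ex[OF zS] by blast
      have u01: "u \<in> {0..1}" by (rule R01[OF u zS])
      have T: "(z, u) \<in> ?T" using zS u01 by simp
      have K3: "(z, u) \<in> ?K3 c" if c: "c \<in> {0..1}" for c
      proof -
        have ut: "u \<le> snd z" using u by (simp add: R_def)
        have "c * (snd z - u) \<le> 1 * (snd z - u)" using c ut by (intro mult_right_mono) auto
        moreover have "0 \<le> c * (snd z - u)" using c ut by simp
        ultimately have "u + c * (snd z - u) \<in> {u..snd z}" by simp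
        then have "min (fst z) (f (snd z)) \<le> f (u + c * (snd z - u))" using u unfolding R_def by blast
        then show ?thesis using T ut by simp
      qed
      have "(z, u) \<in> ?K1 \<inter> ?K2 \<inter> ?K4"
        using T u h[OF u zS] z by (simp add: R_def)
      then have "(z, u) \<in> ?T \<inter> (?K1 \<inter> ?K2 \<inter> (\<Inter>c\<in>{0..1}. ?K3 c) \<inter> ?K4)" using K3 T by blast
      then show "z \<in> fst ` (?T \<inter> (?K1 \<inter> ?K2 \<inter> (\<Inter>c\<in>{0..1}. ?K3 c) \<inter> ?K4))" by (rule rev_image_eqI) simp
    qed
    ultimately show "closed (h -` B \<inter> ?S)" by (simp add: compact_imp_closed)
  qed
  then have "continuous_map (top_of_set ?S) (top_of_set X) h"
    using hX by (auto simp: continuous_map_in_subtopology)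
  then have ch: "continuous_map (prod_topology (top_of_set {0..1}) (top_of_set {0..1})) (top_of_set X) h"
    by (simp add: prod_topology_subtopology_eu)
  have h0: "h (0, t) = x0" if t: "t \<in> {0..1}" for t
  proof -
    have z: "(0, t) \<in> ?S" using t by simp
    obtain u where u: "R (0, t) u" using ex[OF z] by blast
    have u': "u \<in> {0..1}" "f u = 0" using R01[OF u z] u f01[OF t] by (auto simp: R_def)
    have "\<gamma> 0 = \<gamma> u"
    proof (cases "u = 0")
      case False
      then show ?thesis by (intro code) (use u' f(2) f01 in auto)
    qed simp
    then show ?thesis using h[OF u z] \<gamma>01 by simp
  qed
  have h1: "h (1, t) = \<gamma> t" if t: "t \<in> {0..1}" for t
    by (rule h) (use t f01[OF t] in \<open>auto simp: R_def\<close>)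
  have hs: "h (s, 0) = x0" "h (s, 1) = x0" if s: "s \<in> {0..1}" for s
  proof -
    have "R (s, 0) 0" "R (s, 1) 1" using s f by (auto simp: R_def)
    then show "h (s, 0) = x0" "h (s, 1) = x0" using h s \<gamma>01 by auto
  qed
  have "homotopic_with (\<lambda>h. h 0 = x0 \<and> h 1 = x0) (top_of_set {0..1}) (top_of_set X) (\<lambda>_. x0) \<gamma>"
    by (subst homotopic_with) (use ch h0 h1 hs in \<open>auto intro!: exI[of _ h]\<close>)
  then show ?thesis by (simp add: loop_homotopic_def)
qed

section \<open>Loops whose lifts to all tree covers are closed\<close>

lemma tree_lift_lifts: "tree_lift m \<gamma> x \<Longrightarrow> lifts m \<gamma> x"
  by (simp add: tree_lift_def lifts_def)

text \<open>The bounds on \<open>e\<close> keep the coordinate of \<open>y\<close> on the edge of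
  \<open>x\<close> fractional, and a fractional coordinate is the parameter of the image on the
  circle, up to orientation.\<close>

lemma arc_determined_by_coordinate:
  assumes x: "(p, x) \<in> tree_cover m" and y: "(q, y) \<in> tree_cover m"
    and p: "p = circ_loop i \<tau>" "1 \<le> i" "i \<le> m" "0 < \<tau>" "\<tau> < 1" and e: "e < \<tau>" "e < 1 - \<tau>"
    and close: "\<And>v. v \<noteq> [] \<Longrightarrow> fst (last v) = i \<Longrightarrow> \<bar>Poly_Mapping.lookup x v - Poly_Mapping.lookup y v\<bar> \<le> e"
  obtains \<tau>' where "0 < \<tau>'" "\<tau>' < 1" "\<bar>\<tau> - \<tau>'\<bar> \<le> e" "q = circ_loop i \<tau>'"
proof -
  obtain u b where u: "u @ [(i, b)] \<in> fword m"
    "x = vertex_vec u + Poly_Mapping.single (u @ [(i, b)]) (if b then \<tau> else 1 - \<tau>)"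
    by (rule tree_cover_arc[OF x p])
  let ?v = "u @ [(i, b)]"
  let ?z = "Poly_Mapping.lookup y ?v"
  have c: "\<bar>(if b then \<tau> else 1 - \<tau>) - ?z\<bar> \<le> e"
    using close[of ?v] u(2) by (simp add: lookup_edge_point)
  then have z: "0 < ?z" "?z < 1" using e by (auto split: if_splits)
  then have q: "q = letter_loop (i, b) ?z" using tree_cover_fraction[OF y z] by (metis last_snoc)
  show ?thesis
  proof (rule that[of "if b then ?z else 1 - ?z"])
    show "q = circ_loop i (if b then ?z else 1 - ?z)" using q by (simp add: letter_loop_def)
  qed (use z c in \<open>auto split: if_splits\<close>)
qed

lemma null_homotopic_if_lifts_closed:
  assumes \<gamma>: "\<gamma> \<in> H_loops" and closed: "\<And>m x. 2 \<le> m \<Longrightarrow> tree_lift m \<gamma> x \<Longrightarrow> x 1 = 0"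
  shows "loop_homotopic (top_of_set hawaiian) (0, 0) (\<lambda>_. (0, 0)) \<gamma>"
proof -
  note g = H_loopsD[OF \<gamma>]
  \<comment> \<open>The shift by 2 meets the condition \<open>2 \<le> m\<close> on the covers whose
    lifts are assumed to be closed.\<close>
  define x where "x m = (SOME x. tree_lift (m + 2) \<gamma> x)" for m
  have x: "tree_lift (m + 2) \<gamma> (x m)" for m
  proof -
    obtain y where "tree_lift (m + 2) \<gamma> y" by (rule tree_lift_exists[OF \<gamma>])
    then show ?thesis unfolding x_def by (rule someI[of "tree_lift (m + 2) \<gamma>"])
  qed
  note xl = tree_lift_lifts[OF x]
  have E: "(\<gamma> t, x m t) \<in> tree_cover (m + 2)" if "t \<in> {0..1}" for t m
    using xl[of m] that by (simp add: lifts_def)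
  have x0: "x m 0 = 0" and x1: "x m 1 = 0" for m
    using x[of m] closed[OF _ x[of m]] by (auto simp: tree_lift_def)
  have "\<exists>N. 1 \<le> N \<and> (\<forall>m s s'. s \<in> {0..1} \<longrightarrow> s' \<in> {0..1} \<longrightarrow> wnorm (label_weight i) (x m s - x m s') \<le> N)"
    if i: "1 \<le> i" for i
  proof -
    obtain N where N: "1 \<le> N" "\<And>m x s s'. lifts m \<gamma> x \<Longrightarrow> s \<in> {0..1} \<Longrightarrow> s' \<in> {0..1} \<Longrightarrow>
        wnorm (label_weight i) (x s - x s') \<le> N"
      by (rule wnorm_label_bounded[OF g(1) i]) blast
    then show ?thesis using xl by blast
  qed
  then obtain N where N: "\<And>i. 1 \<le> i \<Longrightarrow> 1 \<le> N i"
    "\<And>i m s s'. 1 \<le> i \<Longrightarrow> s \<in> {0..1} \<Longrightarrow> s' \<in> {0..1} \<Longrightarrow> wnorm (label_weight i) (x m s - x m s') \<le> N i"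
    by metis
  \<comment> \<open>\<open>N i\<close> bounds the unweighted length on edges with label
    \<open>i\<close> between any two points of any of the lifts, so label \<open>i\<close>
    contributes at most \<open>(1/2) ^ i\<close> to every distance, whatever \<open>m\<close>
    is.\<close>
  define c where "c i = (if 1 \<le> i then (1/2) ^ i / N i else 1)" for i :: nat
  define h :: "word \<Rightarrow> real" where "h v = c (fst (last v))" for v
  have N0: "0 < N i" if "1 \<le> i" for i using N(1)[OF that] by simp
  have c0: "0 < c i" for i using N0[of i] by (simp add: c_def)
  then have h0: "0 < h v" for v by (simp add: h_def)
  then have h0': "0 \<le> h v" for v by (simp add: less_imp_le)
  have cle: "c i \<le> (1/2) ^ i" if "1 \<le> i" for i
    using N(1)[OF that] that by (simp add: c_def divide_le_eq mult_left_le)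
  have lw0: "0 \<le> wnorm (label_weight i) z" for i z by (rule wnorm_nonneg) (simp add: label_weight_def)
  have split: "wnorm h (x m s - x m s') = (\<Sum>i=1..m+2. c i * wnorm (label_weight i) (x m s - x m s'))"
    if s: "s \<in> {0..1}" "s' \<in> {0..1}" for m s s'
    unfolding h_def
  proof (rule wnorm_by_label)
    fix v assume "v \<in> Poly_Mapping.keys (x m s - x m s')"
    then have "v \<in> Poly_Mapping.keys (x m s) \<or> v \<in> Poly_Mapping.keys (x m s')"
      using keys_diff by fastforce
    then have "v \<noteq> [] \<and> v \<in> fword (m + 2)" using tree_cover_keys[OF E[OF s(1)]] tree_cover_keys[OF E[OF s(2)]] by blast
    then show "v \<noteq> [] \<and> fst (last v) \<in> {1..m+2}" using last_in_set[of v] by (auto simp: fword_def)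
  qed
  have term_le: "c i * wnorm (label_weight i) (x m s - x m s') \<le> (1/2) ^ i"
    if "1 \<le> i" "s \<in> {0..1}" "s' \<in> {0..1}" for i m s s'
  proof -
    have "c i * wnorm (label_weight i) (x m s - x m s') \<le> c i * N i"
      using N(2)[OF that] c0[of i] by (intro mult_left_mono) (auto simp: less_imp_le)
    also have "\<dots> = (1/2) ^ i" using that(1) N0[OF that(1)] by (simp add: c_def)
    finally show ?thesis .
  qed
  have geo: "(\<Sum>i=Suc k..n. (1/2) ^ i) \<le> (1/2::real) ^ k" for k n
  proof (cases "k \<le> n")
    case True
    have "(\<Sum>i=Suc k..n. (1/2) ^ i) = (1/2::real) ^ k - (1/2) ^ n" using True
    proof (induction n rule: dec_induct)
      case (step n)
      then show ?case by simp
    qed simp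
    then show ?thesis by simp
  qed simp
  have bound: "wnorm h (x m s - x m s') \<le> 1" if "s \<in> {0..1}" "s' \<in> {0..1}" for m s s'
  proof -
    have "wnorm h (x m s - x m s') \<le> (\<Sum>i=1..m+2. (1/2) ^ i)"
      unfolding split[OF that] by (rule sum_mono, rule term_le) (use that in auto)
    also have "\<dots> \<le> 1" using geo[of 0 "m + 2"] by simp
    finally show ?thesis .
  qed
  define F where "F m t = wnorm h (x m t)" for m t
  have F0: "F m 0 = 0" "F m 1 = 0" for m by (simp_all add: F_def x0 x1 wnorm_def)
  have F01: "0 \<le> F m t" "F m t \<le> 1" if "t \<in> {0..1}" for m t
    using wnorm_nonneg[OF h0'] bound[OF that, of 0 m] by (auto simp: F_def x0)
  have Fdiff: "\<bar>F m s - F m s'\<bar> \<le> wnorm h (x m s - x m s')" for m s s'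
    using wnorm_triangle[of h "x m s - x m s'" "x m s'"] wnorm_triangle[of h "x m s' - x m s" "x m s"] h0'
      wnorm_minus[of h "x m s - x m s'"] by (simp add: F_def abs_le_iff)
  have equi: "\<exists>d>0. \<forall>m s s'. s \<in> {0..1} \<longrightarrow> s' \<in> {0..1} \<longrightarrow> \<bar>s - s'\<bar> < d \<longrightarrow> wnorm h (x m s - x m s') < e"
    if e: "0 < e" for e
  proof -
    \<comment> \<open>The labels above \<open>M\<close> contribute less than \<open>e / 2\<close> in
      total; the finitely many others have a common modulus of continuity, and \<open>e'\<close>
      keeps their sum below \<open>e / 2\<close>.\<close>
    obtain M where M: "(1/2::real) ^ M < e / 2" using real_arch_pow_inv[of "e / 2" "1/2"] e by auto
    define e' where "e' = min (1/2) (e / 8)"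
    have e': "0 < e'" "e' < 1" "2 * e' < e / 2" using e by (auto simp: e'_def min_def)
    have "\<exists>d>0. \<forall>m s s'. s \<in> {0..1} \<longrightarrow> s' \<in> {0..1} \<longrightarrow> \<bar>s - s'\<bar> < d \<longrightarrow>
        wnorm (label_weight i) (x m s - x m s') \<le> 2 * e'" if i: "1 \<le> i" for i
    proof -
      obtain d where d: "0 < d" "\<And>m x s s' v. lifts m \<gamma> x \<Longrightarrow> s \<in> {0..1} \<Longrightarrow> s' \<in> {0..1} \<Longrightarrow> \<bar>s - s'\<bar> < d \<Longrightarrow>
          v \<noteq> [] \<Longrightarrow> fst (last v) = i \<Longrightarrow> \<bar>Poly_Mapping.lookup (x s) v - Poly_Mapping.lookup (x s') v\<bar> \<le> e'"
        by (rule lifts_equicontinuous[OF g(1) i e'(1,2)]) blast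
      have "wnorm (label_weight i) (x m s - x m s') \<le> 2 * e'"
        if "s \<in> {0..1}" "s' \<in> {0..1}" "\<bar>s - s'\<bar> < d" for m s s'
        by (rule wnorm_label_le[OF E[OF that(1)] E[OF that(2)] e'(1,2)]) (rule d(2)[OF xl that])
      then show ?thesis using d(1) by blast
    qed
    then obtain d where d: "\<And>i. 1 \<le> i \<Longrightarrow> 0 < d i"
      "\<And>i m s s'. 1 \<le> i \<Longrightarrow> s \<in> {0..1} \<Longrightarrow> s' \<in> {0..1} \<Longrightarrow> \<bar>s - s'\<bar> < d i \<Longrightarrow>
        wnorm (label_weight i) (x m s - x m s') \<le> 2 * e'" by metis
    define D where "D = Min (insert 1 (d ` {1..M}))"
    have D0: "0 < D" unfolding D_def using d(1) by (subst Min_gr_iff) auto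
    have Dd: "D \<le> d i" if "i \<in> {1..M}" for i unfolding D_def using that by (intro Min_le) auto
    have "wnorm h (x m s - x m s') < e"
      if s: "s \<in> {0..1}" "s' \<in> {0..1}" "\<bar>s - s'\<bar> < D" for m s s'
    proof -
      let ?w = "\<lambda>i. c i * wnorm (label_weight i) (x m s - x m s')"
      have w0: "0 \<le> ?w i" for i using c0[of i] lw0 by (simp add: less_imp_le)
      have "wnorm h (x m s - x m s') = (\<Sum>i=1..m+2. ?w i)" by (rule split[OF s(1,2)])
      also have "\<dots> \<le> (\<Sum>i\<in>{1..M} \<union> {Suc M..m+2}. ?w i)"
        by (rule sum_mono2) (use w0 in auto)
      also have "\<dots> = (\<Sum>i=1..M. ?w i) + (\<Sum>i=Suc M..m+2. ?w i)"
        by (rule sum.union_disjoint) auto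
      also have "(\<Sum>i=1..M. ?w i) \<le> (\<Sum>i=1..M. (1/2) ^ i * (2 * e'))"
      proof (rule sum_mono)
        fix i assume i: "i \<in> {1..M}"
        have "wnorm (label_weight i) (x m s - x m s') \<le> 2 * e'"
          using d(2)[OF _ s(1,2), of i m] Dd[OF i] s(3) i by simp
        then show "?w i \<le> (1/2) ^ i * (2 * e')"
          using cle[of i] i lw0 by (intro mult_mono) auto
      qed
      also have "(\<Sum>i=1..M. (1/2) ^ i * (2 * e')) \<le> 1 * (2 * e')"
        unfolding sum_distrib_right[symmetric] using geo[of 0 M] e' by (intro mult_right_mono) auto
      also have "(\<Sum>i=Suc M..m+2. ?w i) \<le> (\<Sum>i=Suc M..m+2. (1/2) ^ i)"
        by (rule sum_mono, rule term_le[OF _ s(1,2)]) simp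
      also have "\<dots> \<le> (1/2) ^ M" by (rule geo)
      finally show ?thesis using M e'(3) by simp
    qed
    then show ?thesis using D0 by blast
  qed
  \<comment> \<open>Compactness is applied to the heights only, since the lifts themselves run in
    different trees.\<close>
  obtain f k where f: "continuous_on {0..1} f" and k: "strict_mono (k :: nat \<Rightarrow> nat)"
    and lim: "\<And>e. 0 < e \<Longrightarrow> \<exists>n0. \<forall>n t. n \<ge> n0 \<and> t \<in> {0..1} \<longrightarrow> norm (F (k n) t - f t) < e"
  proof (rule Arzela_Ascoli[of "{0..1::real}" F 1])
    show "compact {0..1::real}" by simp
    show "norm (F n t) \<le> 1" if "t \<in> {0..1}" for n t using F01[OF that, of n] by simp
    show "\<exists>d. 0 < d \<and> (\<forall>n s'. s' \<in> {0..1} \<and> norm (s - s') < d \<longrightarrow> norm (F n s - F n s') < e)"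
      if s: "s \<in> {0..1}" and "0 < e" for s e :: real
    proof -
      obtain d where d: "d > 0" "\<And>m s s'. s \<in> {0..1} \<Longrightarrow> s' \<in> {0..1} \<Longrightarrow> \<bar>s - s'\<bar> < d \<Longrightarrow> wnorm h (x m s - x m s') < e"
        using equi[OF \<open>0 < e\<close>] by blast
      have "norm (F n s - F n s') < e" if "s' \<in> {0..1}" "norm (s - s') < d" for n s'
        using d(2)[OF s that(1), of n] that(2) Fdiff[of n s s'] by simp
      then show ?thesis using d(1) by blast
    qed
  qed blast
  have flim: "(\<lambda>n. F (k n) t) \<longlonglongrightarrow> f t" if "t \<in> {0..1}" for t
    using lim that unfolding lim_sequentially dist_norm by blast
  have Fcont: "continuous_on {0..1} (F m)" for m
    unfolding continuous_on_iff
  proof (intro ballI allI impI)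
    fix s e :: real assume s: "s \<in> {0..1}" and e: "0 < e"
    obtain d where d: "d > 0" "\<And>m s s'. s \<in> {0..1} \<Longrightarrow> s' \<in> {0..1} \<Longrightarrow> \<bar>s - s'\<bar> < d \<Longrightarrow> wnorm h (x m s - x m s') < e"
      using equi[OF e] by blast
    have "dist (F m s') (F m s) < e" if "s' \<in> {0..1}" "dist s' s < d" for s'
      using d(2)[OF that(1) s, of m] that(2) Fdiff[of m s' s] by (simp add: dist_real_def)
    then show "\<exists>d>0. \<forall>s'\<in>{0..1}. dist s' s < d \<longrightarrow> dist (F m s') (F m s) < e" using d(1) by blast
  qed
  show ?thesis
  proof (rule null_homotopic_if_coded_by_tree[OF \<gamma> f])
    show "f 0 = 0" using LIMSEQ_unique[OF flim[of 0]] by (simp add: F0)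
    show "f 1 = 0" using LIMSEQ_unique[OF flim[of 1]] by (simp add: F0)
    show "0 \<le> f t \<and> f t \<le> 1" if "t \<in> {0..1}" for t
      using LIMSEQ_le_const[OF flim[OF that], of 0] LIMSEQ_le_const2[OF flim[OF that], of 1] F01[OF that] by blast
  next
    fix s t :: real
    assume st: "0 \<le> s" "s < t" "t \<le> 1" "f s = f t" and min: "\<And>v. v \<in> {s..t} \<Longrightarrow> f s \<le> f v"
    have s01: "s \<in> {0..1}" and t01: "t \<in> {0..1}" using st by auto
    \<comment> \<open>In the limit the heights at \<open>s\<close> and \<open>t\<close> agree and
      are least on the interval. For large \<open>n\<close> the least height, taken at
      \<open>r\<close>, is thus nearly that at \<open>s\<close> and at \<open>t\<close>, and
      \<open>wnorm_min_le\<close> turns this into small distances from the point at \<open>r\<close>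
      to both.\<close>
    have near: "\<exists>n0. \<forall>n\<ge>n0. wnorm h (x (k n) s - x (k n) t) \<le> e" if e: "0 < e" for e
    proof -
      obtain n0 where n0: "\<And>n t. n \<ge> n0 \<Longrightarrow> t \<in> {0..1} \<Longrightarrow> norm (F (k n) t - f t) < e / 4"
        using lim[of "e / 4"] e by auto
      have "wnorm h (x (k n) s - x (k n) t) \<le> e" if n: "n \<ge> n0" for n
      proof -
        have "continuous_on {s..t} (F (k n))" by (rule continuous_on_subset[OF Fcont]) (use st in auto)
        then obtain r where r: "r \<in> {s..t}" "\<And>v. v \<in> {s..t} \<Longrightarrow> F (k n) r \<le> F (k n) v"
          using continuous_attains_inf[of "{s..t}" "F (k n)"] st(2) by auto
        have r01: "r \<in> {0..1}" using r st by auto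
        have dist: "wnorm h (x (k n) v - x (k n) r) = F (k n) v - F (k n) r" if "v \<in> {s..t}" for v
          unfolding F_def by (rule wnorm_min_le[OF xl st(1,3) r(1) h0 r(2)[unfolded F_def] that])
        have "F (k n) v - F (k n) r \<le> e / 2" if v: "v \<in> {s, t}" for v
        proof -
          have "f v = f s" "v \<in> {0..1}" using v st by auto
          then show ?thesis
            using n0[OF n \<open>v \<in> {0..1}\<close>] n0[OF n r01] min[OF r(1)] unfolding real_norm_def by linarith
        qed
        then have "wnorm h (x (k n) s - x (k n) r) \<le> e / 2" "wnorm h (x (k n) t - x (k n) r) \<le> e / 2"
          using dist[of s] dist[of t] st(2) by auto
        moreover have "wnorm h (x (k n) s - x (k n) t) \<le> wnorm h (x (k n) s - x (k n) r) + wnorm h (x (k n) r - x (k n) t)"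
          using wnorm_triangle[of h "x (k n) s - x (k n) r" "x (k n) r - x (k n) t"] h0' by simp
        ultimately show ?thesis using wnorm_minus[of h "x (k n) t - x (k n) r"] by simp
      qed
      then show ?thesis by blast
    qed
    \<comment> \<open>If \<open>\<gamma> a\<close> is a point of the circle \<open>i\<close> off the
      origin, the lifts at \<open>a\<close> and \<open>b\<close> have nearly the same coordinates
      with label \<open>i\<close>, which forces \<open>\<gamma> b\<close> onto the same circle with
      nearly the same parameter.\<close>
    have one_side: "\<gamma> a = \<gamma> b"
      if a: "a \<in> {0..1}" and b: "b \<in> {0..1}" and nz: "\<gamma> a \<noteq> (0, 0)"
        and nr: "\<And>e. 0 < e \<Longrightarrow> \<exists>n0. \<forall>n\<ge>n0. wnorm h (x (k n) a - x (k n) b) \<le> e" for a b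
    proof (rule ccontr)
      assume neq: "\<gamma> a \<noteq> \<gamma> b"
      obtain i \<tau> where i: "1 \<le> i" "0 < \<tau>" "\<tau> < 1" "\<gamma> a = circ_loop i \<tau>"
        using hawaiian_cases[OF g(2)[OF a]] nz by metis
      have approx: "\<exists>\<tau>'. 0 < \<tau>' \<and> \<tau>' < 1 \<and> \<bar>\<tau> - \<tau>'\<bar> \<le> e \<and> \<gamma> b = circ_loop i \<tau>'"
        if e: "0 < e" "e < \<tau>" "e < 1 - \<tau>" for e
      proof -
        obtain n0 where n0: "\<forall>n\<ge>n0. wnorm h (x (k n) a - x (k n) b) \<le> e * c i"
          using nr[of "e * c i"] e(1) c0[of i] by auto
        \<comment> \<open>With \<open>i \<le> k ?n + 2\<close> the circle \<open>i\<close> is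
          unrolled in the tree, so that its points are seen by the coordinates.\<close>
        let ?n = "max n0 i"
        have ki: "i \<le> k ?n + 2" using seq_suble[OF k, of ?n] by simp
        have near: "wnorm h (x (k ?n) a - x (k ?n) b) \<le> e * c i" using n0 by simp
        obtain \<tau>' where "0 < \<tau>'" "\<tau>' < 1" "\<bar>\<tau> - \<tau>'\<bar> \<le> e" "\<gamma> b = circ_loop i \<tau>'"
        proof (rule arc_determined_by_coordinate[OF E[OF a] E[OF b] i(4,1) ki i(2,3) e(2,3)])
          fix v :: word assume v: "v \<noteq> []" "fst (last v) = i"
          have "h v * \<bar>Poly_Mapping.lookup (x (k ?n) a - x (k ?n) b) v\<bar> \<le> e * c i"
            using wnorm_component[of h v] h0' near by (meson order_trans)
          then have "c i * \<bar>Poly_Mapping.lookup (x (k ?n) a) v - Poly_Mapping.lookup (x (k ?n) b) v\<bar> \<le> c i * e"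
            using v(2) by (simp add: h_def lookup_minus mult.commute)
          then show "\<bar>Poly_Mapping.lookup (x (k ?n) a) v - Poly_Mapping.lookup (x (k ?n) b) v\<bar> \<le> e"
            using c0[of i] by simp
        qed blast
        then show ?thesis by blast
      qed
      \<comment> \<open>A first use of \<open>approx\<close> yields a parameter
        \<open>\<tau>1\<close> of \<open>\<gamma> b\<close>; a second use, with an error below the
        distance of \<open>\<tau>1\<close> and \<open>\<tau>\<close>, contradicts it.\<close>
      define e1 where "e1 = min (\<tau> / 2) ((1 - \<tau>) / 2)"
      have e1: "0 < e1" "e1 < \<tau>" "e1 < 1 - \<tau>" using i by (auto simp: e1_def min_def)
      obtain \<tau>1 where \<tau>1: "0 < \<tau>1" "\<tau>1 < 1" "\<gamma> b = circ_loop i \<tau>1" using approx[OF e1] by blast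
      have ne: "\<tau>1 \<noteq> \<tau>" using neq i(4) \<tau>1(3) by auto
      define e2 where "e2 = min e1 (\<bar>\<tau> - \<tau>1\<bar> / 2)"
      have e2: "0 < e2" "e2 < \<tau>" "e2 < 1 - \<tau>" "e2 < \<bar>\<tau> - \<tau>1\<bar>"
        using e1 ne by (auto simp: e2_def min_def)
      obtain \<tau>2 where \<tau>2: "0 < \<tau>2" "\<tau>2 < 1" "\<bar>\<tau> - \<tau>2\<bar> \<le> e2" "\<gamma> b = circ_loop i \<tau>2"
        using approx[OF e2(1-3)] by blast
      have "\<tau>1 = \<tau>2" using circ_loop_eqD(2)[OF i(1) i(1) \<tau>1(1,2), of \<tau>2] \<tau>2 \<tau>1(3) by simp
      then show False using \<tau>2(3) e2(4) by simp
    qed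
    have sym: "wnorm h (x n t - x n s) = wnorm h (x n s - x n t)" for n
      using wnorm_minus[of h "x n s - x n t"] by simp
    have near': "\<exists>n0. \<forall>n\<ge>n0. wnorm h (x (k n) t - x (k n) s) \<le> e" if "0 < e" for e
      unfolding sym by (rule near[OF that])
    show "\<gamma> s = \<gamma> t"
    proof (cases "\<gamma> s = (0, 0)")
      case True
      show ?thesis
      proof (cases "\<gamma> t = (0, 0)")
        case False
        then show ?thesis by (rule one_side[OF t01 s01 _ near', symmetric])
      qed (use True in simp)
    next
      case False
      then show ?thesis by (rule one_side[OF s01 t01 _ near])
    qed
  qed
qed

section \<open>Conjugating an essential loop out of the subgroup\<close>

lemma tracks_cong:
  assumes g: "tracks act S \<gamma> g" and eq: "\<And>t. t \<in> S \<Longrightarrow> \<gamma> t = \<gamma>' t"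
  shows "tracks act S \<gamma>' g"
  unfolding tracks_def
proof
  fix t0 assume t0: "t0 \<in> S"
  obtain U where U: "openin (top_of_set S) U" "t0 \<in> U" "\<And>t. t \<in> U \<Longrightarrow> tracks_at act \<gamma> g t0 t"
    by (rule tracksE[OF g t0]) blast
  have "tracks_at act \<gamma>' g t0 t" if t: "t \<in> U" for t
  proof -
    have "t \<in> S" using openin_subset[OF U(1)] t by auto
    then show ?thesis using U(3)[OF t] eq t0 unfolding tracks_at_def by simp
  qed
  then show "\<exists>U. openin (top_of_set S) U \<and> t0 \<in> U \<and> (\<forall>t\<in>U. tracks_at act \<gamma>' g t0 t)"
    using U(1,2) by (intro exI[of _ U]) simp
qed

lemma tracks_atD:
  "tracks_at act \<gamma> g t0 t \<Longrightarrow> \<gamma> t0 = (0, 0) \<Longrightarrow> 1 \<le> i \<Longrightarrow> \<tau> \<in> {0..<1} \<Longrightarrow> \<gamma> t = circ_loop i \<tau> \<Longrightarrow>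
    if \<tau> < 1/2 then g t = g t0 else act i (g t) = g t0"
  unfolding tracks_at_def by simp

text \<open>This does not claim that there is a lift of \<open>\<gamma>\<close> starting at \<open>u\<close>.\<close>

definition carries ::
  "(nat \<Rightarrow> 'v \<Rightarrow> 'v) \<Rightarrow> 'v set \<Rightarrow> (real \<Rightarrow> real \<times> real) \<Rightarrow> 'v \<Rightarrow> 'v \<Rightarrow> bool" where
  "carries act V \<gamma> u v \<longleftrightarrow>
     (\<forall>g. tracks act {0..1} \<gamma> g \<longrightarrow> (\<forall>t\<in>{0..1}. g t \<in> V) \<longrightarrow> g 0 = u \<longrightarrow> g 1 = v)"

lemma tracks_loop_join:
  assumes g: "tracks act {0..1} (loop_join \<gamma> \<delta>) g" and e: "\<gamma> 1 = \<delta> 0"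
  shows "tracks act {0..1} \<gamma> (\<lambda>t. g (t / 2))" "tracks act {0..1} \<delta> (\<lambda>t. g ((t + 1) / 2))"
proof -
  have "tracks act {0..1} (\<lambda>t. loop_join \<gamma> \<delta> (t / 2)) (\<lambda>t. g (t / 2))"
    by (rule tracks_compose[OF g]) (auto intro!: continuous_intros)
  then show "tracks act {0..1} \<gamma> (\<lambda>t. g (t / 2))"
    by (rule tracks_cong) (simp add: loop_join_def)
  have "tracks act {0..1} (\<lambda>t. loop_join \<gamma> \<delta> ((t + 1) / 2)) (\<lambda>t. g ((t + 1) / 2))"
    by (rule tracks_compose[OF g]) (auto intro!: continuous_intros)
  then show "tracks act {0..1} \<delta> (\<lambda>t. g ((t + 1) / 2))"
  proof (rule tracks_cong)
    fix t :: real assume t: "t \<in> {0..1}"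
    have "2 * ((t + 1) / 2) - 1 = t" by (simp add: field_simps)
    moreover have "(t + 1) / 2 \<le> 1/2 \<longleftrightarrow> t = 0" using t by auto
    ultimately show "loop_join \<gamma> \<delta> ((t + 1) / 2) = \<delta> t" using e by (simp add: loop_join_def)
  qed
qed

lemma carries_loop_join:
  assumes "carries act V \<gamma> u v" "carries act V \<delta> v z" "\<gamma> 1 = \<delta> 0"
  shows "carries act V (loop_join \<gamma> \<delta>) u z"
  unfolding carries_def
proof (intro allI impI)
  fix g assume g: "tracks act {0..1} (loop_join \<gamma> \<delta>) g" "\<forall>t\<in>{0..1}. g t \<in> V" "g 0 = u"
  have "g (1 / 2) = v"
    using assms(1)[unfolded carries_def, rule_format, OF tracks_loop_join(1)[OF g(1) assms(3)]] g(2,3) by auto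
  then show "g 1 = z"
    using assms(2)[unfolded carries_def, rule_format, OF tracks_loop_join(2)[OF g(1) assms(3)]] g(2) by auto
qed

text \<open>During the open interval of times the source is constant; just after time 0 it is
  \<open>u\<close>, and just before time 1 it is a vertex that \<open>act i\<close> takes to the
  end.\<close>

lemma carries_circ_loop:
  assumes i: "1 \<le> i"
  shows "carries act V (circ_loop i) u (act i u)"
  unfolding carries_def
proof (intro allI impI)
  fix g assume g: "tracks act {0..1} (circ_loop i) g" "\<forall>t\<in>{0..1}. g t \<in> V" "g 0 = u"
  have nbhd: "\<exists>d>0. \<forall>t. t \<in> {0..1} \<and> \<bar>t - t0\<bar> < d \<longrightarrow> tracks_at act (circ_loop i) g t0 t" if t0: "t0 \<in> {0..1}" for t0
  proof -
    obtain U where U: "openin (top_of_set {0..1}) U" "t0 \<in> U" "\<And>t. t \<in> U \<Longrightarrow> tracks_at act (circ_loop i) g t0 t"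
      by (rule tracksE[OF g(1) t0]) blast
    obtain d where "0 < d" "\<And>t. t \<in> {0..1} \<Longrightarrow> dist t t0 < d \<Longrightarrow> t \<in> U"
      using U(1,2) unfolding openin_euclidean_subtopology_iff by blast
    then show ?thesis using U(3) by (auto simp: dist_real_def)
  qed
  have mid: "g s = g t" if st: "s \<in> {0<..<1}" "t \<in> {0<..<1}" for s t
  proof (rule connected_local_const[of "{0<..<1}", OF _ st], simp, rule ballI)
    fix t0 :: real assume t0: "t0 \<in> {0<..<1}"
    then obtain d where d: "0 < d" "\<And>t. t \<in> {0..1} \<Longrightarrow> \<bar>t - t0\<bar> < d \<Longrightarrow> tracks_at act (circ_loop i) g t0 t"
      using nbhd[of t0] by auto
    have nz: "circ_loop i t0 \<noteq> (0, 0)" using circ_loop_eq_0[OF i] t0 by simp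
    have "g t0 = g t" if "t \<in> {0<..<1}" "dist t t0 < d" for t
      using d(2)[of t] that nz unfolding tracks_at_def by (simp add: dist_real_def)
    then show "\<forall>\<^sub>F t in at t0 within {0<..<1}. g t0 = g t"
      unfolding eventually_at using d(1) by blast
  qed
  obtain d where d: "0 < d" "\<And>t. t \<in> {0..1} \<Longrightarrow> \<bar>t - 0\<bar> < d \<Longrightarrow> tracks_at act (circ_loop i) g 0 t"
    using nbhd[of 0] by auto
  obtain d' where d': "0 < d'" "\<And>t. t \<in> {0..1} \<Longrightarrow> \<bar>t - 1\<bar> < d' \<Longrightarrow> tracks_at act (circ_loop i) g 1 t"
    using nbhd[of 1] by auto
  define s where "s = min (1/4) (d / 2)"
  have s: "0 < s" "s < 1/2" "s < d" using d(1) by (auto simp: s_def min_def)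
  define t where "t = max (3/4) (1 - d' / 2)"
  have t: "1/2 < t" "t < 1" "1 - t < d'" using d'(1) by (auto simp: t_def max_def)
  have "tracks_at act (circ_loop i) g 0 s" using d(2)[of s] s by simp
  from tracks_atD[OF this _ i, of s] have "g s = g 0" using s by simp
  moreover have "act i (g t) = g 1"
  proof -
    have "tracks_at act (circ_loop i) g 1 t" using d'(2)[of t] t by simp
    from tracks_atD[OF this _ i, of t] show ?thesis using t by simp
  qed
  ultimately show "g 1 = act i u" using mid[of s t] s t g(3) by simp
qed

text \<open>\<open>carries\<close> gives the end of a lift in terms of its start. For the last piece
  of a conjugate the end is known instead, so this piece is read backwards.\<close>

lemma carries_reverse:
  assumes c: "carries act V \<gamma> u v" and g: "tracks act {0..1} (\<gamma> \<circ> (\<lambda>t. 1 - t)) g"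
    and V: "\<And>t. t \<in> {0..1} \<Longrightarrow> g t \<in> V" and u: "g 1 = u"
  shows "g 0 = v"
proof -
  have "tracks act {0..1} (\<lambda>t. (\<gamma> \<circ> (\<lambda>t. 1 - t)) (1 - t)) (\<lambda>t. g (1 - t))"
    by (rule tracks_compose[OF g]) (auto intro!: continuous_intros)
  then have "tracks act {0..1} \<gamma> (\<lambda>t. g (1 - t))" by (rule tracks_cong) simp
  then show ?thesis using c V u unfolding carries_def by fastforce
qed

section \<open>Reversed loops and inverse classes\<close>

lemma circ_loop_H_loops: "1 \<le> i \<Longrightarrow> circ_loop i \<in> H_loops"
  using circ_loop_hawaiian[of i] continuous_on_circ_loop[of "{0..1}" i]
  by (auto simp: loops_at_def pathin_def)

lemma loop_reverse_homotopic:
  assumes f: "f \<in> loops_at X x"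
  shows "loop_homotopic X x (loop_join f (f \<circ> (\<lambda>t. 1 - t))) (\<lambda>_. x)"
proof -
  have ends: "f 0 = x" "f 1 = x" using f by (auto simp: loops_at_def)
  have "loop_homotopic X x (f \<circ> (\<lambda>t. 1 - \<bar>1 - 2 * t\<bar>)) (f \<circ> (\<lambda>t. 0))"
    by (rule loop_homotopic_reparam[OF f]) (use ends in \<open>auto intro!: continuous_intros\<close>)
  moreover have "f \<circ> (\<lambda>t. 1 - \<bar>1 - 2 * t\<bar>) = loop_join f (f \<circ> (\<lambda>t. 1 - t))"
    by (auto simp: loop_join_def fun_eq_iff intro!: arg_cong[where f = f])
  moreover have "f \<circ> (\<lambda>t::real. 0) = (\<lambda>_. x)" using ends by (simp add: o_def)
  ultimately show ?thesis by (simp only:)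
qed

lemma inv_loop_class:
  assumes x: "x \<in> topspace X" and f: "f \<in> loops_at X x"
  shows "inv\<^bsub>fundamental_group X x\<^esub> loop_class X x f = loop_class X x (f \<circ> (\<lambda>t. 1 - t))"
proof -
  let ?G = "fundamental_group X x" and ?r = "f \<circ> (\<lambda>t. 1 - t)"
  interpret group ?G by (rule group_fundamental_group[OF x])
  have r: "?r \<in> loops_at X x" by (rule loop_reverse[OF f])
  have carr: "loop_class X x h \<in> carrier ?G" if "h \<in> loops_at X x" for h
    using that by (simp add: fundamental_group_def)
  have rr: "?r \<circ> (\<lambda>t. 1 - t) = f" by (simp add: fun_eq_iff)
  have "loop_class X x ?r \<otimes>\<^bsub>?G\<^esub> loop_class X x f = loop_class X x (loop_join ?r f)"
    by (rule fundamental_group_mult[OF r f])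
  also have "\<dots> = \<one>\<^bsub>?G\<^esub>"
    using loop_class_eq_iff[OF loop_join_loops[OF r f] const_loop[OF x]] loop_reverse_homotopic[OF r]
    unfolding rr by (simp add: fundamental_group_def)
  finally show ?thesis by (rule inv_equality[OF _ carr[OF f] carr[OF r]])
qed

section \<open>Words whose prefixes reduce to given vertices\<close>

definition word_inv :: "word \<Rightarrow> word" where
  "word_inv u = rev (map inv_letter u)"

lemma reduce_word_inv: "reduce (x @ u @ word_inv u @ y) = reduce (x @ y)"
proof (induction u arbitrary: x y rule: rev_induct)
  case (snoc l u)
  have "reduce (x @ (u @ [l]) @ word_inv (u @ [l]) @ y) = reduce ((x @ u) @ [l, inv_letter l] @ word_inv u @ y)"
    by (simp add: word_inv_def)
  also have "\<dots> = reduce ((x @ u) @ word_inv u @ y)" by (rule reduce_cancel)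
  finally show ?case using snoc by simp
qed (simp add: word_inv_def)

lemma reduce_append_eqD:
  assumes "is_reduced u" "is_reduced v" "reduce (u @ v) = u"
  shows "v = []"
proof -
  have "word_inv (word_inv u) = u" by (simp add: word_inv_def rev_map o_def)
  then have "reduce (word_inv u @ reduce (u @ v)) = v"
    using reduce_word_inv[of "[]" "word_inv u" v] reduce_reduced[OF assms(2)] by (simp add: reduce_append_right)
  moreover have "reduce (word_inv u @ u) = []"
    using \<open>word_inv (word_inv u) = u\<close> reduce_word_inv[of "[]" "word_inv u" "[]"] by (simp add: reduce_def)
  ultimately show ?thesis using assms(3) by simp
qed

text \<open>For each vertex \<open>u\<close> of \<open>P\<close> a detour along \<open>u\<close> and
  back is appended. So \<open>z\<close> stands for the identity of the free group while its prefixes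
  reach all of \<open>P\<close>.\<close>

lemma word_visiting:
  assumes "finite P" "P \<subseteq> fword n"
  shows "\<exists>z. (\<forall>l\<in>set z. fst l \<in> {1..n}) \<and> (\<forall>b. reduce (z @ b) = reduce b) \<and>
    (\<forall>u\<in>P. \<exists>k\<le>length z. reduce (take k z) = u)"
  using assms
proof (induction P)
  case empty
  then show ?case by (intro exI[of _ "[]"]) simp
next
  case (insert u P)
  then obtain z where z: "\<forall>l\<in>set z. fst l \<in> {1..n}" "\<And>b. reduce (z @ b) = reduce b"
    "\<And>u. u \<in> P \<Longrightarrow> \<exists>k\<le>length z. reduce (take k z) = u" by auto
  have u: "is_reduced u" "\<forall>l\<in>set u. fst l \<in> {1..n}" using insert.prems by (auto simp: fword_def)
  let ?z = "z @ u @ word_inv u"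
  have "\<forall>l\<in>set ?z. fst l \<in> {1..n}" using z(1) u(2) by (auto simp: word_inv_def inv_letter_def)
  moreover have "reduce (?z @ b) = reduce b" for b
    using reduce_word_inv[of z u b] z(2) by simp
  moreover have "\<exists>k\<le>length ?z. reduce (take k ?z) = v" if v: "v \<in> insert u P" for v
  proof (cases "v = u")
    case True
    have "reduce (take (length z + length u) ?z) = v"
      using z(2)[of u] reduce_reduced[OF u(1)] True by simp
    then show ?thesis by (intro exI[of _ "length z + length u"]) simp
  next
    case False
    then obtain k where k: "k \<le> length z" "reduce (take k z) = v" using z(3) v by auto
    then show ?thesis by (intro exI[of _ k]) simp
  qed
  ultimately show ?case by blast
qed

section \<open>Lifts of the conjugated loop\<close>

context word_enumeration
begin

text \<open>The loop runs through the circles 1 and 2 in turn. It must be fixed before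
  \<open>m\<close> is known; as its labels are at most 2, the truncation does not affect it for
  \<open>m \<ge> 2\<close>.\<close>

lemma ray_loop:
  "\<exists>\<beta>\<in>H_loops. \<forall>m\<ge>2. carries (trunc_act m) (Gam_star w) \<beta> [] (alternating k)"
proof (induction k)
  case 0
  have "(\<lambda>_. (0, 0)) \<in> H_loops" using zero_hawaiian by (intro const_loop) simp
  moreover have "carries (trunc_act m) (Gam_star w) (\<lambda>_. (0, 0)) [] (alternating 0)" for m
    unfolding carries_def
  proof (intro allI impI)
    fix g :: "real \<Rightarrow> word"
    assume g: "tracks (trunc_act m) {0..1} (\<lambda>_. (0, 0)) g" "\<forall>t\<in>{0..1}. g t \<in> Gam_star w" "g 0 = []"
    have "tracks (trunc_act m) {0..1::real} (\<lambda>_. (0, 0)) (\<lambda>_. [])"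
      unfolding tracks_def
    proof
      fix t0 :: real assume t0: "t0 \<in> {0..1}"
      have half: "\<tau> < 1/2" if "1 \<le> i" "\<tau> \<in> {0..<1}" "(0, 0) = circ_loop i \<tau>" for i \<tau>
      proof (rule ccontr)
        assume "\<not> \<tau> < 1/2"
        then have "0 < \<tau>" "\<tau> < 1" using that(2) by simp_all
        then show False using circ_loop_eq_0[OF that(1)] that(3) by metis
      qed
      have "tracks_at (trunc_act m) (\<lambda>_. (0, 0)) (\<lambda>_. []) t0 t" for t
        unfolding tracks_at_def if_P[OF refl]
      proof (intro allI ballI impI)
        fix i :: nat and \<tau> assume "1 \<le> i" "\<tau> \<in> {0..<1}" "(0, 0) = circ_loop i \<tau>"
        then have "\<tau> < 1/2" by (rule half)
        then show "if \<tau> < 1/2 then [] = [] else trunc_act m i [] = []" by simp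
      qed
      then show "\<exists>U. openin (top_of_set {0..1}) U \<and> t0 \<in> U \<and>
          (\<forall>t\<in>U. tracks_at (trunc_act m) (\<lambda>_. (0, 0)) (\<lambda>_. []) t0 t)"
        using t0 by (intro exI[of _ "{0..1}"]) simp
    qed
    then have t: "tracks (trunc_act m) {0..1::real} (\<lambda>_. (0, 0)) (\<lambda>_. [])" .
    have nil: "[] \<in> Gam_star w" using alternating_Gam_star[of 0] by (simp add: alternating_def)
    have "g 1 = []"
      by (rule tracks_unique[OF connected_Icc _ g(1) _ t _ inj_on_trunc_act, where s = 0])
        (use g(2,3) zero_hawaiian nil in simp_all)
    then show "g 1 = alternating 0" by (simp add: alternating_def)
  qed
  ultimately show ?case by blast
next
  case (Suc k)
  then obtain \<beta> where \<beta>: "\<beta> \<in> H_loops" "\<And>m. 2 \<le> m \<Longrightarrow> carries (trunc_act m) (Gam_star w) \<beta> [] (alternating k)"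
    by blast
  define i where "i = (if even k then 1 else 2 :: nat)"
  have i: "1 \<le> i" "i \<in> {1, 2}" by (auto simp: i_def)
  note v = alternating_Gam_star[of k]
  have "i \<in> E_set w (alternating k)" using i(2) E_set_iff[OF v] by blast
  moreover have "rmul (alternating k) (i, True) = alternating (Suc k)"
  proof -
    have "last (alternating k) \<noteq> inv_letter (i, True)" if "alternating k \<noteq> []"
      using set_alternating[OF last_in_set[OF that]] by auto
    then have "rmul (alternating k) (i, True) = alternating k @ [(i, True)]"
      unfolding rmul_def by (intro if_not_P) blast
    then show ?thesis by (simp add: alternating_Suc i_def)
  qed
  ultimately have a: "act i (alternating k) = alternating (Suc k)" by (simp add: act_def)
  have "carries (trunc_act m) (Gam_star w) (loop_join \<beta> (circ_loop i)) [] (alternating (Suc k))" if m: "2 \<le> m" for m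
  proof (rule carries_loop_join[OF \<beta>(2)[OF m]])
    have "trunc_act m i (alternating k) = alternating (Suc k)" using a i m by (auto simp: trunc_act_def)
    then show "carries (trunc_act m) (Gam_star w) (circ_loop i) (alternating k) (alternating (Suc k))"
      using carries_circ_loop[OF i(1), of "trunc_act m" "Gam_star w" "alternating k"] by simp
    show "\<beta> 1 = circ_loop i 0" using H_loopsD(4)[OF \<beta>(1)] by simp
  qed
  moreover have "loop_join \<beta> (circ_loop i) \<in> H_loops"
    by (rule loop_join_loops[OF \<beta>(1) circ_loop_H_loops[OF i(1)]])
  ultimately show ?case by blast
qed

text \<open>Left translation by \<open>hat_word w j\<close> sends the vertices of the lift in the
  tree into \<open>Zset w j\<close>. There exactly the labels up to \<open>n\<close> belong to tree
  edges, so the translation is equivariant along the lift, and \<open>tracks_map\<close> and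
  \<open>tracks_unique\<close> apply.\<close>

lemma essential_loop_moves_vertex:
  assumes \<alpha>: "\<alpha> \<in> H_loops" and n: "2 \<le> n" and y: "tree_lift n \<alpha> y" "y 1 \<noteq> 0"
  obtains k v where "v \<noteq> alternating k"
    "\<And>m. n \<le> m \<Longrightarrow> carries (trunc_act m) (Gam_star w) \<alpha> (alternating k) v"
proof -
  let ?g = "\<lambda>t. edge_source (y t)"
  note tr = tracks_lift[OF \<alpha> y(1)]
  let ?\<rho> = "edge_source (y 1)"
  have \<rho>: "?\<rho> \<in> fword n" "?\<rho> \<noteq> []" using tr(2)[of 1] tr(4)[of "[]"] y(2) by (auto simp: vertex_vec_Nil)
  have fin: "finite {u \<in> fword n. \<exists>i\<ge>1. free_act n i u = v}" if v: "v \<in> fword n" for v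
  proof -
    have "u \<in> insert v ((\<lambda>i. rmul v (i, False)) ` {..n})" if u: "u \<in> fword n" "free_act n i u = v" for u i
    proof (cases "i \<le> n")
      case True
      have "is_reduced u" using u(1) by (simp add: fword_def)
      then have "u = rmul v (i, False)"
        using rmul_rmul_inv[of u "(i, True)"] u(2) True by (simp add: free_act_def)
      then show ?thesis using True by blast
    next
      case False
      then show ?thesis using u by (simp add: free_act_def)
    qed
    then have "{u \<in> fword n. \<exists>i\<ge>1. free_act n i u = v} \<subseteq> insert v ((\<lambda>i. rmul v (i, False)) ` {..n})" by blast
    then show ?thesis by (rule finite_subset) simp
  qed
  have "finite (?g ` {0..1})"
    by (rule tracks_finite[OF compact_Icc H_loopsD(2)[OF \<alpha>] tr(1,2) fin])
  moreover have "?g ` {0..1} \<subseteq> fword n" using tr(2) by blast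
  ultimately obtain z where z: "\<forall>l\<in>set z. fst l \<in> {1..n}" "\<And>b. reduce (z @ b) = reduce b"
    "\<And>u. u \<in> ?g ` {0..1} \<Longrightarrow> \<exists>k\<le>length z. reduce (take k z) = u"
    using word_visiting by meson
  \<comment> \<open>The cancelling pair of letters with index \<open>n\<close> forces
    \<open>nmin w j = n\<close> even if no other letter has this index.\<close>
  let ?w = "z @ [(n, True), (n, False)] @ ?\<rho>"
  have wn: "\<forall>l\<in>set ?w. fst l \<in> {1..n}" using z(1) \<rho>(1) n by (auto simp: fword_def)
  then have "?w \<in> words - {[]}" by (auto simp: words_iff)
  then obtain j where j: "1 \<le> j" "w j = ?w" using enum by (metis atLeast_iff imageE)
  have wu: "words_upto k = {x. \<forall>l\<in>set x. fst l \<in> {1..k}}" for k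
    unfolding words_upto_def by (simp add: case_prod_beta)
  have nm: "nmin w j = n"
    unfolding nmin_def
  proof (rule Least_equality)
    show "2 \<le> n \<and> w j \<in> words_upto n" using n wn unfolding j(2) wu by blast
    show "n \<le> n'" if "2 \<le> n' \<and> w j \<in> words_upto n'" for n'
      using that unfolding j(2) wu by simp
  qed
  let ?h = "hat_word w j"
  let ?\<phi> = "\<lambda>g. reduce (?h @ g)"
  have \<phi>Z: "?\<phi> (?g t) \<in> Zset w j" if t: "t \<in> {0..1}" for t
  proof -
    obtain k where k: "k \<le> length z" "reduce (take k z) = ?g t" using z(3)[OF imageI[OF t]] by blast
    then have "?\<phi> (?g t) = reduce (?h @ take k (w j))"
      using reduce_append_right[of ?h "take k z"] j(2) by simp
    moreover have "k \<le> length (w j)" using k j(2) by simp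
    ultimately show ?thesis unfolding Zset_def by blast
  qed
  have act: "?\<phi> (free_act n i (?g t)) = trunc_act m i (?\<phi> (?g t))"
    if t: "t \<in> {0..1}" and i: "1 \<le> i" and m: "n \<le> m" for t i m
  proof -
    note Zs = Zset_Gam_star[OF j(1) \<phi>Z[OF t]]
    have red: "is_reduced (?g t)" using tr(2)[OF t] by (simp add: fword_def)
    show ?thesis
    proof (cases "i \<le> n")
      case True
      then have "i \<in> E_set w (?\<phi> (?g t))" using Zs(2) nm i by simp
      then have "trunc_act m i (?\<phi> (?g t)) = rmul (?\<phi> (?g t)) (i, True)"
        using True m by (simp add: trunc_act_def act_def)
      also have "\<dots> = reduce (?h @ ?g t @ [(i, True)])" by (rule reduce_append_snoc[symmetric])
      also have "\<dots> = ?\<phi> (rmul (?g t) (i, True))"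
        unfolding reduce_snoc[OF red, symmetric] by (rule reduce_append_right[symmetric])
      finally show ?thesis using True by (simp add: free_act_def)
    next
      case False
      then have "i \<notin> E_set w (?\<phi> (?g t))" using Zs(2) nm by simp
      then show ?thesis using False by (simp add: trunc_act_def act_def free_act_def)
    qed
  qed
  have "?\<phi> ?\<rho> \<noteq> ?h"
    using reduce_append_eqD[OF reduced_hat_word, of ?\<rho>] \<rho> by (auto simp: fword_def)
  moreover have "carries (trunc_act m) (Gam_star w) \<alpha> ?h (?\<phi> ?\<rho>)" if m: "n \<le> m" for m
    unfolding carries_def
  proof (intro allI impI)
    fix G assume G: "tracks (trunc_act m) {0..1} \<alpha> G" "\<forall>t\<in>{0..1}. G t \<in> Gam_star w" "G 0 = ?h"
    have t: "tracks (trunc_act m) {0..1} \<alpha> (\<lambda>t. ?\<phi> (?g t))"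
      by (rule tracks_map[OF tr(1), of ?\<phi>]) (rule act[OF _ _ m])
    have Z: "?\<phi> (?g t) \<in> Gam_star w" if "t \<in> {0..1}" for t
      using Zset_Gam_star(1)[OF j(1) \<phi>Z[OF that]] .
    show "G 1 = ?\<phi> (?g 1)"
    proof (rule tracks_unique[OF connected_Icc H_loopsD(2)[OF \<alpha>] G(1) _ t Z inj_on_trunc_act, of 0 1])
      show "G 0 = ?\<phi> (?g 0)" using G(3) tr(3) reduce_reduced[OF reduced_hat_word] by simp
    qed (use G(2) in auto)
  qed
  ultimately show ?thesis using that unfolding hat_word_alternating by blast
qed

lemma K_subgroup_lift:
  assumes \<gamma>: "\<gamma> \<in> H_loops" and K: "loop_class (top_of_set hawaiian) (0, 0) \<gamma> \<in> K_subgroup w"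
  obtains f where "f \<in> loops_at (hat_space w) (Vertex [])"
    "loop_homotopic (top_of_set hawaiian) (0, 0) \<gamma> (q_map \<circ> f)"
proof -
  let ?H = "top_of_set hawaiian"
  obtain A where A: "A \<in> carrier (fundamental_group (hat_space w) (Vertex []))"
    "loop_class ?H (0, 0) \<gamma> = induced_map ?H (0, 0) q_map A"
    using K unfolding K_subgroup_def by blast
  then obtain f where f: "f \<in> loops_at (hat_space w) (Vertex [])" "A = loop_class (hat_space w) (Vertex []) f"
    by (auto simp: fundamental_group_def)
  have fA: "f \<in> A" using f loop_homotopic_refl by (simp add: loop_class_def)
  have "continuous_map (top_of_set {0..1}) ?H (q_map \<circ> f)"
    using f(1) by (intro continuous_map_compose[OF _ continuous_map_q_map]) (simp add: loops_at_def pathin_def)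
  then have qf: "q_map \<circ> f \<in> H_loops" using f(1) by (simp add: loops_at_def pathin_def)
  then have "q_map \<circ> f \<in> loop_class ?H (0, 0) (q_map \<circ> f)"
    using loop_homotopic_refl by (simp add: loop_class_def)
  then have "q_map \<circ> f \<in> loop_class ?H (0, 0) \<gamma>"
    unfolding A(2) induced_map_def using fA by blast
  then have "loop_homotopic ?H (0, 0) \<gamma> (q_map \<circ> f)" by (simp add: loop_class_def)
  then show ?thesis using that f(1) by blast
qed

text \<open>If the conjugate were in \<open>K\<close>, its lift would be pinned from both ends: read
  forwards, it is at \<open>v\<close> after the first two pieces; read backwards from the root along
  the last piece, it is at \<open>alternating k\<close> at the same moment.\<close>

lemma essential_loop_conjugate_not_in_K:
  assumes \<alpha>: "\<alpha> \<in> H_loops" and ess: "\<not> loop_homotopic (top_of_set hawaiian) (0, 0) (\<lambda>_. (0, 0)) \<alpha>"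
  obtains \<beta> where "\<beta> \<in> H_loops"
    "loop_class (top_of_set hawaiian) (0, 0) (loop_join (loop_join \<beta> \<alpha>) (\<beta> \<circ> (\<lambda>t. 1 - t))) \<notin> K_subgroup w"
proof -
  obtain n y where ny: "2 \<le> n" "tree_lift n \<alpha> y" "y 1 \<noteq> 0"
    using null_homotopic_if_lifts_closed[OF \<alpha>] ess by blast
  obtain k v where v: "v \<noteq> alternating k"
    "\<And>m. n \<le> m \<Longrightarrow> carries (trunc_act m) (Gam_star w) \<alpha> (alternating k) v"
    by (rule essential_loop_moves_vertex[OF \<alpha> ny]) blast
  obtain \<beta> where \<beta>: "\<beta> \<in> H_loops" "\<And>m. 2 \<le> m \<Longrightarrow> carries (trunc_act m) (Gam_star w) \<beta> [] (alternating k)"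
    using ray_loop[of k] by blast
  let ?r = "\<beta> \<circ> (\<lambda>t. 1 - t)"
  let ?\<gamma> = "loop_join (loop_join \<beta> \<alpha>) ?r"
  have r: "?r \<in> H_loops" by (rule loop_reverse[OF \<beta>(1)])
  have j: "loop_join \<beta> \<alpha> \<in> H_loops" by (rule loop_join_loops[OF \<beta>(1) \<alpha>])
  have \<gamma>: "?\<gamma> \<in> H_loops" by (rule loop_join_loops[OF j r])
  have "loop_class (top_of_set hawaiian) (0, 0) ?\<gamma> \<notin> K_subgroup w"
  proof
    assume "loop_class (top_of_set hawaiian) (0, 0) ?\<gamma> \<in> K_subgroup w"
    then obtain f where f: "f \<in> loops_at (hat_space w) (Vertex [])"
      "loop_homotopic (top_of_set hawaiian) (0, 0) ?\<gamma> (q_map \<circ> f)"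
      by (rule K_subgroup_lift[OF \<gamma>])
    obtain m0 where m0: "\<And>m x. m0 \<le> m \<Longrightarrow> tree_lift m (q_map \<circ> f) x \<Longrightarrow> word_act (edge_source (x 1)) [] = []"
      by (rule closed_lift_fixes_root[OF f(1)]) blast
    define m where "m = max m0 n"
    have m: "m0 \<le> m" "n \<le> m" "2 \<le> m" using ny(1) by (auto simp: m_def)
    obtain x where x: "tree_lift m ?\<gamma> x" by (rule tree_lift_exists[OF \<gamma>])
    obtain x' where x': "tree_lift m (q_map \<circ> f) x'"
      by (rule tree_lift_exists[OF loop_homotopic_imp_loops(2)[OF f(2)]])
    have "x 1 = x' 1" by (rule tree_lift_homotopic[OF f(2) x x'])
    \<comment> \<open>The lift of the conjugate to the tree, pushed into the graph by the action on
      the root; it follows the truncated action whether or not a path in the graph realizes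
      it.\<close>
    define G where "G t = word_act (edge_source (x t)) []" for t
    have nil: "[] \<in> Gam_star w" using alternating_Gam_star[of 0] by (simp add: alternating_def)
    have G: "tracks (trunc_act m) {0..1} ?\<gamma> G" "\<And>t. G t \<in> Gam_star w"
      using tracks_word_act[OF \<gamma> x nil] word_act_in[OF nil] by (simp_all add: G_def[abs_def])
    have G01: "G 0 = []" "G 1 = []"
      using tracks_lift(3)[OF \<gamma> x] m0[OF m(1) x'] \<open>x 1 = x' 1\<close> by (simp_all add: G_def word_act_def)
    have e: "loop_join \<beta> \<alpha> 1 = ?r 0" "\<beta> 1 = \<alpha> 0"
      using H_loopsD(3,4)[OF j] H_loopsD(3,4)[OF r] H_loopsD(3,4)[OF \<beta>(1)] H_loopsD(3,4)[OF \<alpha>] by simp_all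
    have "carries (trunc_act m) (Gam_star w) (loop_join \<beta> \<alpha>) [] v"
      by (rule carries_loop_join[OF \<beta>(2)[OF m(3)] v(2)[OF m(2)] e(2)])
    then have "G (1 / 2) = v"
      using tracks_loop_join(1)[OF G(1) e(1)] G(2) G01(1) unfolding carries_def by fastforce
    moreover have "G ((0 + 1) / 2) = alternating k"
      by (rule carries_reverse[OF \<beta>(2)[OF m(3)] tracks_loop_join(2)[OF G(1) e(1)]]) (use G(2) G01(2) in auto)
    ultimately show False using v(1) by simp
  qed
  then show ?thesis using that \<beta>(1) by blast
qed

end

theorem proposition4p2:
  fixes w :: "nat \<Rightarrow> word"
  assumes "w ` {1..} = words - {[]}"
  shows "\<forall>N. N \<lhd> fundamental_group (top_of_set hawaiian) (0, 0) \<and> N \<subseteq> K_subgroup w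
           \<longrightarrow> N = {\<one>\<^bsub>fundamental_group (top_of_set hawaiian) (0, 0)\<^esub>}"
proof (intro allI impI)
  let ?X = "top_of_set hawaiian" and ?x = "(0, 0) :: real \<times> real"
  let ?G = "fundamental_group ?X ?x" and ?c = "loop_class ?X ?x"
  interpret word_enumeration w by unfold_locales (rule assms)
  have x: "?x \<in> topspace ?X" using zero_hawaiian by simp
  interpret G: group ?G by (rule group_fundamental_group[OF x])
  fix N assume N: "N \<lhd> ?G \<and> N \<subseteq> K_subgroup w"
  then interpret N: normal N ?G by blast
  have "a = \<one>\<^bsub>?G\<^esub>" if a: "a \<in> N" for a
  proof (rule ccontr)
    assume ne: "a \<noteq> \<one>\<^bsub>?G\<^esub>"
    have "a \<in> carrier ?G" using a N.subset by blast
    then obtain \<alpha> where \<alpha>: "\<alpha> \<in> H_loops" "a = ?c \<alpha>" by (auto simp: fundamental_group_def)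
    have "\<not> loop_homotopic ?X ?x (\<lambda>_. ?x) \<alpha>"
      using ne loop_class_eq_iff[OF const_loop[OF x] \<alpha>(1)] \<alpha>(2) by (auto simp: fundamental_group_def)
    then obtain \<beta> where \<beta>: "\<beta> \<in> H_loops"
      "?c (loop_join (loop_join \<beta> \<alpha>) (\<beta> \<circ> (\<lambda>t. 1 - t))) \<notin> K_subgroup w"
      by (rule essential_loop_conjugate_not_in_K[OF \<alpha>(1)])
    have "?c \<beta> \<in> carrier ?G" using \<beta>(1) by (simp add: fundamental_group_def)
    then have "?c \<beta> \<otimes>\<^bsub>?G\<^esub> a \<otimes>\<^bsub>?G\<^esub> inv\<^bsub>?G\<^esub> (?c \<beta>) \<in> N" using a by (rule N.inv_op_closed2)
    then have "?c (loop_join (loop_join \<beta> \<alpha>) (\<beta> \<circ> (\<lambda>t. 1 - t))) \<in> N"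
      by (simp add: inv_loop_class[OF x \<beta>(1)] \<alpha>(2) fundamental_group_mult \<alpha>(1) \<beta>(1) loop_join_loops loop_reverse)
    then show False using \<beta>(2) N by blast
  qed
  then show "N = {\<one>\<^bsub>?G\<^esub>}" using N.one_closed by blast
qed

end
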